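(* Let $n\ge1$ and let $\kappa(n):=\|e_1\vee\cdots\vee e_n\|_{\pi s+,\ell_1^n}$; then $\kappa(n)=c_{\pi,s+}(n,\ell_1)$. (i) If $\mathbf{X}=(X_1,\dots,X_n)$ is an exchangeable random vector with values in $S^n$, where $S$ is an arbitrary measurable space, then its distribution $\mu_{\mathbf{X}}\in\mathcal P(S^n)$ has a representation $$\mu_{\mathbf{X}}=\int_{\mathcal P(S)}\nu^n\,d\lambda(\nu)\qquad(\ast)$$ (meaning $\mu_{\mathbf{X}}(A)=\int_{\mathcal P(S)}\nu^n(A)\,d\lambda(\nu)$ for all measurable $A\subseteq S^n$, where $\nu^n$ is the product measure) with a signed measure $\lambda\in\mathcal M(\mathcal P(S))$ satisfying $\|\lambda\|_{\mathcal M(\mathcal P(S))}\le\kappa(n)$. The constant $\kappa(n)$ is in general best possible: there exist a measurable space $S$ and an exchangeable $\mathbf X$ in $S^n$ such that every signed measure $\lambda$ satisfying $(\ast)$ has $\|\lambda\|\ge\kappa(n)$. Moreover, $$\frac{n^n}{n!}\le\kappa(n)\le2^{n-1}\frac{n^n}{n!}.$$ (ii) If furthermore $S$ is finite with $|S|=m$, then $\lambda$ in $(\ast)$ can be chosen with $\|\lambda\|_{\mathcal M(\mathcal P(S))}\le c_{\pi,s+}(n,\ell_1^m)$, and this constant is best possible for the given $S$, i.e. it is the smallest constant $M$ such that every exchangeable distribution on $S^n$ has a representation $(\ast)$ with $\|\lambda\|\le M$. If $m\ge n$, then $c_{\pi,s+}(n,\ell_1^m)=\kappa(n)$.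
   Context: For a measurable space $S$, $\mathcal M(S)$ is the space of finite signed measures on $S$ with total variation norm, and $\mathcal P(S)\subseteq\mathcal M(S)$ the probability measures; $\mathcal P(S)$ is given the $\sigma$-field generated by the maps $\mu\mapsto\mu(A)$, $A\subseteq S$ measurable, and $\mathcal M(\mathcal P(S))$ denotes finite signed measures on this measurable space. A random vector $(X_1,\dots,X_n)$ in $S^n$ is exchangeable if its distribution is invariant under permutations of the coordinates. Tensor notation (real scalars): for a normed space $E$, $E^{\otimes n}$ is the algebraic tensor power, $E^{\vee n}$ the symmetric tensors, $x^{\otimes n}:=x\otimes\cdots\otimes x$, $x_1\vee\cdots\vee x_n:=\frac1{n!}\sum_{\sigma\in\mathfrak S_n}x_{\sigma(1)}\otimes\cdots\otimes x_{\sigma(n)}$; $\|\mathbf{x}\|_{\pi,E}:=\inf\{\sum_k|a_k|\prod_i\|x_{ik}\| : \mathbf{x}=\sum_k a_k x_{1k}\otimes\cdots\otimes x_{nk}\}$. $\ell_1^m$ ($1\le m<\infty$) is $\mathbb{R}^m$ with the $\ell_1$-norm and $\ell_1=\ell_1^\infty$, ordered coordinatewise (positive = nonnegative coordinates), with standard basis $(e_i)$. For $E=\ell_1^m$ (or $\ell_1$), $\|\mathbf{x}\|_{\pi s+,E}:=\inf\{\sum_k|a_k|\,\|x_k\|^n : \mathbf{x}=\sum_k a_k x_k^{\otimes n},\ x_k\ge0\}$ (finite sums), and $c_{\pi,s+}(n,E):=\sup\{\|\mathbf{x}\|_{\pi s+,E}/\|\mathbf{x}\|_{\pi,E}: 0\ne\mathbf{x}\in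 E^{\vee n}\}$. *)

theory Defs
  imports "HOL-Probability.Probability"
begin

section \<open>The sequence spaces l1(I), I a set of indices (l1^m: I = {..<m}; l1: I = UNIV)\<close>

definition l1vec :: "nat set \<Rightarrow> (nat \<Rightarrow> real) set" where
  "l1vec I = {x. (\<forall>j. j \<notin> I \<longrightarrow> x j = 0) \<and> summable (\<lambda>j. \<bar>x j\<bar>)}"

definition l1norm :: "(nat \<Rightarrow> real) \<Rightarrow> real" where
  "l1norm x = (\<Sum>j. \<bar>x j\<bar>)"

definition unitvec :: "nat \<Rightarrow> nat \<Rightarrow> real" where
  "unitvec i = (\<lambda>j. if j = i then 1 else 0)"

section \<open>Algebraic tensor powers, realised as arrays indexed by index lists of length n\<close>

definition tprod :: "nat \<Rightarrow> (nat \<Rightarrow> nat \<Rightarrow> real) \<Rightarrow> nat list \<Rightarrow> real" where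
  "tprod n xs = (\<lambda>js. if length js = n then (\<Prod>i<n. xs i (js ! i)) else 0)"

definition tpow :: "nat \<Rightarrow> (nat \<Rightarrow> real) \<Rightarrow> nat list \<Rightarrow> real" where
  "tpow n x = tprod n (\<lambda>_. x)"

definition tvee :: "nat \<Rightarrow> (nat \<Rightarrow> nat \<Rightarrow> real) \<Rightarrow> nat list \<Rightarrow> real" where
  "tvee n xs = (\<lambda>js. (1 / fact n) * (\<Sum>\<sigma>\<in>{\<sigma>. \<sigma> permutes {..<n}}. tprod n (xs \<circ> \<sigma>) js))"

definition tensor_pow :: "nat set \<Rightarrow> nat \<Rightarrow> (nat list \<Rightarrow> real) set" where
  "tensor_pow I n = {t. \<exists>(K::nat) a xs. (\<forall>k<K. \<forall>i<n. xs k i \<in> l1vec I)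
                       \<and> t = (\<lambda>js. \<Sum>k<K. a k * tprod n (xs k) js)}"

definition permute_idx :: "(nat \<Rightarrow> nat) \<Rightarrow> nat list \<Rightarrow> nat list" where
  "permute_idx \<sigma> js = map (\<lambda>i. js ! \<sigma> i) [0..<length js]"

definition sym_tensor_pow :: "nat set \<Rightarrow> nat \<Rightarrow> (nat list \<Rightarrow> real) set" where
  "sym_tensor_pow I n = {t \<in> tensor_pow I n. \<forall>\<sigma>. \<sigma> permutes {..<n} \<longrightarrow>
                         (\<forall>js. t (permute_idx \<sigma> js) = t js)}"

definition proj_norm :: "nat set \<Rightarrow> nat \<Rightarrow> (nat list \<Rightarrow> real) \<Rightarrow> real" where
  "proj_norm I n t = Inf {(\<Sum>k<K. \<bar>a k\<bar> * (\<Prod>i<n. l1norm (xs k i))) | (K::nat) a xs.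
       (\<forall>k<K. \<forall>i<n. xs k i \<in> l1vec I) \<and> t = (\<lambda>js. \<Sum>k<K. a k * tprod n (xs k) js)}"

definition pis_norm :: "nat set \<Rightarrow> nat \<Rightarrow> (nat list \<Rightarrow> real) \<Rightarrow> real" where
  "pis_norm I n t = Inf {(\<Sum>k<K. \<bar>a k\<bar> * l1norm (x k) ^ n) | (K::nat) a x.
       (\<forall>k<K. x k \<in> l1vec I \<and> (\<forall>j. x k j \<ge> 0)) \<and> t = (\<lambda>js. \<Sum>k<K. a k * tpow n (x k) js)}"

definition c_pis :: "nat \<Rightarrow> nat set \<Rightarrow> real" where
  "c_pis n I = Sup {pis_norm I n t / proj_norm I n t | t. t \<in> sym_tensor_pow I n \<and> t \<noteq> (\<lambda>_. 0)}"

definition kappa :: "nat \<Rightarrow> real" where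
  "kappa n = pis_norm {..<n} n (tvee n unitvec)"

definition Sn :: "'a measure \<Rightarrow> nat \<Rightarrow> (nat \<Rightarrow> 'a) measure" where
  "Sn M n = PiM {..<n} (\<lambda>_. M)"

definition permute_coords :: "nat \<Rightarrow> (nat \<Rightarrow> nat) \<Rightarrow> (nat \<Rightarrow> 'a) \<Rightarrow> (nat \<Rightarrow> 'a)" where
  "permute_coords n \<sigma> x = restrict (\<lambda>i. x (\<sigma> i)) {..<n}"

definition exch_dist :: "'a measure \<Rightarrow> nat \<Rightarrow> (nat \<Rightarrow> 'a) measure \<Rightarrow> bool" where
  "exch_dist M n \<mu> \<longleftrightarrow> prob_space \<mu> \<and> sets \<mu> = sets (Sn M n) \<and>
     (\<forall>\<sigma>. \<sigma> permutes {..<n} \<longrightarrow> distr \<mu> (Sn M n) (permute_coords n \<sigma>) = \<mu>)"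

definition exchangeable :: "'b measure \<Rightarrow> 'a measure \<Rightarrow> nat \<Rightarrow> ('b \<Rightarrow> nat \<Rightarrow> 'a) \<Rightarrow> bool" where
  "exchangeable P M n X \<longleftrightarrow> prob_space P \<and> X \<in> measurable P (Sn M n) \<and>
     (\<forall>\<sigma>. \<sigma> permutes {..<n} \<longrightarrow>
        distr P (Sn M n) (\<lambda>\<omega>. permute_coords n \<sigma> (X \<omega>)) = distr P (Sn M n) X)"

text \<open>A finite signed measure lambda on P(S) (= prob_algebra M, whose sigma-field is generated
  by the evaluations nu |-> nu(A)) is given as lambda = alpha - beta with finite measures
  alpha, beta.  represents: mu(A) = integral over P(S) of nu^n(A) d lambda(nu).\<close>
definition represents :: "'a measure \<Rightarrow> nat \<Rightarrow> (nat \<Rightarrow> 'a) measure \<Rightarrow> 'a measure measure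
    \<Rightarrow> 'a measure measure \<Rightarrow> bool" where
  "represents M n \<mu> \<alpha> \<beta> \<longleftrightarrow> finite_measure \<alpha> \<and> finite_measure \<beta> \<and>
     sets \<alpha> = sets (prob_algebra M) \<and> sets \<beta> = sets (prob_algebra M) \<and>
     (\<forall>A \<in> sets (Sn M n). measure \<mu> A =
        (\<integral>\<nu>. measure (Sn \<nu> n) A \<partial>\<alpha>) - (\<integral>\<nu>. measure (Sn \<nu> n) A \<partial>\<beta>))"

definition tv_norm :: "'c measure \<Rightarrow> 'c measure \<Rightarrow> 'c measure \<Rightarrow> real" where
  "tv_norm K \<alpha> \<beta> = Sup {(\<Sum>i<k. \<bar>measure \<alpha> (B i) - measure \<beta> (B i)\<bar>) | (k::nat) B.
       (\<forall>i<k. B i \<in> sets K) \<and> disjoint_family_on B {..<k}}"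

end

(* Everything is governed by one tensor. A representation of e_1 v ... v e_n as a combination of powers
   x_k^n of probability vectors x_k on {1..n} can be evaluated at a random sample: with
   nu_k(X) := sum_j x_k(j) delta_(X_j), the same combination of the powers nu_k(X)^n is the symmetrisation
   of delta_X, and averaging over an exchangeable X yields its law. Applied to arbitrary positive vectors
   in place of point masses (and, after splitting into positive and negative parts, to all vectors), the
   same substitution shows that e_1 v ... v e_n is the worst symmetric tensor, so c_pis(n, l1) = kappa(n).
   The infimum is attained by a Caratheodory reduction followed by compactness. Conversely, for a finite
   state space a representing signed measure is discretised to a finite positive representation of a
   nearby symmetric tensor, and the error is controlled by the finite constant kappa(n) itself. The bounds
   for kappa(n) are the polarization formula, with each subset paired with its complement, and AM-GM at
   the coordinate (1,...,n). *)

theory Submission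
  imports Defs
begin

section \<open>Arrays\<close>

text \<open>The infimum has to be attained because the claim is the bound kappa(n) itself, without
  an epsilon; compactness in turn needs representations of one fixed length, which is the role of
  the Caratheodory step. Both existence claims are instances of \<open>represents_tensor\<close>:
  given a random tuple H of points and a tensor t, a representation of t by powers of probability
  vectors y_k becomes a combination of the laws of the random measures sum_j y_k(j) delta_(H_j).
  Besides the random sample with the unit tensor, the case used for a finite space takes for H a
  fixed enumeration and for t the array of point masses of mu. In the converse direction a law on a
  finite space is a nonnegative symmetric array of total 1, and on l1^m the projective norm is the
  sum of the absolute entries. So the ratio in \<open>c_pis\<close> need only be controlled on laws:
  other symmetric arrays split by the sign of their entries. Splitting costs no constant, since the
  l1 norm is additive over positive and negative parts, for vectors as well as for arrays.\<close>

text \<open>Tensors take lists as indices, but multi-indices are summed over as functions in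
  \<open>PiE\<close>, where \<open>prod_sum_PiE\<close> applies and permutations act by composition.
  \<open>idx\<close> translates between the two.\<close>

definition idx :: "nat \<Rightarrow> (nat \<Rightarrow> nat) \<Rightarrow> nat list" where
  "idx n g = map g [0..<n]"

abbreviation grid :: "nat \<Rightarrow> nat \<Rightarrow> (nat \<Rightarrow> nat) set" where
  "grid n m \<equiv> {..<n} \<rightarrow>\<^sub>E {..<m}"

definition supported :: "nat \<Rightarrow> nat \<Rightarrow> (nat list \<Rightarrow> real) \<Rightarrow> bool" where
  "supported m n t \<longleftrightarrow> (\<forall>js. \<not> (length js = n \<and> set js \<subseteq> {..<m}) \<longrightarrow> t js = 0)"

lemma length_idx [simp]: "length (idx n g) = n"
  by (simp add: idx_def)

lemma nth_idx [simp]: "i < n \<Longrightarrow> idx n g ! i = g i"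
  by (simp add: idx_def)

lemma set_idx: "set (idx n g) = g ` {..<n}"
  by (auto simp: idx_def)

lemma idx_cong: "(\<And>i. i < n \<Longrightarrow> g i = h i) \<Longrightarrow> idx n g = idx n h"
  by (simp add: idx_def)

lemma idx_nth: "length js = n \<Longrightarrow> idx n (\<lambda>i. js ! i) = js"
  by (rule nth_equalityI) auto

lemma tensor_eqI:
  assumes "\<And>js. length js \<noteq> n \<Longrightarrow> s js = t js" "\<And>g. s (idx n g) = t (idx n g)"
  shows "s = t"
proof
  fix js show "s js = t js"
    using assms(1)[of js] assms(2)[of "\<lambda>i. js ! i"] idx_nth[of js n] by fastforce
qed

lemma supported_eqI:
  assumes "supported m n s" "supported m n t" "\<And>g. g \<in> grid n m \<Longrightarrow> s (idx n g) = t (idx n g)"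
  shows "s = t"
proof
  fix js show "s js = t js"
  proof (cases "length js = n \<and> set js \<subseteq> {..<m}")
    case True
    let ?g = "restrict (\<lambda>i. js ! i) {..<n}"
    have "idx n ?g = js" using True idx_nth[of js n] by (metis idx_cong lessThan_iff restrict_apply)
    moreover have "?g \<in> grid n m" using True by (force simp: subset_iff)
    ultimately show ?thesis using assms(3) by metis
  qed (use assms(1,2) in \<open>auto simp: supported_def\<close>)
qed

lemma finite_grid [simp]: "finite (grid n m)"
  by (simp add: finite_PiE)

lemma tprod_idx [simp]: "tprod n xs (idx n g) = (\<Prod>i<n. xs i (g i))"
  by (simp add: tprod_def)

lemma tpow_idx [simp]: "tpow n x (idx n g) = (\<Prod>i<n. x (g i))"
  by (simp add: tpow_def)

lemma tprod_length [simp]: "length js \<noteq> n \<Longrightarrow> tprod n xs js = 0"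
  by (simp add: tprod_def)

lemma tpow_length [simp]: "length js \<noteq> n \<Longrightarrow> tpow n x js = 0"
  by (simp add: tpow_def)

lemma tvee_length [simp]: "length js \<noteq> n \<Longrightarrow> tvee n xs js = 0"
  by (simp add: tvee_def)

lemma tvee_idx: "tvee n xs (idx n g) = (1 / fact n) * (\<Sum>\<sigma> | \<sigma> permutes {..<n}. \<Prod>i<n. xs (\<sigma> i) (g i))"
  by (simp add: tvee_def)

text \<open>Summing over inverse permutations moves the permutation from the factors to the index.
  In this form symmetrising a tensor is visibly averaging over permutations of its index.\<close>

lemma tvee_idx': "tvee n xs (idx n g) = (1 / fact n) * (\<Sum>\<sigma> | \<sigma> permutes {..<n}. \<Prod>i<n. xs i (g (\<sigma> i)))"
proof -
  have "(\<Sum>\<sigma> | \<sigma> permutes {..<n}. \<Prod>i<n. xs (\<sigma> i) (g i))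
      = (\<Sum>\<sigma> | \<sigma> permutes {..<n}. \<Prod>i<n. xs (inv \<sigma> i) (g i))"
    by (rule sum_permutations_inverse)
  also have "\<dots> = (\<Sum>\<sigma> | \<sigma> permutes {..<n}. \<Prod>i<n. xs i (g (\<sigma> i)))"
  proof (intro sum.cong refl)
    fix \<sigma> assume "\<sigma> \<in> {\<sigma>. \<sigma> permutes {..<n}}"
    then have s: "\<sigma> permutes {..<n}" by simp
    show "(\<Prod>i<n. xs (inv \<sigma> i) (g i)) = (\<Prod>i<n. xs i (g (\<sigma> i)))"
      using prod.permute[OF s, of "\<lambda>i. xs (inv \<sigma> i) (g i)"] by (simp add: permutes_inverses[OF s])
  qed
  finally show ?thesis by (simp add: tvee_idx)
qed

lemma tvee_permute:
  assumes "\<tau> permutes {..<n}"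
  shows "tvee n xs (permute_idx \<tau> js) = tvee n xs js"
proof (cases "length js = n")
  case True
  have "(\<Sum>\<sigma> | \<sigma> permutes {..<n}. \<Prod>i<n. xs i (js ! (\<tau> (\<sigma> i))))
      = (\<Sum>\<sigma> | \<sigma> permutes {..<n}. \<Prod>i<n. xs i (js ! (\<sigma> i)))"
    using setum_permutations_compose_left[OF assms, of "\<lambda>\<sigma>. \<Prod>i<n. xs i (js ! (\<sigma> i))"] by simp
  moreover have "permute_idx \<tau> js = idx n (\<lambda>i. js ! \<tau> i)" 
    using True by (simp add: permute_idx_def idx_def)
  moreover have "tvee n xs js = tvee n xs (idx n (\<lambda>i. js ! i))" by (simp add: idx_nth True)
  ultimately show ?thesis by (simp only: tvee_idx')
qed (simp add: permute_idx_def)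

lemma permutes_lessThan: "\<sigma> permutes {..<n} \<Longrightarrow> \<sigma> i < n \<longleftrightarrow> i < n"
  using permutes_in_image[of \<sigma> "{..<n}" i] by simp

lemma tvee_nonneg: "(\<And>i j. i < n \<Longrightarrow> xs i j \<ge> 0) \<Longrightarrow> tvee n xs js \<ge> 0"
  unfolding tvee_def tprod_def
  by (auto intro!: mult_nonneg_nonneg sum_nonneg prod_nonneg divide_nonneg_nonneg simp: permutes_lessThan)

text \<open>A Kronecker delta on the grid. Members of the grid are extensional, so agreement on
  \<open>{..<n}\<close> is equality with the restriction.\<close>

lemma prod_unitvec:
  fixes n :: nat
  assumes "g \<in> extensional {..<n}"
  shows "(\<Prod>i<n. unitvec (h i) (g i)) = (if g = restrict h {..<n} then 1 else 0)"
proof (cases "g = restrict h {..<n}")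
  case False
  then obtain i where "i < n" "g i \<noteq> h i"
    using assms by (metis (no_types, lifting) extensionalityI lessThan_iff restrict_apply restrict_extensional)
  then have "(\<Prod>i<n. unitvec (h i) (g i)) = 0" by (auto simp: unitvec_def intro!: prod_zero)
  then show ?thesis using False by simp
qed (auto simp: unitvec_def)

lemma restrict_permutes_grid: "\<sigma> permutes {..<n} \<Longrightarrow> n \<le> m \<Longrightarrow> restrict \<sigma> {..<n} \<in> grid n m"
  by (auto simp: permutes_lessThan less_le_trans[of _ n m])

text \<open>Pairing with the unit tensor is averaging over permutations. With different F this
  transports representations to other vectors, computes the projective norm and uses
  exchangeability.\<close>

lemma sum_tvee_unitvec:
  "(\<Sum>g\<in>grid n n. tvee n unitvec (idx n g) * F g)
     = (1 / fact n) * (\<Sum>\<sigma> | \<sigma> permutes {..<n}. F (restrict \<sigma> {..<n}))" for F :: "_ \<Rightarrow> real"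
proof -
  have "(\<Sum>g\<in>grid n n. tvee n unitvec (idx n g) * F g)
      = (1 / fact n) * (\<Sum>g\<in>grid n n. \<Sum>\<sigma> | \<sigma> permutes {..<n}. (\<Prod>i<n. unitvec (\<sigma> i) (g i)) * F g)"
    by (simp add: tvee_idx sum_distrib_left sum_distrib_right mult_ac)
  also have "(\<Sum>g\<in>grid n n. \<Sum>\<sigma> | \<sigma> permutes {..<n}. (\<Prod>i<n. unitvec (\<sigma> i) (g i)) * F g)
      = (\<Sum>\<sigma> | \<sigma> permutes {..<n}. \<Sum>g\<in>grid n n. (\<Prod>i<n. unitvec (\<sigma> i) (g i)) * F g)"
    by (rule sum.swap)
  also have "\<dots> = (\<Sum>\<sigma> | \<sigma> permutes {..<n}. F (restrict \<sigma> {..<n}))"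
  proof (intro sum.cong refl)
    fix \<sigma> assume "\<sigma> \<in> {\<sigma>. \<sigma> permutes {..<n}}"
    then have s: "restrict \<sigma> {..<n} \<in> grid n n" using restrict_permutes_grid by blast
    have "(\<Sum>g\<in>grid n n. (\<Prod>i<n. unitvec (\<sigma> i) (g i)) * F g) = (\<Sum>g\<in>grid n n. if g = restrict \<sigma> {..<n} then F g else 0)"
      by (rule sum.cong) (auto simp: prod_unitvec PiE_def)
    then show "(\<Sum>g\<in>grid n n. (\<Prod>i<n. unitvec (\<sigma> i) (g i)) * F g) = F (restrict \<sigma> {..<n})" using s by simp
  qed
  finally show ?thesis .
qed

lemma supported_tprod_unitvec:
  assumes "\<And>i. i < n \<Longrightarrow> h i < m" shows "supported m n (tprod n (\<lambda>i. unitvec (h i)))"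
proof (unfold supported_def, intro allI impI)
  fix js assume js: "\<not> (length js = n \<and> set js \<subseteq> {..<m})"
  show "tprod n (\<lambda>i. unitvec (h i)) js = 0"
  proof (cases "length js = n")
    case True
    then obtain i where "i < n" "js ! i \<ge> m" using js by (auto simp: subset_iff in_set_conv_nth not_less)
    then show ?thesis using True assms[of i] by (auto simp: tprod_def unitvec_def intro!: bexI[of _ i])
  qed simp
qed

lemma supported_sum:
  assumes "\<And>k. k \<in> A \<Longrightarrow> supported m n (f k)"
  shows "supported m n (\<lambda>js. \<Sum>k\<in>A. a k * f k js)"
  using assms by (auto simp: supported_def intro!: sum.neutral)

lemma supported_tvee_unitvec: "supported n n (tvee n unitvec)"
proof -
  have "supported n n (\<lambda>js. \<Sum>\<sigma>\<in>{\<sigma>. \<sigma> permutes {..<n}}. (1 / fact n) * tprod n (\<lambda>i. unitvec (\<sigma> i)) js)"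
    by (rule supported_sum, rule supported_tprod_unitvec) (auto simp: permutes_lessThan)
  then show ?thesis by (simp add: tvee_def o_def sum_distrib_left)
qed

text \<open>Only the identity permutation contributes at the index (0,...,n-1). This entry drives
  the lower bound for kappa and shows that the unit tensor is nonzero.\<close>

lemma tvee_unitvec_id: "tvee n unitvec (idx n id) = 1 / fact n"
proof -
  have "(\<Sum>\<sigma> | \<sigma> permutes {..<n}. \<Prod>i<n. unitvec (\<sigma> i) (id i)) = (\<Sum>\<sigma> | \<sigma> permutes {..<n}. if \<sigma> = id then 1 else 0)"
  proof (intro sum.cong refl)
    fix \<sigma> assume "\<sigma> \<in> {\<sigma>. \<sigma> permutes {..<n}}"
    then have s: "\<sigma> permutes {..<n}" by simp
    show "(\<Prod>i<n. unitvec (\<sigma> i) (id i)) = (if \<sigma> = id then 1 else 0 :: real)"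
    proof (cases "\<sigma> = id")
      case False
      then obtain i where "\<sigma> i \<noteq> i" by (auto simp: fun_eq_iff)
      moreover from this have "i < n" using s by (meson lessThan_iff permutes_def)
      ultimately show ?thesis using False by (auto simp: unitvec_def intro!: bexI[of _ i])
    qed (simp add: unitvec_def)
  qed
  then show ?thesis by (simp add: tvee_idx permutes_id finite_permutations)
qed

section \<open>Vectors of l1\<close>

lemma l1vec_finite: "finite I \<Longrightarrow> x \<in> l1vec I \<longleftrightarrow> (\<forall>j. j \<notin> I \<longrightarrow> x j = 0)"
  unfolding l1vec_def by (auto intro!: summable_finite)

lemma l1norm_finite: "x \<in> l1vec {..<m} \<Longrightarrow> l1norm x = (\<Sum>j<m. \<bar>x j\<bar>)"
  unfolding l1norm_def by (rule suminf_finite) (auto simp: l1vec_finite)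

lemma l1norm_nonneg: "x \<in> l1vec I \<Longrightarrow> l1norm x \<ge> 0"
  unfolding l1norm_def l1vec_def by (auto intro: suminf_nonneg)

lemma sum_le_l1norm: "x \<in> l1vec I \<Longrightarrow> finite A \<Longrightarrow> (\<Sum>j\<in>A. \<bar>x j\<bar>) \<le> l1norm x"
  unfolding l1norm_def l1vec_def by (auto intro!: sum_le_suminf)

lemma l1norm_eq_0: "x \<in> l1vec I \<Longrightarrow> l1norm x = 0 \<longleftrightarrow> x = (\<lambda>_. 0)"
  unfolding l1norm_def l1vec_def by (auto simp: suminf_eq_zero_iff)

lemma unitvec_l1vec: "i \<in> I \<Longrightarrow> unitvec i \<in> l1vec I"
  unfolding l1vec_def unitvec_def by (auto intro!: summable_finite[of "{i}"])

lemma l1norm_unitvec [simp]: "l1norm (unitvec i) = 1"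
  unfolding l1norm_def unitvec_def using suminf_finite[of "{i}" "\<lambda>j. \<bar>if j = i then 1 else 0 :: real\<bar>"] by simp

lemma scale_l1vec: "x \<in> l1vec I \<Longrightarrow> (\<lambda>j. c * x j) \<in> l1vec I"
  unfolding l1vec_def by (auto simp: abs_mult intro: summable_mult)

lemma l1norm_scale: "x \<in> l1vec I \<Longrightarrow> l1norm (\<lambda>j. c * x j) = \<bar>c\<bar> * l1norm x"
  unfolding l1vec_def l1norm_def by (auto simp: abs_mult intro: suminf_mult)

lemma sum_l1vec:
  assumes "finite A" "\<And>k. k \<in> A \<Longrightarrow> x k \<in> l1vec I"
  shows "(\<lambda>j. \<Sum>k\<in>A. x k j) \<in> l1vec I"
proof -
  have s: "summable (\<lambda>j. \<Sum>k\<in>A. \<bar>x k j\<bar>)" using assms by (intro summable_sum) (auto simp: l1vec_def)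
  have "summable (\<lambda>j. \<bar>\<Sum>k\<in>A. x k j\<bar>)" by (rule summable_comparison_test'[OF s, of 0]) auto
  then show ?thesis using assms by (auto simp: l1vec_def)
qed

lemma l1norm_sum_nonneg:
  assumes "finite A" "\<And>k. k \<in> A \<Longrightarrow> x k \<in> l1vec I" "\<And>k j. k \<in> A \<Longrightarrow> x k j \<ge> 0"
  shows "l1norm (\<lambda>j. \<Sum>k\<in>A. x k j) = (\<Sum>k\<in>A. l1norm (x k))"
proof -
  have "(\<lambda>j. \<bar>\<Sum>k\<in>A. x k j\<bar>) = (\<lambda>j. \<Sum>k\<in>A. \<bar>x k j\<bar>)" using assms by (auto simp: sum_nonneg)
  then show ?thesis unfolding l1norm_def using assms by (simp add: suminf_sum l1vec_def)
qed

definition posp :: "(nat \<Rightarrow> real) \<Rightarrow> nat \<Rightarrow> real" where "posp x = (\<lambda>j. max (x j) 0)"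
definition negp :: "(nat \<Rightarrow> real) \<Rightarrow> nat \<Rightarrow> real" where "negp x = (\<lambda>j. max (- x j) 0)"

lemma posp_l1vec: "x \<in> l1vec I \<Longrightarrow> posp x \<in> l1vec I"
  unfolding l1vec_def posp_def
  by (auto intro!: summable_comparison_test'[of "\<lambda>j. \<bar>x j\<bar>" 0])

lemma negp_l1vec: "x \<in> l1vec I \<Longrightarrow> negp x \<in> l1vec I"
  unfolding l1vec_def negp_def
  by (auto intro!: summable_comparison_test'[of "\<lambda>j. \<bar>x j\<bar>" 0])

lemma l1norm_posp_negp: "x \<in> l1vec I \<Longrightarrow> l1norm (posp x) + l1norm (negp x) = l1norm x"
proof -
  assume x: "x \<in> l1vec I"
  have "(\<lambda>j. \<bar>x j\<bar>) = (\<lambda>j. \<bar>posp x j\<bar> + \<bar>negp x j\<bar>)" by (auto simp: posp_def negp_def)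
  then show ?thesis unfolding l1norm_def using posp_l1vec[OF x] negp_l1vec[OF x]
    by (simp add: suminf_add l1vec_def)
qed

lemma supported_tpow:
  assumes "x \<in> l1vec {..<m}" shows "supported m n (tpow n x)"
proof (unfold supported_def, intro allI impI)
  fix js assume js: "\<not> (length js = n \<and> set js \<subseteq> {..<m})"
  show "tpow n x js = 0"
  proof (cases "length js = n")
    case True
    then obtain i where "i < n" "js ! i \<ge> m" using js by (auto simp: subset_iff in_set_conv_nth not_less)
    then show ?thesis using True assms by (auto simp: tpow_def tprod_def l1vec_finite intro!: bexI[of _ i])
  qed simp
qed

section \<open>Positive symmetric representations\<close>

text \<open>A representation together with its cost c, so that \<open>pis_norm\<close> is an infimum
  of costs. As \<open>Inf\<close> of an empty set of reals carries no information, later lemmas take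
  some \<open>pis_rep\<close> as a witness that the set is nonempty.\<close>

definition pis_rep :: "nat set \<Rightarrow> nat \<Rightarrow> (nat list \<Rightarrow> real) \<Rightarrow> real \<Rightarrow> bool" where
  "pis_rep I n t c \<longleftrightarrow> (\<exists>(K::nat) a x. (\<forall>k<K. x k \<in> l1vec I \<and> (\<forall>j. x k j \<ge> 0)) \<and>
     t = (\<lambda>js. \<Sum>k<K. a k * tpow n (x k) js) \<and> c = (\<Sum>k<K. \<bar>a k\<bar> * l1norm (x k) ^ n))"

lemma pis_norm_eq: "pis_norm I n t = Inf {c. pis_rep I n t c}"
  unfolding pis_norm_def pis_rep_def by (rule arg_cong[of _ _ Inf]) auto

lemma pis_repI:
  assumes "finite A" "\<And>k. k \<in> A \<Longrightarrow> x k \<in> l1vec I" "\<And>k j. k \<in> A \<Longrightarrow> x k j \<ge> 0"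
    and "\<And>js. t js = (\<Sum>k\<in>A. a k * tpow n (x k) js)" "c = (\<Sum>k\<in>A. \<bar>a k\<bar> * l1norm (x k) ^ n)"
  shows "pis_rep I n t c"
proof -
  obtain b where b: "bij_betw b {..<card A} A" using ex_bij_betw_nat_finite[OF assms(1)]
    by (auto simp: atLeast0LessThan)
  show ?thesis unfolding pis_rep_def
    apply (rule exI[of _ "card A"], rule exI[of _ "a \<circ> b"], rule exI[of _ "x \<circ> b"])
    using b assms bij_betwE[OF b]
      sum.reindex_bij_betw[OF b, of "\<lambda>k. \<bar>a k\<bar> * l1norm (x k) ^ n"]
      sum.reindex_bij_betw[OF b, of "\<lambda>k. a k * tpow n (x k) js" for js]
    by (auto simp: fun_eq_iff)
qed

lemma pis_rep_nonneg: "pis_rep I n t c \<Longrightarrow> c \<ge> 0"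
  unfolding pis_rep_def by (auto intro!: sum_nonneg mult_nonneg_nonneg zero_le_power l1norm_nonneg)

lemma pis_norm_le: "pis_rep I n t c \<Longrightarrow> pis_norm I n t \<le> c"
  unfolding pis_norm_eq by (rule cInf_lower) (auto intro!: bdd_belowI[of _ 0] pis_rep_nonneg)

lemma pis_norm_ge: "pis_rep I n t c \<Longrightarrow> (\<And>d. pis_rep I n t d \<Longrightarrow> b \<le> d) \<Longrightarrow> b \<le> pis_norm I n t"
  unfolding pis_norm_eq by (rule cInf_greatest) auto

lemma pis_rep_zero: "pis_rep I n (\<lambda>_. 0) 0"
  by (rule pis_repI[of "{}"]) auto

text \<open>Representations are concatenated over a \<open>Sigma\<close> index set, so costs add up
  with weights.\<close>

lemma pis_rep_sum:
  assumes "finite A" "\<And>k. k \<in> A \<Longrightarrow> pis_rep I n (t k) (c k)"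
  shows "pis_rep I n (\<lambda>js. \<Sum>k\<in>A. b k * t k js) (\<Sum>k\<in>A. \<bar>b k\<bar> * c k)"
proof -
  have "\<forall>k\<in>A. pis_rep I n (t k) (c k)" using assms(2) by blast
  then obtain K a x where h: "\<forall>k\<in>A. (\<forall>i<K k. x k i \<in> l1vec I \<and> (\<forall>j. x k i j \<ge> 0)) \<and>
     t k = (\<lambda>js. \<Sum>i<(K k::nat). a k i * tpow n (x k i) js) \<and> c k = (\<Sum>i<K k. \<bar>a k i\<bar> * l1norm (x k i) ^ n)"
    unfolding pis_rep_def bchoice_iff by (elim exE) (rule that)
  show ?thesis
  proof (rule pis_repI[where A="SIGMA k:A. {..<K k}" and a="\<lambda>(k,i). b k * a k i" and x="\<lambda>(k,i). x k i"])
    show "(\<Sum>k\<in>A. b k * t k js) = (\<Sum>k\<in>Sigma A (\<lambda>k. {..<K k}). (case k of (k, i) \<Rightarrow> b k * a k i) * tpow n (case k of (k, i) \<Rightarrow> x k i) js)" for js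
      using h assms(1) by (simp add: sum.Sigma case_prod_unfold sum_distrib_left mult.assoc)
    show "(\<Sum>k\<in>A. \<bar>b k\<bar> * c k) = (\<Sum>k\<in>Sigma A (\<lambda>k. {..<K k}). \<bar>case k of (k, i) \<Rightarrow> b k * a k i\<bar> * l1norm (case k of (k, i) \<Rightarrow> x k i) ^ n)"
      using h assms(1) by (simp add: sum.Sigma case_prod_unfold sum_distrib_left mult.assoc abs_mult)
  qed (use h assms(1) in auto)
qed

lemma pis_norm_lincomb:
  assumes "pis_rep I n s c" "pis_rep I n t d"
  shows "pis_norm I n (\<lambda>js. a * s js + b * t js) \<le> \<bar>a\<bar> * pis_norm I n s + \<bar>b\<bar> * pis_norm I n t"
proof (rule field_le_epsilon)
  fix e :: real assume e: "e > 0"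
  \<comment> \<open>The tolerance is shared by both near-optimal representations; the summand 1
    keeps the denominator positive when both scalars vanish.\<close>
  define e' where "e' = e / (\<bar>a\<bar> + \<bar>b\<bar> + 1)"
  have pos: "\<bar>a\<bar> + \<bar>b\<bar> + 1 > 0" by simp
  have e': "e' > 0" unfolding e'_def using e pos by simp
  have ex: "\<exists>c'. pis_rep I n u c' \<and> c' < pis_norm I n u + e'" if "pis_rep I n u c''" for u c''
    using that cInf_lessD[of "{c. pis_rep I n u c}" "pis_norm I n u + e'"] e' unfolding pis_norm_eq by auto
  obtain c' where c': "pis_rep I n s c'" "c' < pis_norm I n s + e'" using ex[OF assms(1)] by auto
  obtain d' where d': "pis_rep I n t d'" "d' < pis_norm I n t + e'" using ex[OF assms(2)] by auto
  have "pis_rep I n (\<lambda>js. \<Sum>k\<in>{True,False}. (if k then a else b) * (if k then s else t) js)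
     (\<Sum>k\<in>{True,False}. \<bar>if k then a else b\<bar> * (if k then c' else d'))"
    by (rule pis_rep_sum) (use c' d' in auto)
  then have "pis_norm I n (\<lambda>js. a * s js + b * t js) \<le> \<bar>a\<bar> * c' + \<bar>b\<bar> * d'"
    using pis_norm_le by force
  also have "\<dots> \<le> \<bar>a\<bar> * (pis_norm I n s + e') + \<bar>b\<bar> * (pis_norm I n t + e')"
    using c' d' by (intro add_mono mult_left_mono) auto
  also have "\<dots> = \<bar>a\<bar> * pis_norm I n s + \<bar>b\<bar> * pis_norm I n t + (\<bar>a\<bar> + \<bar>b\<bar>) * e'" by (simp add: algebra_simps)
  also have "(\<bar>a\<bar> + \<bar>b\<bar>) * e' \<le> (\<bar>a\<bar> + \<bar>b\<bar> + 1) * e'" using e' by (intro mult_right_mono) auto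
  also have "(\<bar>a\<bar> + \<bar>b\<bar> + 1) * e' = e" unfolding e'_def using pos by simp
  finally show "pis_norm I n (\<lambda>js. a * s js + b * t js) \<le> \<bar>a\<bar> * pis_norm I n s + \<bar>b\<bar> * pis_norm I n t + e" by simp
qed

section \<open>Polarization and the bounds for kappa\<close>

lemma sum_Pow_alternating: "finite U \<Longrightarrow> (\<Sum>W\<in>Pow U. (-1 :: real) ^ card W) = (if U = {} then 1 else 0)"
  using prod_add[of U "\<lambda>_. -1 :: real" "\<lambda>_. 1"] by (auto simp: power_0_left)

lemma tvee_unitvec_grid:
  assumes g: "g \<in> grid n n"
  shows "tvee n unitvec (idx n g) = (if g ` {..<n} = {..<n} then 1 / fact n else 0)"
proof -
  have eq: "tvee n unitvec (idx n g) = (1 / fact n) * (\<Sum>\<sigma> | \<sigma> permutes {..<n}. if g = restrict \<sigma> {..<n} then 1 else 0)"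
    using g by (auto simp: tvee_idx prod_unitvec PiE_def intro!: sum.cong)
  show ?thesis
  proof (cases "g ` {..<n} = {..<n}")
    case True
    \<comment> \<open>A surjection of the finite set onto itself is injective; extending g by the
      identity makes it a \<open>permutes\<close>, and it is the only permutation
      contributing.\<close>
    define s where "s = (\<lambda>i. if i < n then g i else i)"
    have "inj_on g {..<n}" using True by (simp add: eq_card_imp_inj_on)
    then have "bij_betw s {..<n} {..<n}" using True unfolding s_def
      by (auto simp: bij_betw_def inj_on_def)
    then have s: "s permutes {..<n}" by (rule bij_imp_permutes) (simp add: s_def)
    have "g = restrict \<sigma> {..<n} \<longleftrightarrow> \<sigma> = s" if "\<sigma> permutes {..<n}" for \<sigma>
    proof
      assume h: "g = restrict \<sigma> {..<n}"
      have "\<sigma> i = s i" for i using that h by (cases "i < n") (auto simp: s_def permutes_def)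
      then show "\<sigma> = s" by blast
    next
      assume "\<sigma> = s"
      then show "g = restrict \<sigma> {..<n}" using g by (auto simp: s_def PiE_def extensional_def)
    qed
    then have "(\<Sum>\<sigma> | \<sigma> permutes {..<n}. if g = restrict \<sigma> {..<n} then 1 else 0 :: real)
        = (\<Sum>\<sigma> | \<sigma> permutes {..<n}. if \<sigma> = s then 1 else 0)" by (intro sum.cong) auto
    then show ?thesis using True s by (simp add: eq finite_permutations)
  next
    case False
    have "g \<noteq> restrict \<sigma> {..<n}" if "\<sigma> permutes {..<n}" for \<sigma>
      using False permutes_image[OF that] by (metis image_restrict_eq)
    then show ?thesis using False by (simp add: eq)
  qed
qed

text \<open>The sum of the basis vectors left after omitting W; indexing by the omitted set makes
  the sign in the polarization formula (-1)^|W|.\<close>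

definition block :: "nat \<Rightarrow> nat set \<Rightarrow> nat \<Rightarrow> real" where
  "block n W = (\<lambda>j. if j < n \<and> j \<notin> W then 1 else 0)"

lemma block_l1vec: "block n W \<in> l1vec {..<n}"
  by (simp add: l1vec_finite block_def)

lemma block_nonneg: "block n W j \<ge> 0"
  by (simp add: block_def)

lemma l1norm_block: "l1norm (block n W) = card ({..<n} - W)"
proof -
  have "l1norm (block n W) = (\<Sum>j<n. if j \<notin> W then 1 else 0)"
    unfolding l1norm_finite[OF block_l1vec] by (rule sum.cong) (auto simp: block_def)
  also have "\<dots> = (\<Sum>j\<in>{..<n} - W. 1)" by (simp add: sum.If_cases Diff_eq Collect_neg_eq)
  finally show ?thesis by simp
qed

text \<open>Inclusion-exclusion over the values that an index misses.\<close>

lemma polarization: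
  "tvee n unitvec js = (\<Sum>W\<in>Pow {..<n}. ((-1) ^ card W / fact n) * tpow n (block n W) js)"
proof -
  have "tvee n unitvec = (\<lambda>js. \<Sum>W\<in>Pow {..<n}. ((-1) ^ card W / fact n) * tpow n (block n W) js)"
  proof (rule supported_eqI[OF supported_tvee_unitvec])
    show "supported n n (\<lambda>js. \<Sum>W\<in>Pow {..<n}. ((-1) ^ card W / fact n) * tpow n (block n W) js)"
      by (intro supported_sum supported_tpow block_l1vec)
    fix g assume g: "g \<in> grid n n"
    \<comment> \<open>The power of a block is nonzero at g exactly when W avoids the values of g,
      that is W lies in \<open>?U\<close>. The alternating sum over such W vanishes unless
      \<open>?U\<close> is empty, which leaves the bijective g.\<close>
    let ?U = "{..<n} - g ` {..<n}"
    have gn: "i < n \<Longrightarrow> g i < n" for i using g by auto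
    have "(\<Prod>i<n. block n W (g i)) = (if W \<inter> g ` {..<n} = {} then 1 else 0)" for W
    proof (cases "W \<inter> g ` {..<n} = {}")
      case True
      then have "g i \<notin> W" if "i < n" for i using that by auto
      then show ?thesis using True by (auto simp: block_def gn)
    qed (auto simp: block_def gn intro!: prod_zero)
    then have "(\<Sum>W\<in>Pow {..<n}. ((-1) ^ card W / fact n) * tpow n (block n W) (idx n g))
        = (\<Sum>W\<in>Pow {..<n}. if W \<inter> g ` {..<n} = {} then (-1) ^ card W / fact n else 0)"
      by (intro sum.cong) auto
    also have "\<dots> = (\<Sum>W\<in>Pow ?U. (-1) ^ card W / fact n)"
      by (rule sum.mono_neutral_cong_right) auto
    also have "\<dots> = (\<Sum>W\<in>Pow ?U. (-1) ^ card W) / fact n" by (simp add: sum_divide_distrib)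
    also have "\<dots> = (if ?U = {} then 1 else 0) / fact n" by (subst sum_Pow_alternating) auto
    also have "\<dots> = tvee n unitvec (idx n g)" using gn by (auto simp: tvee_unitvec_grid[OF g])
    finally show "tvee n unitvec (idx n g) = (\<Sum>W\<in>Pow {..<n}. ((-1) ^ card W / fact n) * tpow n (block n W) (idx n g))" ..
  qed
  then show ?thesis by metis
qed

lemma pis_rep_tvee_unitvec:
  "pis_rep {..<n} n (tvee n unitvec) (\<Sum>W\<in>Pow {..<n}. real (card ({..<n} - W)) ^ n / fact n)"
  by (rule pis_repI[where A="Pow {..<n}" and a="\<lambda>W. (-1) ^ card W / fact n" and x="block n"])
     (auto simp: block_l1vec block_nonneg polarization l1norm_block power_abs)

lemma kappa_le:
  assumes "n \<ge> 1" shows "kappa n \<le> 2 ^ (n - 1) * real n ^ n / fact n"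
proof -
  let ?S = "\<Sum>W\<in>Pow {..<n}. real (card ({..<n} - W)) ^ n"
  have eq: "?S = (\<Sum>W\<in>Pow {..<n}. real (card W) ^ n)"
    by (rule sum.reindex_bij_witness[of _ "\<lambda>W. {..<n} - W" "\<lambda>W. {..<n} - W"]) (auto simp: double_diff)
  have "2 * ?S = (\<Sum>W\<in>Pow {..<n}. real (card ({..<n} - W)) ^ n + real (card W) ^ n)"
    using eq by (simp add: sum.distrib)
  also have "\<dots> \<le> (\<Sum>W\<in>Pow {..<n}. real n ^ n)"
  proof (rule sum_mono)
    fix W assume "W \<in> Pow {..<n}"
    then have W: "card ({..<n} - W) + card W = n"
      by (metis PowD card_Diff_subset card_lessThan card_mono finite_lessThan finite_subset le_add_diff_inverse2)
    obtain k where k: "n = Suc k" using assms by (cases n) auto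
    let ?p = "real (card ({..<n} - W))" let ?q = "real (card W)"
    have pq: "?p + ?q = real n" using W by linarith
    \<comment> \<open>One factor of each power is kept and the other n-1 are bounded by n; the kept
      factors add up to n.\<close>
    have "?p ^ n + ?q ^ n = ?p * ?p ^ k + ?q * ?q ^ k" by (simp add: k)
    also have "\<dots> \<le> ?p * real n ^ k + ?q * real n ^ k"
      using pq by (intro add_mono mult_left_mono power_mono) auto
    also have "\<dots> = real n ^ n" using pq by (simp add: k flip: distrib_right)
    finally show "?p ^ n + ?q ^ n \<le> real n ^ n" .
  qed
  \<comment> \<open>There are 2^n sets W, and the left side counts the sum twice: hence the exponent
    n-1.\<close>
  also have "\<dots> = 2 * (2 ^ (n - 1) * real n ^ n)" using assms by (cases n) (auto simp: card_Pow)
  finally have "?S \<le> 2 ^ (n - 1) * real n ^ n" by simp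
  then have "?S / fact n \<le> 2 ^ (n - 1) * real n ^ n / fact n" by (intro divide_right_mono) auto
  moreover have "kappa n \<le> ?S / fact n"
    unfolding kappa_def using pis_norm_le[OF pis_rep_tvee_unitvec] by (simp add: sum_divide_distrib)
  ultimately show ?thesis by linarith
qed

lemma prod_le_mean_power:
  fixes x :: "nat \<Rightarrow> real"
  assumes "n \<ge> 1" "\<And>i. i < n \<Longrightarrow> x i \<ge> 0"
  shows "(\<Prod>i<n. x i) \<le> ((\<Sum>i<n. x i) / real n) ^ n"
proof -
  let ?P = "\<Prod>i<n. x i"
  have P: "?P \<ge> 0" using assms by (intro prod_nonneg) auto
  have "?P powr (1 / real n) \<le> (\<Sum>i<n. x i) / real n"
    using arith_geom_mean[of "{..<n}" x] assms
    by (auto simp: sum_divide_distrib lessThan_empty_iff bot_nat_def)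
  then have "(?P powr (1 / real n)) ^ n \<le> ((\<Sum>i<n. x i) / real n) ^ n"
    by (intro power_mono) auto
  moreover have "(?P powr (1 / real n)) ^ n = ?P"
  proof (cases "?P = 0")
    case True
    show ?thesis unfolding True using assms(1) by (simp add: power_0_left)
  qed (use P assms(1) in \<open>simp add: powr_power\<close>)
  ultimately show ?thesis by simp
qed

lemma le_kappa:
  assumes "n \<ge> 1" shows "real n ^ n / fact n \<le> kappa n"
  unfolding kappa_def
proof (rule pis_norm_ge[OF pis_rep_tvee_unitvec])
  fix c assume "pis_rep {..<n} n (tvee n unitvec) c"
  then obtain K a x where h: "\<forall>k<K. x k \<in> l1vec {..<n} \<and> (\<forall>j. x k j \<ge> 0)"
    "tvee n unitvec = (\<lambda>js. \<Sum>k<(K::nat). a k * tpow n (x k) js)" "c = (\<Sum>k<K. \<bar>a k\<bar> * l1norm (x k) ^ n)"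
    unfolding pis_rep_def by blast
  \<comment> \<open>Every power contributes the product of all n coordinates to this entry, so AM-GM
    bounds it by the n-th power of norm/n.\<close>
  have "1 / fact n = (\<Sum>k<K. a k * (\<Prod>i<n. x k i))"
    using tvee_unitvec_id[of n] unfolding h(2) by simp
  also have "\<dots> \<le> (\<Sum>k<K. \<bar>a k\<bar> * (l1norm (x k) ^ n / real n ^ n))"
  proof (rule sum_mono)
    fix k assume "k \<in> {..<K}"
    then have k: "k < K" by simp
    have "a k * (\<Prod>i<n. x k i) \<le> \<bar>a k\<bar> * (\<Prod>i<n. x k i)"
      using h k by (intro mult_right_mono prod_nonneg) auto
    also have "\<dots> \<le> \<bar>a k\<bar> * ((\<Sum>i<n. x k i) / real n) ^ n"
      using h k assms by (intro mult_left_mono prod_le_mean_power) auto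
    also have "(\<Sum>i<n. x k i) = l1norm (x k)"
    proof -
      have "x k \<in> l1vec {..<n}" "\<And>j. x k j \<ge> 0" using h(1) k by auto
      then show ?thesis by (simp add: l1norm_finite)
    qed
    finally show "a k * (\<Prod>i<n. x k i) \<le> \<bar>a k\<bar> * (l1norm (x k) ^ n / real n ^ n)" by (simp add: power_divide)
  qed
  also have "\<dots> = c / real n ^ n" by (simp add: h(3) sum_divide_distrib)
  finally show "real n ^ n / fact n \<le> c" using assms by (simp add: field_simps)
qed

lemma kappa_pos: "n \<ge> 1 \<Longrightarrow> kappa n > 0"
  using le_kappa[of n] by (metis divide_pos_pos fact_gt_zero less_le_trans of_nat_0_less_iff zero_less_power not_gr_zero not_one_le_zero)

section \<open>The infimum is attained for finitely many coordinates\<close>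

text \<open>Gaussian elimination: a vector p that is nonzero in coordinate j clears this coordinate
  from all the others, leaving one coordinate and one vector fewer.\<close>

lemma linear_dependence:
  fixes v :: "'k \<Rightarrow> 'j \<Rightarrow> real"
  assumes "finite J" "finite A" "card J < card A"
  shows "\<exists>c. (\<exists>k\<in>A. c k \<noteq> 0) \<and> (\<forall>j\<in>J. (\<Sum>k\<in>A. c k * v k j) = 0)"
  using assms
proof (induction J arbitrary: A v rule: finite_induct)
  case empty
  then obtain k where "k \<in> A" by fastforce
  then show ?case by (intro exI[of _ "\<lambda>_. 1"]) auto
next
  case (insert j J)
  show ?case
  proof (cases "\<forall>k\<in>A. v k j = 0")
    case True
    then show ?thesis using insert.IH[of A v] insert.prems insert.hyps by auto
  next
    case False
    then obtain p where p: "p \<in> A" "v p j \<noteq> 0" by blast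
    let ?v = "\<lambda>k i. v k i - v k j / v p j * v p i"
    have "card J < card (A - {p})" using insert p by simp
    then obtain c where c: "\<exists>k\<in>A - {p}. c k \<noteq> 0" "\<forall>i\<in>J. (\<Sum>k\<in>A - {p}. c k * ?v k i) = 0"
      using insert.IH[of "A - {p}" ?v] insert.prems by auto
    \<comment> \<open>The coefficient of the pivot is the one that cancels coordinate j; in the
      remaining coordinates it restores the original vectors from the reduced ones.\<close>
    define d where "d = c(p := - (\<Sum>k\<in>A - {p}. c k * v k j) / v p j)"
    have eq: "(\<Sum>k\<in>A. d k * v k i) = (\<Sum>k\<in>A - {p}. c k * ?v k i)" for i
    proof -
      have "(\<Sum>k\<in>A. d k * v k i) = d p * v p i + (\<Sum>k\<in>A - {p}. c k * v k i)"
        using p insert.prems by (subst sum.remove[of _ p]) (auto simp: d_def)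
      also have "\<dots> = (\<Sum>k\<in>A - {p}. c k * ?v k i)"
        by (simp add: d_def algebra_simps sum_subtractf sum_distrib_left sum_divide_distrib)
      finally show ?thesis .
    qed
    have "(\<Sum>k\<in>A. d k * v k i) = 0" if "i \<in> insert j J" for i
      using that c(2) p(2) unfolding eq by auto
    moreover have "\<exists>k\<in>A. d k \<noteq> 0" using c(1) by (auto simp: d_def)
    ultimately show ?thesis by blast
  qed
qed

text \<open>Moving the coefficients along a linear relation, in the direction in which their absolute
  sum does not increase, until one of them vanishes.\<close>

lemma caratheodory_abs:
  fixes v :: "'k \<Rightarrow> 'j \<Rightarrow> real"
  assumes "finite J" "finite A"
  shows "\<exists>B b. B \<subseteq> A \<and> card B \<le> card J \<and> (\<forall>j\<in>J. (\<Sum>k\<in>B. b k * v k j) = (\<Sum>k\<in>A. a k * v k j))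
     \<and> (\<Sum>k\<in>B. \<bar>b k\<bar>) \<le> (\<Sum>k\<in>A. \<bar>a k\<bar>)"
  using assms(2)
proof (induction "card A" arbitrary: A a rule: less_induct)
  case less
  \<comment> \<open>Once some coefficient is zero, its index is discarded and the induction
    hypothesis applies to the smaller set.\<close>
  have drop: ?case if p: "p \<in> A" "a' p = 0" and
    a': "\<And>j. j \<in> J \<Longrightarrow> (\<Sum>k\<in>A. a' k * v k j) = (\<Sum>k\<in>A. a k * v k j)" "(\<Sum>k\<in>A. \<bar>a' k\<bar>) \<le> (\<Sum>k\<in>A. \<bar>a k\<bar>)" for p a'
  proof -
    have "card (A - {p}) < card A" using p less.prems by (meson card_Diff1_less)
    from less.hyps[OF this, of a'] obtain B b where B: "B \<subseteq> A - {p}" "card B \<le> card J"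
      "\<forall>j\<in>J. (\<Sum>k\<in>B. b k * v k j) = (\<Sum>k\<in>A - {p}. a' k * v k j)" "(\<Sum>k\<in>B. \<bar>b k\<bar>) \<le> (\<Sum>k\<in>A - {p}. \<bar>a' k\<bar>)"
      using less.prems by auto
    have "(\<Sum>k\<in>A - {p}. a' k * v k j) = (\<Sum>k\<in>A. a' k * v k j)" for j
      using p less.prems by (simp add: sum.remove[of A p])
    moreover have "(\<Sum>k\<in>A - {p}. \<bar>a' k\<bar>) = (\<Sum>k\<in>A. \<bar>a' k\<bar>)"
      using p less.prems by (simp add: sum.remove[of A p])
    ultimately show ?thesis using B a' by (intro exI[of _ B] exI[of _ b]) auto
  qed
  show ?case
  proof (cases "card A \<le> card J \<or> (\<exists>p\<in>A. a p = 0)")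
    case True
    then show ?thesis
    proof
      assume "card A \<le> card J"
      then show ?thesis by (intro exI[of _ A] exI[of _ a]) auto
    next
      assume "\<exists>p\<in>A. a p = 0"
      then show ?thesis using drop[of _ a] by auto
    qed
  next
    case False
    then have nz: "\<And>k. k \<in> A \<Longrightarrow> a k \<noteq> 0" and "card J < card A" by auto
    obtain c0 where c0: "\<exists>k\<in>A. c0 k \<noteq> 0" "\<forall>j\<in>J. (\<Sum>k\<in>A. c0 k * v k j) = 0"
      using linear_dependence[OF assms(1) less.prems \<open>card J < card A\<close>, of v] by blast
    \<comment> \<open>The sum of c k * sgn (a k) is the rate at which the absolute sum falls when c
      is subtracted; the sign of the relation is chosen to make this rate nonnegative.\<close>
    define c where "c = (if (\<Sum>k\<in>A. c0 k * sgn (a k)) \<ge> 0 then c0 else (\<lambda>k. - c0 k))"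
    have c: "\<exists>k\<in>A. c k \<noteq> 0" "\<forall>j\<in>J. (\<Sum>k\<in>A. c k * v k j) = 0" "(\<Sum>k\<in>A. c k * sgn (a k)) \<ge> 0"
      using c0 by (auto simp: c_def sum_negf)
    \<comment> \<open>The coefficients that shrink. Below, \<open>r k\<close> is the time at which
      such a coefficient reaches zero and s is the first such time.\<close>
    define P where "P = {k\<in>A. c k * sgn (a k) > 0}"
    have "P \<noteq> {}"
    proof
      assume "P = {}"
      then have le: "c k * sgn (a k) \<le> 0" if "k \<in> A" for k using that by (force simp: P_def)
      then have "(\<Sum>k\<in>A. c k * sgn (a k)) = 0" using c(3) by (meson antisym sum_nonpos)
      then have "\<forall>k\<in>A. c k * sgn (a k) = 0"
        using sum_nonneg_eq_0_iff[OF less.prems, of "\<lambda>k. - (c k * sgn (a k))"] le by (simp add: sum_negf)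
      then show False using c(1) nz by (auto simp: sgn_if split: if_splits)
    qed
    have finP: "finite P" using less.prems by (simp add: P_def)
    define r where "r k = \<bar>a k\<bar> / (c k * sgn (a k))" for k
    define s where "s = Min (r ` P)"
    have "s \<in> r ` P" unfolding s_def using finP \<open>P \<noteq> {}\<close> by (intro Min_in) auto
    then obtain p where p: "p \<in> P" "s = r p" by blast
    have sle: "s \<le> r k" if "k \<in> P" for k using finP that by (simp add: s_def)
    have "s \<ge> 0" using p by (simp add: r_def P_def)
    define a' where "a' k = a k - s * c k" for k
    \<comment> \<open>No coefficient changes sign up to time s, so the absolute values are still
      linear in s.\<close>
    have abs': "\<bar>a' k\<bar> = \<bar>a k\<bar> - s * (c k * sgn (a k))" if k: "k \<in> A" for k
    proof -
      have sg: "sgn (a k) * a' k = \<bar>a k\<bar> - s * (c k * sgn (a k))"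
        by (simp add: a'_def abs_sgn algebra_simps)
      have "s * (c k * sgn (a k)) \<le> \<bar>a k\<bar>"
      proof (cases "k \<in> P")
        case True
        then show ?thesis using sle[OF True] by (simp add: r_def P_def pos_le_divide_eq)
      next
        case False
        then have "s * (c k * sgn (a k)) \<le> 0" using k \<open>s \<ge> 0\<close> by (auto simp: P_def intro: mult_nonneg_nonpos)
        then show ?thesis by linarith
      qed
      then have "sgn (a k) * a' k \<ge> 0" using sg by linarith
      moreover have "\<bar>sgn (a k) * a' k\<bar> = \<bar>a' k\<bar>" using nz[OF k] by (simp add: abs_mult abs_sgn_eq)
      ultimately show ?thesis using sg by linarith
    qed
    have "\<bar>a' p\<bar> = 0" using p abs'[of p] by (auto simp: r_def P_def)
    moreover have "(\<Sum>k\<in>A. a' k * v k j) = (\<Sum>k\<in>A. a k * v k j)" if "j \<in> J" for j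
    proof -
      have "(\<Sum>k\<in>A. a' k * v k j) = (\<Sum>k\<in>A. a k * v k j) - s * (\<Sum>k\<in>A. c k * v k j)"
        by (simp add: a'_def algebra_simps sum_subtractf sum_distrib_left)
      then show ?thesis using c(2) that by simp
    qed
    moreover have "(\<Sum>k\<in>A. \<bar>a' k\<bar>) \<le> (\<Sum>k\<in>A. \<bar>a k\<bar>)"
    proof -
      have "(\<Sum>k\<in>A. \<bar>a' k\<bar>) = (\<Sum>k\<in>A. \<bar>a k\<bar> - s * (c k * sgn (a k)))" by (intro sum.cong abs' refl)
      also have "\<dots> = (\<Sum>k\<in>A. \<bar>a k\<bar>) - s * (\<Sum>k\<in>A. c k * sgn (a k))" by (simp add: sum_subtractf sum_distrib_left)
      finally show ?thesis using c(3) \<open>s \<ge> 0\<close> by simp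
    qed
    ultimately show ?thesis using drop[of p a'] p(1) by (auto simp: P_def)
  qed
qed

definition prob_vec :: "nat \<Rightarrow> (nat \<Rightarrow> real) set" where
  "prob_vec m = {x. (\<forall>j. x j \<ge> 0) \<and> (\<forall>j\<ge>m. x j = 0) \<and> (\<Sum>j<m. x j) = 1}"

lemma prob_vec_l1vec: "x \<in> prob_vec m \<Longrightarrow> x \<in> l1vec {..<m}"
  by (auto simp: prob_vec_def l1vec_finite)

lemma l1norm_prob_vec: "x \<in> prob_vec m \<Longrightarrow> l1norm x = 1"
  by (subst l1norm_finite[OF prob_vec_l1vec]) (auto simp: prob_vec_def)

lemma unitvec_prob_vec: "i < m \<Longrightarrow> unitvec i \<in> prob_vec m"
  by (auto simp: prob_vec_def unitvec_def)

lemma pis_rep_supported: "pis_rep {..<m} n t c \<Longrightarrow> supported m n t"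
  unfolding pis_rep_def by (auto intro!: supported_sum supported_tpow)

text \<open>Norms are absorbed into coefficients, Caratheodory is applied in the space of arrays on
  the grid, and the result is padded. The number of terms D depends only on m and n, not on the
  representation, as the compactness argument requires.\<close>

lemma pis_rep_prob_vec:
  assumes m: "m \<ge> 1" and n: "n \<ge> 1" and rep: "pis_rep {..<m} n t c"
  defines "D \<equiv> card (grid n m)"
  shows "\<exists>a x. (\<forall>k<D. x k \<in> prob_vec m) \<and> (\<forall>g\<in>grid n m. t (idx n g) = (\<Sum>k<D. a k * (\<Prod>i<n. x k (g i))))
    \<and> (\<Sum>k<D. \<bar>a k\<bar>) \<le> c"
proof -
  obtain K a x where h: "\<And>k. k < K \<Longrightarrow> x k \<in> l1vec {..<m}" "\<And>k j. k < K \<Longrightarrow> x k j \<ge> 0"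
    "t = (\<lambda>js. \<Sum>k<(K::nat). a k * tpow n (x k) js)" "c = (\<Sum>k<K. \<bar>a k\<bar> * l1norm (x k) ^ n)"
    using rep unfolding pis_rep_def by blast
  \<comment> \<open>The zero vector cannot be normalised; any probability vector may replace it,
    because its new coefficient contains the factor 0^n = 0.\<close>
  define y where "y k = (if l1norm (x k) = 0 then unitvec 0 else (\<lambda>j. x k j / l1norm (x k)))" for k
  have y: "y k \<in> prob_vec m" if k: "k < K" for k
  proof (cases "l1norm (x k) = 0")
    case False
    have "(\<Sum>j<m. x k j) = l1norm (x k)" using h(1,2)[OF k] by (simp add: l1norm_finite)
    then show ?thesis using h(1,2)[OF k] False l1norm_nonneg[OF h(1)[OF k]]
      by (auto simp: prob_vec_def y_def l1vec_finite simp flip: sum_divide_distrib)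
  qed (use m in \<open>auto simp: y_def intro: unitvec_prob_vec\<close>)
  have xy: "(\<Prod>i<n. x k (g i)) = l1norm (x k) ^ n * (\<Prod>i<n. y k (g i))" if k: "k < K" for k g
  proof (cases "l1norm (x k) = 0")
    case True
    then have "x k = (\<lambda>_. 0)" using l1norm_eq_0[OF h(1)[OF k]] by simp
    then show ?thesis using n True by (auto simp: power_0_left intro!: bexI[of _ 0])
  next
    case False
    have "(\<Prod>i<n. x k (g i)) = (\<Prod>i<n. l1norm (x k) * y k (g i))" using False by (intro prod.cong) (auto simp: y_def)
    then show ?thesis by (simp add: prod.distrib)
  qed
  let ?a = "\<lambda>k. a k * l1norm (x k) ^ n"
  obtain B b where B: "B \<subseteq> {..<K}" "card B \<le> D"
    "\<forall>g\<in>grid n m. (\<Sum>k\<in>B. b k * (\<Prod>i<n. y k (g i))) = (\<Sum>k<K. ?a k * (\<Prod>i<n. y k (g i)))"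
    "(\<Sum>k\<in>B. \<bar>b k\<bar>) \<le> (\<Sum>k<K. \<bar>?a k\<bar>)"
    using caratheodory_abs[of "grid n m" "{..<K}" "\<lambda>k g. \<Prod>i<n. y k (g i)" ?a] unfolding D_def by auto
  have finB: "finite B" using B(1) finite_subset by blast
  obtain f where f: "bij_betw f {..<card B} B" using ex_bij_betw_nat_finite[OF finB]
    by (auto simp: atLeast0LessThan)
  \<comment> \<open>Padding up to length D by terms with coefficient zero.\<close>
  define a' where "a' k = (if k < card B then b (f k) else 0)" for k
  define x' where "x' k = (if k < card B then y (f k) else unitvec 0)" for k
  have red: "(\<Sum>k<D. F k) = (\<Sum>k\<in>B. G k)"
    if "\<And>k. k < card B \<Longrightarrow> F k = G (f k)" "\<And>k. k \<ge> card B \<Longrightarrow> F k = 0" for F G :: "nat \<Rightarrow> real"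
  proof -
    have "(\<Sum>k<D. F k) = (\<Sum>k<card B. F k)"
      using B(2) that(2) by (intro sum.mono_neutral_right) auto
    also have "\<dots> = (\<Sum>k<card B. G (f k))" using that(1) by (intro sum.cong) auto
    also have "\<dots> = (\<Sum>k\<in>B. G k)" by (rule sum.reindex_bij_betw[OF f])
    finally show ?thesis .
  qed
  show ?thesis
  proof (intro exI[of _ a'] exI[of _ x'] conjI ballI allI impI)
    show "x' k \<in> prob_vec m" for k
      using y B(1) bij_betwE[OF f] m by (auto simp: x'_def intro!: unitvec_prob_vec)
    show "(\<Sum>k<D. \<bar>a' k\<bar>) \<le> c"
    proof -
      have "(\<Sum>k<D. \<bar>a' k\<bar>) = (\<Sum>k\<in>B. \<bar>b k\<bar>)" by (rule red) (auto simp: a'_def)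
      also have "\<dots> \<le> (\<Sum>k<K. \<bar>?a k\<bar>)" by (rule B(4))
      also have "\<dots> = c" unfolding h(4)
        by (intro sum.cong refl) (simp add: abs_mult l1norm_nonneg[OF h(1)])
      finally show ?thesis .
    qed
    fix g assume g: "g \<in> grid n m"
    have "(\<Sum>k<D. a' k * (\<Prod>i<n. x' k (g i))) = (\<Sum>k\<in>B. b k * (\<Prod>i<n. y k (g i)))"
      by (rule red) (auto simp: a'_def x'_def)
    also have "\<dots> = (\<Sum>k<K. a k * (\<Prod>i<n. x k (g i)))" using B(3) g xy by (auto simp: mult.assoc)
    also have "\<dots> = t (idx n g)" by (simp add: h(3))
    finally show "t (idx n g) = (\<Sum>k<D. a' k * (\<Prod>i<n. x' k (g i)))" ..
  qed
qed

section \<open>Compactness of the set of representations of fixed length\<close>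

lemma continuous_on_apply: "continuous_on A (\<lambda>z::'i \<Rightarrow> real. z p)"
  by (rule continuous_on_subset[OF continuous_on_product_coordinates subset_UNIV])

lemma closed_Collect_guard: "(c \<Longrightarrow> closed {z. P z}) \<Longrightarrow> closed {z. c \<longrightarrow> P z}"
  by (cases c) auto

text \<open>Tychonoff's theorem, with the function type carrying the product topology.\<close>

lemma compact_box: "compact {z :: 'i \<Rightarrow> real. \<forall>p. z p \<in> {a..b}}"
proof -
  have "compactin (product_topology (\<lambda>i. euclidean) UNIV) (PiE (UNIV :: 'i set) (\<lambda>_. {a..b::real}))"
    unfolding compactin_PiE by (simp add: compact_Icc)
  moreover have "PiE (UNIV :: 'i set) (\<lambda>_. {a..b}) = {z. \<forall>p. z p \<in> {a..b}}" by (auto simp: PiE_def)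
  ultimately show ?thesis by (simp add: euclidean_product_topology)
qed

lemma pis_norm_attained:
  assumes m: "m \<ge> 1" and n: "n \<ge> 1" and rep: "pis_rep {..<m} n t c"
  shows "\<exists>(K::nat) a x. (\<forall>k<K. x k \<in> prob_vec m) \<and> t = (\<lambda>js. \<Sum>k<K. a k * tpow n (x k) js)
    \<and> (\<Sum>k<K. \<bar>a k\<bar>) \<le> pis_norm {..<m} n t"
proof -
  define D where "D = card (grid n m)"
  \<comment> \<open>Bounds all parameters at once: coordinates of probability vectors are at most 1,
    and coefficients are at most the cost. Only costs up to C matter, since the given representation
    already costs c.\<close>
  define C where "C = max 1 c"
  \<comment> \<open>A representation is encoded as one point z: \<open>z (k, 0)\<close> is the k-th
    coefficient and \<open>z (k, Suc j)\<close> the j-th coordinate of the k-th vector. All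
    conditions are closed.\<close>
  define good where "good = (\<lambda>z :: nat \<times> nat \<Rightarrow> real. 
     (\<forall>k<D. (\<forall>j. z (k, Suc j) \<ge> 0) \<and> (\<forall>j\<ge>m. z (k, Suc j) = 0) \<and> (\<Sum>j<m. z (k, Suc j)) = 1) \<and>
     (\<forall>g\<in>grid n m. t (idx n g) = (\<Sum>k<D. z (k, 0) * (\<Prod>i<n. z (k, Suc (g i))))))"
  define Z where "Z = {z :: nat \<times> nat \<Rightarrow> real. \<forall>p. z p \<in> {-C..C}} \<inter> {z. good z}"
  define val where "val z = (\<Sum>k<D. \<bar>z (k, 0::nat)\<bar>)" for z :: "nat \<times> nat \<Rightarrow> real"
  have "closed {z. good z}" unfolding good_def Ball_def
    by (intro closed_Collect_conj closed_Collect_all closed_Collect_guard closed_Collect_eq closed_Collect_le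
        continuous_on_const continuous_on_sum continuous_on_prod continuous_on_mult continuous_on_apply)
  then have cpt: "compact Z" unfolding Z_def using compact_box by (rule compact_Int_closed[rotated])
  have inZ: "\<exists>z\<in>Z. val z \<le> d" if d: "pis_rep {..<m} n t d" "d \<le> C" for d
  proof -
    obtain a x where ax: "\<forall>k<D. x k \<in> prob_vec m" "\<forall>g\<in>grid n m. t (idx n g) = (\<Sum>k<D. a k * (\<Prod>i<n. x k (g i)))"
      "(\<Sum>k<D. \<bar>a k\<bar>) \<le> d"
      using pis_rep_prob_vec[OF m n d(1)] unfolding D_def by blast
    define z where "z = (\<lambda>(k, j). if k < D then (case j of 0 \<Rightarrow> a k | Suc j' \<Rightarrow> x k j') else 0)"
    have "good z" using ax(1,2) by (auto simp: good_def z_def prob_vec_def)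
    moreover have "z (k, j) \<in> {-C..C}" for k j
    proof -
      have "\<bar>a k\<bar> \<le> C" if "k < D"
        using member_le_sum[of k "{..<D}" "\<lambda>k. \<bar>a k\<bar>"] that ax(3) d(2) by auto
      moreover have "\<bar>x k j\<bar> \<le> C" if "k < D" for j
        using that ax(1) sum_le_l1norm[OF prob_vec_l1vec, of "x k" m "{j}"] l1norm_prob_vec[of "x k" m]
        by (auto simp: C_def)
      moreover have "0 \<le> C" by (simp add: C_def)
      ultimately have "\<bar>z (k, j)\<bar> \<le> C" by (auto simp: z_def split: nat.split)
      then show ?thesis by auto
    qed
    ultimately have "z \<in> Z" by (auto simp: Z_def)
    moreover have "val z \<le> d" using ax(3) by (simp add: val_def z_def)
    ultimately show ?thesis by blast
  qed
  have "Z \<noteq> {}" using inZ[OF rep] by (auto simp: C_def)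
  moreover have "continuous_on Z val" unfolding val_def
    by (intro continuous_on_sum continuous_on_rabs continuous_on_apply)
  ultimately obtain z where z: "z \<in> Z" "\<And>z'. z' \<in> Z \<Longrightarrow> val z \<le> val z'"
    using continuous_attains_inf[OF cpt, of val] by blast
  \<comment> \<open>The minimiser also beats costs above C, since the given representation has cost
    at most C.\<close>
  have le: "val z \<le> d" if d: "pis_rep {..<m} n t d" for d
  proof (cases "d \<le> C")
    case True
    then show ?thesis using inZ[OF d] z(2) by fastforce
  next
    case False
    then show ?thesis using inZ[OF rep] z(2) by (fastforce simp: C_def)
  qed
  let ?x = "\<lambda>k j. z (k, Suc j)"
  have sx: "?x k \<in> prob_vec m" if "k < D" for k
    using z(1) that by (auto simp: Z_def good_def prob_vec_def)
  show ?thesis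
  proof (intro exI[of _ D] exI[of _ "\<lambda>k. z (k, 0)"] exI[of _ ?x] conjI allI impI)
    show "t = (\<lambda>js. \<Sum>k<D. z (k, 0) * tpow n (?x k) js)"
    proof (rule supported_eqI[OF pis_rep_supported[OF rep]])
      show "supported m n (\<lambda>js. \<Sum>k<D. z (k, 0) * tpow n (?x k) js)"
        by (intro supported_sum supported_tpow prob_vec_l1vec sx) simp
    qed (use z(1) in \<open>auto simp: Z_def good_def\<close>)
    show "(\<Sum>k<D. \<bar>z (k, 0)\<bar>) \<le> pis_norm {..<m} n t"
      using pis_norm_ge[OF rep le] by (simp add: val_def)
  qed (rule sx)
qed

section \<open>Comparison with the projective norm\<close>

definition symmetric :: "nat \<Rightarrow> (nat list \<Rightarrow> real) \<Rightarrow> bool" where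
  "symmetric n t \<longleftrightarrow> (\<forall>\<sigma>. \<sigma> permutes {..<n} \<longrightarrow> (\<forall>js. t (permute_idx \<sigma> js) = t js))"

lemma permute_idx_idx: "\<sigma> permutes {..<n} \<Longrightarrow> permute_idx \<sigma> (idx n g) = idx n (g \<circ> \<sigma>)"
  by (auto simp: permute_idx_def idx_def permutes_lessThan)

lemma symmetric_idx: "symmetric n t \<Longrightarrow> \<sigma> permutes {..<n} \<Longrightarrow> t (idx n (g \<circ> \<sigma>)) = t (idx n g)"
  by (metis symmetric_def permute_idx_idx)

lemma sym_tensor_pow_eq: "t \<in> sym_tensor_pow I n \<longleftrightarrow> t \<in> tensor_pow I n \<and> symmetric n t"
  by (auto simp: sym_tensor_pow_def symmetric_def)

lemma symmetric_tvee: "symmetric n (tvee n xs)"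
  by (auto simp: symmetric_def tvee_permute)

text \<open>The positive contraction from l1^n to l1(I) sending the i-th unit vector to the i-th
  normalised vector transports an optimal representation of the unit tensor.\<close>

lemma pis_rep_tvee_pos:
  assumes n: "n \<ge> 1" and x: "\<And>i. i < n \<Longrightarrow> x i \<in> l1vec I" "\<And>i j. i < n \<Longrightarrow> x i j \<ge> 0"
  shows "\<exists>c. pis_rep I n (tvee n x) c \<and> c \<le> kappa n * (\<Prod>i<n. l1norm (x i))"
\<comment> \<open>A vanishing factor cannot be normalised, but then the tensor and the bound are
  both zero.\<close>
proof (cases "\<exists>i<n. l1norm (x i) = 0")
  case True
  then obtain i where i: "i < n" "l1norm (x i) = 0" by blast
  then have "x i = (\<lambda>_. 0)" using l1norm_eq_0[OF x(1)] by simp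
  then have z: "(\<Prod>i<n. x i (g (\<sigma> i))) = 0" for g and \<sigma> :: "nat \<Rightarrow> nat"
    using i by (intro prod_zero bexI[of _ i]) auto
  have "tvee n x (idx n g) = 0" for g unfolding tvee_idx' z by simp
  then have tv: "tvee n x = (\<lambda>_. 0)" by (intro tensor_eqI[of n]) auto
  have P: "(\<Prod>i<n. l1norm (x i)) = 0" using i by (intro prod_zero) auto
  show ?thesis unfolding tv P using pis_rep_zero[of I n] by (intro exI[of _ 0]) simp
next
  case False
  then have nz: "l1norm (x i) > 0" if "i < n" for i
    using l1norm_nonneg[OF x(1)[OF that]] that by (force simp: less_le)
  obtain K a y where y: "\<And>k. k < (K::nat) \<Longrightarrow> y k \<in> prob_vec n"
    "tvee n unitvec = (\<lambda>js. \<Sum>k<K. a k * tpow n (y k) js)" "(\<Sum>k<K. \<bar>a k\<bar>) \<le> kappa n"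
    using pis_norm_attained[OF n n pis_rep_tvee_unitvec] unfolding kappa_def by metis
  let ?P = "\<Prod>i<n. l1norm (x i)"
  have P: "?P \<ge> 0" using nz by (intro prod_nonneg) (auto intro: less_imp_le)
  \<comment> \<open>\<open>z k\<close> is the image of \<open>y k\<close> under the map sending the
    l-th basis vector to the normalised vector \<open>u l\<close>; it again has norm 1 because norms
    of nonnegative vectors add.\<close>
  define u where "u i = (\<lambda>j. (1 / l1norm (x i)) * x i j)" for i
  define z where "z k = (\<lambda>j. \<Sum>l<n. y k l * u l j)" for k
  have u: "u i \<in> l1vec I" "l1norm (u i) = 1" "\<And>j. u i j \<ge> 0" if "i < n" for i
    using nz[OF that] x(2)[OF that] scale_l1vec[OF x(1)[OF that], of "1 / l1norm (x i)"]
    unfolding u_def l1norm_scale[OF x(1)[OF that]] by auto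
  have y0: "y k l \<ge> 0" if "k < K" for k l using y(1)[OF that] by (simp add: prob_vec_def)
  have z: "z k \<in> l1vec I" "l1norm (z k) = 1" "\<And>j. z k j \<ge> 0" if k: "k < K" for k
  proof -
    show "z k \<in> l1vec I" unfolding z_def using u by (intro sum_l1vec scale_l1vec) auto
    show "z k j \<ge> 0" for j unfolding z_def using u y0[OF k] by (intro sum_nonneg mult_nonneg_nonneg) auto
    have "l1norm (z k) = (\<Sum>l<n. l1norm (\<lambda>j. y k l * u l j))" unfolding z_def
      using u y0[OF k] by (intro l1norm_sum_nonneg[of _ _ I] scale_l1vec mult_nonneg_nonneg) auto
    also have "\<dots> = (\<Sum>l<n. y k l)" using u y0[OF k] by (intro sum.cong) (auto simp: l1norm_scale[OF u(1)])
    also have "\<dots> = 1" using y(1)[OF k] by (simp add: prob_vec_def)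
    finally show "l1norm (z k) = 1" .
  qed
  have tz: "(\<Sum>k<K. a k * tpow n (z k) (idx n g)) = tvee n u (idx n g)" for g
  proof -
    \<comment> \<open>Multilinear expansion: the tensor power of the map is applied to the power of
      \<open>y k\<close>, so the combination over k can be replaced by the unit tensor.\<close>
    have "tpow n (z k) (idx n g) = (\<Sum>h\<in>grid n n. tpow n (y k) (idx n h) * (\<Prod>i<n. u (h i) (g i)))" for k
      by (simp add: z_def prod_sum_PiE prod.distrib)
    then have "(\<Sum>k<K. a k * tpow n (z k) (idx n g))
        = (\<Sum>k<K. \<Sum>h\<in>grid n n. a k * tpow n (y k) (idx n h) * (\<Prod>i<n. u (h i) (g i)))"
      by (simp add: sum_distrib_left mult.assoc)
    also have "\<dots> = (\<Sum>h\<in>grid n n. (\<Sum>k<K. a k * tpow n (y k) (idx n h)) * (\<Prod>i<n. u (h i) (g i)))"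
      by (subst sum.swap) (simp add: sum_distrib_right)
    also have "\<dots> = (\<Sum>h\<in>grid n n. tvee n unitvec (idx n h) * (\<Prod>i<n. u (h i) (g i)))" by (simp add: y(2))
    also have "\<dots> = tvee n u (idx n g)" by (subst sum_tvee_unitvec, subst tvee_idx) (auto intro!: sum.cong prod.cong)
    finally show ?thesis .
  qed
  have xu': "l1norm (x i) * u i j = x i j" if "i < n" for i j using nz[OF that] by (simp add: u_def)
  have xu: "tvee n x (idx n g) = ?P * tvee n u (idx n g)" for g
  proof -
    have "(\<Prod>i<n. x i (g (\<sigma> i))) = ?P * (\<Prod>i<n. u i (g (\<sigma> i)))" for \<sigma> :: "nat \<Rightarrow> nat"
    proof -
      have "(\<Prod>i<n. x i (g (\<sigma> i))) = (\<Prod>i<n. l1norm (x i) * u i (g (\<sigma> i)))"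
        by (intro prod.cong) (auto simp: xu')
      then show ?thesis by (simp add: prod.distrib)
    qed
    then show ?thesis by (simp add: tvee_idx' sum_distrib_left mult_ac)
  qed
  have eq: "tvee n x = (\<lambda>js. \<Sum>k<K. ?P * a k * tpow n (z k) js)"
  proof (rule tensor_eqI[of n])
    fix g
    have "(\<Sum>k<K. ?P * a k * tpow n (z k) (idx n g)) = ?P * (\<Sum>k<K. a k * tpow n (z k) (idx n g))"
      by (simp add: sum_distrib_left mult.assoc)
    then show "tvee n x (idx n g) = (\<Sum>k<K. ?P * a k * tpow n (z k) (idx n g))" by (simp only: tz xu)
  qed simp
  have "pis_rep I n (tvee n x) (\<Sum>k<K. \<bar>?P * a k\<bar> * l1norm (z k) ^ n)"
    by (rule pis_repI[where A="{..<K}"]) (use z eq in auto)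
  moreover have "(\<Sum>k<K. \<bar>?P * a k\<bar> * l1norm (z k) ^ n) = ?P * (\<Sum>k<K. \<bar>a k\<bar>)"
    using z P by (simp add: abs_mult sum_distrib_left)
  moreover have "?P * (\<Sum>k<K. \<bar>a k\<bar>) \<le> kappa n * ?P" using mult_left_mono[OF y(3) P] by (simp add: mult.commute)
  ultimately show ?thesis by auto
qed

lemma prod_if_mem:
  fixes p q :: "nat \<Rightarrow> real"
  assumes "E \<subseteq> {..<n}"
  shows "(\<Prod>i<n. if i \<in> E then p i else q i) = (\<Prod>i\<in>E. p i) * (\<Prod>i\<in>{..<n} - E. q i)"
  using assms by (simp add: prod.If_cases Int_absorb1 Diff_eq Collect_neg_eq)

text \<open>Each factor is the difference of its positive and negative part; E collects the slots
  where the negative part is taken.\<close>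

lemma tvee_split_signs:
  "tvee n x js = (\<Sum>E\<in>Pow {..<n}. (-1) ^ card E * tvee n (\<lambda>i. if i \<in> E then negp (x i) else posp (x i)) js)"
proof -
  have "tvee n x = (\<lambda>js. \<Sum>E\<in>Pow {..<n}. (-1) ^ card E * tvee n (\<lambda>i. if i \<in> E then negp (x i) else posp (x i)) js)"
  proof (rule tensor_eqI[of n])
    fix g
    let ?y = "\<lambda>E i. if i \<in> E then negp (x i) else posp (x i)"
    have "(\<Prod>i<n. x i (h i)) = (\<Sum>E\<in>Pow {..<n}. (-1) ^ card E * (\<Prod>i<n. ?y E i (h i)))" for h
    proof -
      have "(\<Prod>i<n. x i (h i)) = (\<Prod>i<n. - negp (x i) (h i) + posp (x i) (h i))"
        by (intro prod.cong) (auto simp: posp_def negp_def)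
      also have "\<dots> = (\<Sum>E\<in>Pow {..<n}. (\<Prod>i\<in>E. - negp (x i) (h i)) * (\<Prod>i\<in>{..<n} - E. posp (x i) (h i)))"
        by (rule prod_add) simp
      also have "\<dots> = (\<Sum>E\<in>Pow {..<n}. (-1) ^ card E * (\<Prod>i<n. ?y E i (h i)))"
      proof (intro sum.cong refl)
        fix E assume "E \<in> Pow {..<n}"
        then have E: "E \<subseteq> {..<n}" by simp
        have "(\<Prod>i<n. ?y E i (h i)) = (\<Prod>i<n. if i \<in> E then negp (x i) (h i) else posp (x i) (h i))"
          by (intro prod.cong) auto
        then show "(\<Prod>i\<in>E. - negp (x i) (h i)) * (\<Prod>i\<in>{..<n} - E. posp (x i) (h i)) = (-1) ^ card E * (\<Prod>i<n. ?y E i (h i))"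
          unfolding prod_uminus prod_if_mem[OF E] by simp
      qed
      finally show ?thesis .
    qed
    note e = this
    have "tvee n x (idx n g) = (1 / fact n) * (\<Sum>\<sigma> | \<sigma> permutes {..<n}. \<Sum>E\<in>Pow {..<n}. (-1) ^ card E * (\<Prod>i<n. ?y E i (g (\<sigma> i))))"
      unfolding tvee_idx' by (subst e) (rule refl)
    also have "\<dots> = (\<Sum>E\<in>Pow {..<n}. (-1) ^ card E * tvee n (?y E) (idx n g))"
      unfolding tvee_idx' by (subst sum.swap) (simp add: sum_distrib_left mult_ac)
    finally show "tvee n x (idx n g) = (\<Sum>E\<in>Pow {..<n}. (-1) ^ card E * tvee n (?y E) (idx n g))" .
  qed simp
  then show ?thesis by metis
qed

lemma posp_nonneg: "posp x j \<ge> 0" and negp_nonneg: "negp x j \<ge> 0"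
  by (auto simp: posp_def negp_def)

text \<open>The 2^n bounds for the sign patterns recombine into the product of the sums of the norms
  of both parts, which is exactly the product of the norms of the factors. So signs do not worsen
  the constant.\<close>

lemma pis_rep_tvee:
  assumes n: "n \<ge> 1" and x: "\<And>i. i < n \<Longrightarrow> x i \<in> l1vec I"
  shows "\<exists>c. pis_rep I n (tvee n x) c \<and> c \<le> kappa n * (\<Prod>i<n. l1norm (x i))"
proof -
  let ?y = "\<lambda>E i. if i \<in> E then negp (x i) else posp (x i)"
  have "\<forall>E. \<exists>c. pis_rep I n (tvee n (?y E)) c \<and> c \<le> kappa n * (\<Prod>i<n. l1norm (?y E i))"
  proof
    fix E
    show "\<exists>c. pis_rep I n (tvee n (?y E)) c \<and> c \<le> kappa n * (\<Prod>i<n. l1norm (?y E i))"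
      by (rule pis_rep_tvee_pos[OF n]) (simp_all add: x posp_l1vec negp_l1vec posp_nonneg negp_nonneg)
  qed
  then obtain c where "\<forall>E. pis_rep I n (tvee n (?y E)) (c E) \<and> c E \<le> kappa n * (\<Prod>i<n. l1norm (?y E i))"
    unfolding choice_iff by (elim exE) (rule that)
  then have c: "\<And>E. pis_rep I n (tvee n (?y E)) (c E)" "\<And>E. c E \<le> kappa n * (\<Prod>i<n. l1norm (?y E i))"
    by blast+
  have "pis_rep I n (\<lambda>js. \<Sum>E\<in>Pow {..<n}. (-1) ^ card E * tvee n (?y E) js) (\<Sum>E\<in>Pow {..<n}. \<bar>(-1) ^ card E\<bar> * c E)"
    by (rule pis_rep_sum) (auto intro: c(1))
  then have "pis_rep I n (tvee n x) (\<Sum>E\<in>Pow {..<n}. c E)"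
    by (simp add: power_abs flip: tvee_split_signs)
  moreover have "(\<Sum>E\<in>Pow {..<n}. c E) \<le> kappa n * (\<Prod>i<n. l1norm (x i))"
  proof -
    have "(\<Sum>E\<in>Pow {..<n}. c E) \<le> (\<Sum>E\<in>Pow {..<n}. kappa n * (\<Prod>i<n. l1norm (?y E i)))"
      by (intro sum_mono c(2))
    also have "\<dots> = kappa n * (\<Sum>E\<in>Pow {..<n}. (\<Prod>i\<in>E. l1norm (negp (x i))) * (\<Prod>i\<in>{..<n} - E. l1norm (posp (x i))))"
      unfolding sum_distrib_left[symmetric]
      by (intro arg_cong2[where f="(*)"] refl sum.cong) (subst prod_if_mem[symmetric], auto intro: prod.cong)
    also have "\<dots> = kappa n * (\<Prod>i<n. l1norm (negp (x i)) + l1norm (posp (x i)))"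
      by (subst prod_add) auto
    also have "(\<Prod>i<n. l1norm (negp (x i)) + l1norm (posp (x i))) = (\<Prod>i<n. l1norm (x i))"
      using l1norm_posp_negp[OF x] by (intro prod.cong) (auto simp: add.commute)
    finally show ?thesis .
  qed
  ultimately show ?thesis by blast
qed

section \<open>Projective representations and symmetrisation\<close>

definition proj_rep :: "nat set \<Rightarrow> nat \<Rightarrow> (nat list \<Rightarrow> real) \<Rightarrow> real \<Rightarrow> bool" where
  "proj_rep I n t c \<longleftrightarrow> (\<exists>(K::nat) a xs. (\<forall>k<K. \<forall>i<n. xs k i \<in> l1vec I) \<and>
     t = (\<lambda>js. \<Sum>k<K. a k * tprod n (xs k) js) \<and> c = (\<Sum>k<K. \<bar>a k\<bar> * (\<Prod>i<n. l1norm (xs k i))))"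

lemma proj_norm_eq: "proj_norm I n t = Inf {c. proj_rep I n t c}"
  unfolding proj_norm_def proj_rep_def by (rule arg_cong[of _ _ Inf]) auto

lemma tensor_pow_iff: "t \<in> tensor_pow I n \<longleftrightarrow> (\<exists>c. proj_rep I n t c)"
  unfolding tensor_pow_def proj_rep_def by blast

lemma proj_rep_nonneg: "proj_rep I n t c \<Longrightarrow> c \<ge> 0"
  unfolding proj_rep_def by (auto intro!: sum_nonneg mult_nonneg_nonneg prod_nonneg l1norm_nonneg)

lemma proj_norm_le: "proj_rep I n t c \<Longrightarrow> proj_norm I n t \<le> c"
  unfolding proj_norm_eq by (rule cInf_lower) (auto intro!: bdd_belowI[of _ 0] proj_rep_nonneg)

lemma proj_norm_ge: "proj_rep I n t c \<Longrightarrow> (\<And>d. proj_rep I n t d \<Longrightarrow> b \<le> d) \<Longrightarrow> b \<le> proj_norm I n t"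
  unfolding proj_norm_eq by (rule cInf_greatest) auto

text \<open>A symmetric tensor equals its own average over index permutations, so every elementary
  tensor may be replaced by its symmetrisation while coefficients and vectors, and hence the
  projective cost, stay the same.\<close>

lemma symmetrize:
  assumes sym: "symmetric n t" and t: "t = (\<lambda>js. \<Sum>k<(K::nat). a k * tprod n (xs k) js)"
  shows "t = (\<lambda>js. \<Sum>k<K. a k * tvee n (xs k) js)"
proof (rule tensor_eqI[of n])
  fix g
  have "(\<Sum>\<sigma> | \<sigma> permutes {..<n}. t (idx n (g \<circ> \<sigma>))) = (\<Sum>\<sigma> | \<sigma> permutes {..<n}. t (idx n g))"
    by (intro sum.cong refl symmetric_idx[OF sym]) simp
  also have "\<dots> = fact n * t (idx n g)" by (simp add: card_permutations[of _ n])
  finally have "t (idx n g) = (1 / fact n) * (\<Sum>\<sigma> | \<sigma> permutes {..<n}. t (idx n (g \<circ> \<sigma>)))" by simp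
  also have "\<dots> = (1 / fact n) * (\<Sum>\<sigma> | \<sigma> permutes {..<n}. \<Sum>k<K. a k * (\<Prod>i<n. xs k i (g (\<sigma> i))))"
    by (simp add: t)
  also have "\<dots> = (\<Sum>k<K. a k * tvee n (xs k) (idx n g))"
    unfolding tvee_idx' by (subst sum.swap) (simp add: sum_distrib_left mult_ac)
  finally show "t (idx n g) = (\<Sum>k<K. a k * tvee n (xs k) (idx n g))" .
qed (simp add: t)

lemma pis_rep_if_proj_rep:
  assumes n: "n \<ge> 1" and sym: "symmetric n t" and "proj_rep I n t c"
  shows "\<exists>d. pis_rep I n t d \<and> d \<le> kappa n * c"
proof -
  obtain K a xs where h: "\<forall>k<K. \<forall>i<n. xs k i \<in> l1vec I" "t = (\<lambda>js. \<Sum>k<(K::nat). a k * tprod n (xs k) js)"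
    "c = (\<Sum>k<K. \<bar>a k\<bar> * (\<Prod>i<n. l1norm (xs k i)))"
    using assms(3) unfolding proj_rep_def by blast
  have "\<forall>k\<in>{..<K}. \<exists>d. pis_rep I n (tvee n (xs k)) d \<and> d \<le> kappa n * (\<Prod>i<n. l1norm (xs k i))"
    using h(1) by (intro ballI pis_rep_tvee[OF n]) auto
  then obtain d where d: "\<And>k. k < K \<Longrightarrow> pis_rep I n (tvee n (xs k)) (d k)"
    "\<And>k. k < K \<Longrightarrow> d k \<le> kappa n * (\<Prod>i<n. l1norm (xs k i))"
    by (metis lessThan_iff)
  have "pis_rep I n (\<lambda>js. \<Sum>k<K. a k * tvee n (xs k) js) (\<Sum>k<K. \<bar>a k\<bar> * d k)"
    by (rule pis_rep_sum) (use d(1) in auto)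
  then have "pis_rep I n t (\<Sum>k<K. \<bar>a k\<bar> * d k)" using symmetrize[OF sym h(2)] by metis
  moreover have "(\<Sum>k<K. \<bar>a k\<bar> * d k) \<le> (\<Sum>k<K. \<bar>a k\<bar> * (kappa n * (\<Prod>i<n. l1norm (xs k i))))"
    by (intro sum_mono mult_left_mono d(2)) auto
  moreover have "\<dots> = kappa n * c" by (simp add: h(3) sum_distrib_left mult_ac)
  ultimately show ?thesis by auto
qed

lemma pis_norm_le_proj_norm:
  assumes n: "n \<ge> 1" and sym: "symmetric n t" and "proj_rep I n t c"
  shows "pis_norm I n t \<le> kappa n * proj_norm I n t"
proof -
  have "pis_norm I n t / kappa n \<le> proj_norm I n t"
  proof (rule proj_norm_ge[OF assms(3)])
    fix d assume "proj_rep I n t d"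
    then show "pis_norm I n t / kappa n \<le> d"
      using pis_rep_if_proj_rep[OF n sym] pis_norm_le kappa_pos[OF n] by (fastforce simp: field_simps)
  qed
  then show ?thesis using kappa_pos[OF n] by (simp add: field_simps)
qed

text \<open>The triangle inequality entry by entry; the sum over the grid of a product of
  coordinates factorises into partial l1 norms.\<close>

lemma proj_rep_ge:
  assumes "proj_rep I n t c"
  shows "(\<Sum>g\<in>grid n m. \<bar>t (idx n g)\<bar>) \<le> c"
proof -
  obtain K a xs where h: "\<And>k i. k < K \<Longrightarrow> i < n \<Longrightarrow> xs k i \<in> l1vec I" "t = (\<lambda>js. \<Sum>k<(K::nat). a k * tprod n (xs k) js)"
    "c = (\<Sum>k<K. \<bar>a k\<bar> * (\<Prod>i<n. l1norm (xs k i)))"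
    using assms unfolding proj_rep_def by blast
  have "(\<Sum>g\<in>grid n m. \<bar>t (idx n g)\<bar>) \<le> (\<Sum>g\<in>grid n m. \<Sum>k<K. \<bar>a k\<bar> * (\<Prod>i<n. \<bar>xs k i (g i)\<bar>))"
    by (intro sum_mono) (simp add: h(2) sum_abs[THEN order_trans] abs_mult abs_prod flip: abs_prod)
  also have "\<dots> = (\<Sum>k<K. \<bar>a k\<bar> * (\<Prod>i<n. \<Sum>j<m. \<bar>xs k i j\<bar>))"
    by (subst sum.swap) (simp add: prod_sum_PiE sum_distrib_left)
  also have "\<dots> \<le> c" unfolding h(3)
    by (intro sum_mono mult_left_mono prod_mono conjI sum_nonneg sum_le_l1norm[OF h(1)]) auto
  finally show ?thesis .
qed

text \<open>Expansion in basis tensors, whose vectors have norm 1. Together with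
  \<open>proj_rep_ge\<close> it identifies the projective tensor power of l1^m with an l1 space of
  arrays.\<close>

lemma proj_rep_supported:
  assumes t: "supported m n t" and I: "{..<m} \<subseteq> I"
  shows "proj_rep I n t (\<Sum>g\<in>grid n m. \<bar>t (idx n g)\<bar>)"
proof -
  have "t = (\<lambda>js. \<Sum>g\<in>grid n m. t (idx n g) * tprod n (\<lambda>i. unitvec (g i)) js)"
  proof (rule supported_eqI[OF t])
    show "supported m n (\<lambda>js. \<Sum>g\<in>grid n m. t (idx n g) * tprod n (\<lambda>i. unitvec (g i)) js)"
      by (intro supported_sum supported_tprod_unitvec) auto
    fix h assume h: "h \<in> grid n m"
    have "(\<Sum>g\<in>grid n m. t (idx n g) * tprod n (\<lambda>i. unitvec (g i)) (idx n h)) = (\<Sum>g\<in>grid n m. if g = h then t (idx n g) else 0)"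
    proof (intro sum.cong refl)
      fix g assume "g \<in> grid n m"
      then have "restrict g {..<n} = g" by (auto simp: PiE_def extensional_restrict)
      then show "t (idx n g) * tprod n (\<lambda>i. unitvec (g i)) (idx n h) = (if g = h then t (idx n g) else 0)"
        using prod_unitvec[of h n g] h by (auto simp: PiE_def)
    qed
    then show "t (idx n h) = (\<Sum>g\<in>grid n m. t (idx n g) * tprod n (\<lambda>i. unitvec (g i)) (idx n h))" using h by simp
  qed
  note eq = this
  obtain b where b: "bij_betw b {..<card (grid n m)} (grid n m)" using ex_bij_betw_nat_finite[OF finite_grid]
    by (auto simp: atLeast0LessThan)
  show ?thesis unfolding proj_rep_def
  proof (rule exI[of _ "card (grid n m)"], rule exI[of _ "\<lambda>k. t (idx n (b k))"], rule exI[of _ "\<lambda>k i. unitvec (b k i)"], intro conjI allI impI)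
    show "unitvec (b k i) \<in> l1vec I" if "k < card (grid n m)" "i < n" for k i
    proof -
      have "b k \<in> grid n m" using bij_betwE[OF b] that(1) by simp
      then show ?thesis using I that(2) by (intro unitvec_l1vec) auto
    qed
    show "t = (\<lambda>js. \<Sum>k<card (grid n m). t (idx n (b k)) * tprod n (\<lambda>i. unitvec (b k i)) js)"
      using sum.reindex_bij_betw[OF b, of "\<lambda>g. t (idx n g) * tprod n (\<lambda>i. unitvec (g i)) js" for js] eq by simp
    show "(\<Sum>g\<in>grid n m. \<bar>t (idx n g)\<bar>) = (\<Sum>k<card (grid n m). \<bar>t (idx n (b k))\<bar> * (\<Prod>i<n. l1norm (unitvec (b k i))))"
      using sum.reindex_bij_betw[OF b, of "\<lambda>g. \<bar>t (idx n g)\<bar>"] by simp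
  qed
qed

lemma proj_norm_supported:
  assumes "supported m n t" "{..<m} \<subseteq> I"
  shows "proj_norm I n t = (\<Sum>g\<in>grid n m. \<bar>t (idx n g)\<bar>)"
  using proj_norm_le[OF proj_rep_supported[OF assms]] proj_norm_ge[OF proj_rep_supported[OF assms] proj_rep_ge]
  by (rule antisym)

lemma supported_in_sym_tensor_pow:
  "supported m n t \<Longrightarrow> symmetric n t \<Longrightarrow> t \<in> sym_tensor_pow {..<m} n"
  using proj_rep_supported[of m n t "{..<m}"] by (auto simp: sym_tensor_pow_eq tensor_pow_iff)

text \<open>It serves twice: positive representations exist for every symmetric array, and small
  entries force a small positive symmetric norm.\<close>

lemma pis_rep_supported_symmetric:
  assumes "n \<ge> 1" "supported m n t" "symmetric n t"
  shows "\<exists>c. pis_rep {..<m} n t c \<and> c \<le> kappa n * (\<Sum>g\<in>grid n m. \<bar>t (idx n g)\<bar>)"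
  using pis_rep_if_proj_rep[OF assms(1,3) proj_rep_supported[OF assms(2)]] by blast

section \<open>The constants c_pis\<close>

lemma proj_norm_nonneg: "t \<in> tensor_pow I n \<Longrightarrow> proj_norm I n t \<ge> 0"
  unfolding tensor_pow_iff by (auto intro: proj_norm_ge proj_rep_nonneg)

lemma ratio_le_kappa:
  assumes n: "n \<ge> 1" and t: "t \<in> sym_tensor_pow I n"
  shows "pis_norm I n t / proj_norm I n t \<le> kappa n"
proof -
  obtain c where "proj_rep I n t c" using t by (auto simp: sym_tensor_pow_eq tensor_pow_iff)
  then have "pis_norm I n t \<le> kappa n * proj_norm I n t"
    using pis_norm_le_proj_norm[OF n] t by (auto simp: sym_tensor_pow_eq)
  moreover have "proj_norm I n t \<ge> 0" using t proj_norm_nonneg by (auto simp: sym_tensor_pow_eq)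
  \<comment> \<open>If the projective norm is 0, the quotient is 0 by the convention for
    division.\<close>
  ultimately show ?thesis using kappa_pos[OF n] by (cases "proj_norm I n t = 0") (auto simp: divide_le_eq)
qed

lemma ratio_le_c_pis:
  assumes n: "n \<ge> 1" and t: "t \<in> sym_tensor_pow I n" "t \<noteq> (\<lambda>_. 0)"
  shows "pis_norm I n t / proj_norm I n t \<le> c_pis n I"
  unfolding c_pis_def
  by (rule cSup_upper) (use t in \<open>auto intro!: bdd_aboveI[of _ "kappa n"] ratio_le_kappa[OF n]\<close>)

lemma sum_tvee_unitvec_eq_1: "(\<Sum>g\<in>grid n n. \<bar>tvee n unitvec (idx n g)\<bar>) = 1"
proof -
  have "(\<Sum>g\<in>grid n n. \<bar>tvee n unitvec (idx n g)\<bar>) = (\<Sum>g\<in>grid n n. tvee n unitvec (idx n g) * 1)"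
    by (intro sum.cong) (auto simp: tvee_nonneg unitvec_def)
  also have "\<dots> = 1" unfolding sum_tvee_unitvec by (simp add: card_permutations[of _ n])
  finally show ?thesis .
qed

text \<open>Additional coordinates do not make the unit tensor cheaper: cutting all vectors off to
  the first n coordinates keeps the tensor and does not increase norms.\<close>

lemma kappa_le_pis_norm:
  assumes n: "n \<ge> 1" and I: "{..<n} \<subseteq> I"
  shows "kappa n \<le> pis_norm I n (tvee n unitvec)"
proof -
  obtain c where c: "pis_rep I n (tvee n unitvec) c"
    using pis_rep_tvee[OF n, of unitvec I] I by (force intro: unitvec_l1vec)
  show ?thesis
  proof (rule pis_norm_ge[OF c])
    fix d assume "pis_rep I n (tvee n unitvec) d"
    then obtain K a x where h: "\<And>k. k < K \<Longrightarrow> x k \<in> l1vec I" "\<And>k j. k < K \<Longrightarrow> x k j \<ge> 0"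
      "tvee n unitvec = (\<lambda>js. \<Sum>k<(K::nat). a k * tpow n (x k) js)" "d = (\<Sum>k<K. \<bar>a k\<bar> * l1norm (x k) ^ n)"
      unfolding pis_rep_def by blast
    define y where "y k = (\<lambda>j. if j < n then x k j else 0)" for k
    have y: "y k \<in> l1vec {..<n}" for k by (simp add: y_def l1vec_finite)
    have "tvee n unitvec = (\<lambda>js. \<Sum>k<K. a k * tpow n (y k) js)"
    proof (rule supported_eqI[OF supported_tvee_unitvec])
      fix g assume "g \<in> grid n n"
      then have "(\<Prod>i<n. y k (g i)) = (\<Prod>i<n. x k (g i))" for k by (intro prod.cong) (auto simp: y_def)
      then show "tvee n unitvec (idx n g) = (\<Sum>k<K. a k * tpow n (y k) (idx n g))" by (simp add: h(3))
    qed (intro supported_sum supported_tpow y)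
    then have "pis_rep {..<n} n (tvee n unitvec) (\<Sum>k<K. \<bar>a k\<bar> * l1norm (y k) ^ n)"
      by (intro pis_repI[where A="{..<K}" and a=a and x=y]) (use y h(2) in \<open>auto simp: y_def\<close>)
    then have "kappa n \<le> (\<Sum>k<K. \<bar>a k\<bar> * l1norm (y k) ^ n)" unfolding kappa_def by (rule pis_norm_le)
    also have "\<dots> \<le> d" unfolding h(4)
    proof (intro sum_mono mult_left_mono power_mono l1norm_nonneg[OF y])
      fix k assume k: "k \<in> {..<K}"
      have "l1norm (y k) = (\<Sum>j<n. \<bar>x k j\<bar>)" unfolding l1norm_finite[OF y] by (simp add: y_def)
      also have "\<dots> \<le> l1norm (x k)" using k by (intro sum_le_l1norm[of _ I] h(1)) auto
      finally show "l1norm (y k) \<le> l1norm (x k)" .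
    qed simp
    finally show "kappa n \<le> d" .
  qed
qed

text \<open>The unit tensor has projective norm 1 and attains the general upper bound. Any index set
  with room for it is covered, so this serves l1 and all l1^m with m \<ge> n.\<close>

lemma c_pis_eq_kappa:
  assumes n: "n \<ge> 1" and I: "{..<n} \<subseteq> I"
  shows "c_pis n I = kappa n"
proof (rule antisym)
  let ?e = "tvee n unitvec"
  have e: "?e \<in> sym_tensor_pow I n"
    using proj_rep_supported[OF supported_tvee_unitvec I] symmetric_tvee by (auto simp: sym_tensor_pow_eq tensor_pow_iff)
  have "?e (idx n id) \<noteq> 0" by (simp add: tvee_unitvec_id)
  then have ne: "?e \<noteq> (\<lambda>_. 0)" by metis
  show "c_pis n I \<le> kappa n" unfolding c_pis_def
    by (rule cSup_least) (use e ne in \<open>auto intro: ratio_le_kappa[OF n]\<close>)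
  have "proj_norm I n ?e = 1" by (simp add: proj_norm_supported[OF supported_tvee_unitvec I] sum_tvee_unitvec_eq_1)
  then show "kappa n \<le> c_pis n I" using ratio_le_c_pis[OF n e ne] kappa_le_pis_norm[OF n I] by simp
qed

lemma pis_norm_le_c_pis:
  assumes n: "n \<ge> 1" and t: "supported m n t" "symmetric n t" and s: "(\<Sum>g\<in>grid n m. \<bar>t (idx n g)\<bar>) = 1"
  shows "pis_norm {..<m} n t \<le> c_pis n {..<m}"
proof -
  have "t \<noteq> (\<lambda>_. 0)" using s by auto
  then show ?thesis using ratio_le_c_pis[OF n supported_in_sym_tensor_pow[OF t]]
    by (simp add: proj_norm_supported[OF t(1)] s)
qed

section \<open>Finitely supported random measures\<close>

text \<open>The discrete measure sum_j y_j delta_(h_j), a weighted empirical measure of the points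
  h.\<close>

definition emp :: "'a measure \<Rightarrow> nat \<Rightarrow> (nat \<Rightarrow> real) \<Rightarrow> (nat \<Rightarrow> 'a) \<Rightarrow> 'a measure" where
  "emp M m y h = distr (point_measure {..<m} (\<lambda>j. ennreal (y j))) M h"

lemma sets_emp [simp, measurable_cong]: "sets (emp M m y h) = sets M"
  by (simp add: emp_def)

lemma space_emp [simp]: "space (emp M m y h) = space M"
  by (simp add: emp_def)

lemma sum_vimage_indicator:
  fixes f :: "'i \<Rightarrow> ennreal"
  assumes "finite J"
  shows "(\<Sum>a\<in>h -` A \<inter> J. f a) = (\<Sum>a\<in>J. f a * indicator A (h a))"
  using assms by (intro sum.mono_neutral_cong_left) (auto simp: indicator_def)

lemma emeasure_emp:
  assumes h: "\<And>j. j < m \<Longrightarrow> h j \<in> space M" and A: "A \<in> sets M"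
  shows "emeasure (emp M m y h) A = (\<Sum>j<m. ennreal (y j) * indicator A (h j))"
proof -
  have "emeasure (emp M m y h) A = emeasure (point_measure {..<m} (\<lambda>j. ennreal (y j))) (h -` A \<inter> {..<m})"
    unfolding emp_def using h A by (subst emeasure_distr) (auto simp: space_point_measure)
  also have "\<dots> = (\<Sum>j\<in>h -` A \<inter> {..<m}. ennreal (y j))" by (rule emeasure_point_measure_finite) auto
  finally show ?thesis by (simp add: sum_vimage_indicator)
qed

lemma prob_space_emp:
  assumes y: "y \<in> prob_vec m" and h: "\<And>j. j < m \<Longrightarrow> h j \<in> space M"
  shows "prob_space (emp M m y h)"
proof
  have "emeasure (emp M m y h) (space M) = (\<Sum>j<m. ennreal (y j))"
    using h by (simp add: emeasure_emp)
  also have "\<dots> = 1" using y by (simp add: prob_vec_def sum_ennreal)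
  finally show "emeasure (emp M m y h) (space (emp M m y h)) = 1" by simp
qed

text \<open>Evaluated at A, the measure is a finite sum of weights times indicators of single
  coordinates. This is what lets the state space be an arbitrary measurable space: the law of the
  random measure is defined on P(S).\<close>

lemma measurable_emp:
  assumes y: "y \<in> prob_vec m"
  shows "emp M m y \<in> PiM {..<m} (\<lambda>_. M) \<rightarrow>\<^sub>M prob_algebra M"
proof (rule measurable_prob_algebraI)
  fix h assume "h \<in> space (PiM {..<m} (\<lambda>_. M))"
  then show "prob_space (emp M m y h)" by (intro prob_space_emp[OF y]) (auto simp: space_PiM)
next
  show "emp M m y \<in> PiM {..<m} (\<lambda>_. M) \<rightarrow>\<^sub>M subprob_algebra M"
  proof (rule measurable_subprob_algebra)
    fix h assume "h \<in> space (PiM {..<m} (\<lambda>_. M))"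
    then show "subprob_space (emp M m y h)"
      by (intro prob_space_imp_subprob_space prob_space_emp[OF y]) (auto simp: space_PiM)
  next
    fix A assume [measurable]: "A \<in> sets M"
    have "(\<lambda>h. \<Sum>j<m. ennreal (y j) * indicator A (h j)) \<in> borel_measurable (PiM {..<m} (\<lambda>_. M))"
      by (intro borel_measurable_sum borel_measurable_times_ennreal borel_measurable_const
          measurable_compose[OF measurable_component_singleton borel_measurable_indicator]) auto
    moreover have "emeasure (emp M m y h) A = (\<Sum>j<m. ennreal (y j) * indicator A (h j))"
      if "h \<in> space (PiM {..<m} (\<lambda>_. M))" for h
      using that \<open>A \<in> sets M\<close> by (intro emeasure_emp) (auto simp: space_PiM)
    ultimately show "(\<lambda>h. emeasure (emp M m y h) A) \<in> borel_measurable (PiM {..<m} (\<lambda>_. M))"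
      by (metis (no_types, lifting) measurable_cong)
  qed simp
qed

lemma sets_Sn: "sets N = sets M \<Longrightarrow> sets (Sn N n) = sets (Sn M n)"
  unfolding Sn_def by (intro sets_PiM_cong) auto

lemma measure_Sn_emp:
  assumes y: "y \<in> prob_vec m" and h: "\<And>j. j < m \<Longrightarrow> h j \<in> space M" and A: "A \<in> sets (Sn M n)"
  shows "measure (Sn (emp M m y h) n) A = (\<Sum>g\<in>grid n m. (\<Prod>i<n. y (g i)) * indicator A (\<lambda>i\<in>{..<n}. h (g i)))"
proof -
  have y0: "y j \<ge> 0" for j using y by (simp add: prob_vec_def)
  let ?P = "point_measure (grid n m) (\<lambda>g. \<Prod>i<n. ennreal (y (g i)))"
  let ?f = "\<lambda>g. \<lambda>i\<in>{..<n}. h (g i)"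
  \<comment> \<open>The candidate for the product measure: mass prod_i y(g i) at the point with
    coordinates h(g i). It is identified by its values on rectangles, where the sum over the grid
    factorises.\<close>
  define R where "R = distr ?P (Sn M n) ?f"
  have f: "?f \<in> grid n m \<rightarrow> space (Sn M n)"
  proof
    fix g assume "g \<in> grid n m"
    then have "g i < m" if "i < n" for i using that by (auto dest: PiE_mem)
    then show "?f g \<in> space (Sn M n)" by (simp add: Sn_def space_PiM restrict_PiE_iff h)
  qed
  have R: "emeasure R B = (\<Sum>g\<in>grid n m. (\<Prod>i<n. ennreal (y (g i))) * indicator B (?f g))" if B: "B \<in> sets (Sn M n)" for B
  proof -
    have "emeasure R B = emeasure ?P (?f -` B \<inter> grid n m)"
      unfolding R_def using f B by (subst emeasure_distr) (auto simp: space_point_measure)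
    also have "\<dots> = (\<Sum>g\<in>?f -` B \<inter> grid n m. \<Prod>i<n. ennreal (y (g i)))" by (rule emeasure_point_measure_finite) auto
    finally show ?thesis by (simp only: sum_vimage_indicator finite_grid)
  qed
  interpret E: prob_space "emp M m y h" by (rule prob_space_emp[OF y h])
  interpret product_sigma_finite "\<lambda>_. emp M m y h" by standard
  have sets_eq: "sets (Sn (emp M m y h) n) = sets (Sn M n)" by (rule sets_Sn) simp
  have "R = PiM {..<n} (\<lambda>_. emp M m y h)"
  proof (rule PiM_eqI)
    show "sets R = sets (PiM {..<n} (\<lambda>_. emp M m y h))" using sets_eq by (simp add: R_def Sn_def)
    fix B assume B: "\<And>i. i \<in> {..<n} \<Longrightarrow> B i \<in> sets (emp M m y h)"
    then have "PiE {..<n} B \<in> sets (Sn M n)" by (auto simp: Sn_def intro!: sets_PiM_I_finite)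
    then have "emeasure R (PiE {..<n} B) = (\<Sum>g\<in>grid n m. (\<Prod>i<n. ennreal (y (g i))) * indicator (PiE {..<n} B) (?f g))" by (rule R)
    also have "\<dots> = (\<Sum>g\<in>grid n m. (\<Prod>i<n. ennreal (y (g i)) * indicator (B i) (h (g i))))"
    proof (intro sum.cong refl)
      fix g
      have "indicator (PiE {..<n} B) (?f g) = (\<Prod>i<n. indicator (B i) (h (g i)) :: ennreal)"
      proof (cases "?f g \<in> PiE {..<n} B")
        case True then show ?thesis by (auto simp: PiE_iff intro!: prod.neutral[symmetric])
      next
        case False
        then obtain i where "i < n" "h (g i) \<notin> B i" by (auto simp: PiE_iff)
        then have "(\<Prod>i<n. indicator (B i) (h (g i)) :: ennreal) = 0" by (intro prod_zero bexI[of _ i]) auto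
        then show ?thesis using False by simp
      qed
      then show "(\<Prod>i<n. ennreal (y (g i))) * indicator (PiE {..<n} B) (?f g) = (\<Prod>i<n. ennreal (y (g i)) * indicator (B i) (h (g i)))"
        by (simp add: prod.distrib)
    qed
    also have "\<dots> = (\<Prod>i<n. \<Sum>j<m. ennreal (y j) * indicator (B i) (h j))" by (subst prod_sum_PiE) auto
    also have "\<dots> = (\<Prod>i<n. emeasure (emp M m y h) (B i))"
      using B h by (intro prod.cong refl emeasure_emp[symmetric]) auto
    finally show "emeasure R (PiE {..<n} B) = (\<Prod>i<n. emeasure (emp M m y h) (B i))" .
  qed simp
  then have "emeasure (Sn (emp M m y h) n) A = (\<Sum>g\<in>grid n m. (\<Prod>i<n. ennreal (y (g i))) * indicator A (?f g))"
    using R[OF A] by (simp add: Sn_def)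
  also have "\<dots> = (\<Sum>g\<in>grid n m. ennreal ((\<Prod>i<n. y (g i)) * indicator A (?f g)))"
    by (intro sum.cong refl) (auto simp: prod_ennreal y0 indicator_def)
  also have "\<dots> = ennreal (\<Sum>g\<in>grid n m. (\<Prod>i<n. y (g i)) * indicator A (?f g))"
    by (rule sum_ennreal) (auto intro!: mult_nonneg_nonneg prod_nonneg y0)
  finally show ?thesis
    by (intro measure_eq_emeasure_eq_ennreal) (auto intro!: sum_nonneg mult_nonneg_nonneg prod_nonneg y0)
qed

section \<open>Product powers as measurable functions of the measure\<close>

lemma emeasure_Sn_PiE:
  assumes "\<nu> \<in> space (prob_algebra M)" "\<And>i. i < n \<Longrightarrow> B i \<in> sets M"
  shows "emeasure (Sn \<nu> n) (PiE {..<n} B) = (\<Prod>i<n. emeasure \<nu> (B i))"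
proof -
  have s: "sets \<nu> = sets M" and "prob_space \<nu>" using assms(1) by (auto simp: space_prob_algebra)
  then interpret prob_space \<nu> by simp
  interpret product_sigma_finite "\<lambda>_. \<nu>" by standard
  show ?thesis unfolding Sn_def by (rule emeasure_PiM) (simp_all add: s assms(2))
qed

lemma prob_space_Sn: "prob_space \<nu> \<Longrightarrow> prob_space (Sn \<nu> n)"
  unfolding Sn_def by (rule prob_space_PiM) simp

text \<open>It suffices to test on rectangles, an intersection-stable generator, where the product
  measure is a finite product of evaluations. This makes the integrand of the representation
  measurable.\<close>

lemma measurable_Sn: "(\<lambda>\<nu>. Sn \<nu> n) \<in> prob_algebra M \<rightarrow>\<^sub>M prob_algebra (Sn M n)"
proof (rule measurable_prob_algebra_generated)
  show "sets (Sn M n) = sigma_sets (\<Pi>\<^sub>E i\<in>{..<n}. space M) (prod_algebra {..<n} (\<lambda>_. M))"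
    unfolding Sn_def by (rule sets_PiM)
  show "Int_stable (prod_algebra {..<n} (\<lambda>_. M))" by (rule Int_stable_prod_algebra)
  show "prod_algebra {..<n} (\<lambda>_. M) \<subseteq> Pow (\<Pi>\<^sub>E i\<in>{..<n}. space M)" by (rule prod_algebra_sets_into_space)
  show "prob_space (Sn \<nu> n)" if "\<nu> \<in> space (prob_algebra M)" for \<nu>
    using that by (simp add: space_prob_algebra prob_space_Sn)
  show "sets (Sn \<nu> n) = sets (Sn M n)" if "\<nu> \<in> space (prob_algebra M)" for \<nu>
    by (rule sets_Sn) (use that in \<open>simp add: space_prob_algebra\<close>)
  fix A assume "A \<in> prod_algebra {..<n} (\<lambda>_. M)"
  then obtain B where B: "A = PiE {..<n} B" and "B \<in> (\<Pi> j\<in>{..<n}. sets M)"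
    unfolding prod_algebra_eq_finite[OF finite_lessThan] by blast
  then have B2: "B i \<in> sets M" if "i < n" for i using that by blast
  have "(\<lambda>\<nu>. emeasure \<nu> (B i)) \<in> borel_measurable (prob_algebra M)" if "i < n" for i
    using B2[OF that] unfolding prob_algebra_def by (intro measurable_restrict_space1 measurable_emeasure_subprob_algebra)
  then have "(\<lambda>\<nu>. \<Prod>i<n. emeasure \<nu> (B i)) \<in> borel_measurable (prob_algebra M)"
    by (intro borel_measurable_prod_ennreal) auto
  moreover have "emeasure (Sn \<nu> n) A = (\<Prod>i<n. emeasure \<nu> (B i))" if "\<nu> \<in> space (prob_algebra M)" for \<nu>
    unfolding B by (rule emeasure_Sn_PiE[OF that B2])
  ultimately show "(\<lambda>\<nu>. emeasure (Sn \<nu> n) A) \<in> borel_measurable (prob_algebra M)"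
    by (metis (no_types, lifting) measurable_cong)
qed

lemma measurable_measure_Sn:
  "A \<in> sets (Sn M n) \<Longrightarrow> (\<lambda>\<nu>. measure (Sn \<nu> n) A) \<in> borel_measurable (prob_algebra M)"
  by (rule measurable_compose[OF measurable_Sn measurable_measure_prob_algebra])

lemma measure_Sn_le_1: "\<nu> \<in> space (prob_algebra M) \<Longrightarrow> measure (Sn \<nu> n) A \<le> 1"
  by (auto simp: space_prob_algebra intro!: prob_space.prob_le_1 prob_space_Sn)

section \<open>Mixtures of laws\<close>

text \<open>The measure sum_k w_k (law of N_k under Q). As the image of one product measure, it gets
  its integrals from Tonelli's theorem.\<close>

definition mix :: "'q measure \<Rightarrow> 'p measure \<Rightarrow> nat \<Rightarrow> (nat \<Rightarrow> real) \<Rightarrow> (nat \<Rightarrow> 'q \<Rightarrow> 'p) \<Rightarrow> 'p measure" where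
  "mix Q R K w N = distr (point_measure {..<K} (\<lambda>k. ennreal (w k)) \<Otimes>\<^sub>M Q) R (\<lambda>(k, x). N k x)"

lemma sets_mix [simp]: "sets (mix Q R K w N) = sets R"
  by (simp add: mix_def)

lemma space_mix [simp]: "space (mix Q R K w N) = space R"
  by (simp add: mix_def)

lemma nn_integral_mix:
  assumes Q: "prob_space Q" and N: "\<And>k. k < K \<Longrightarrow> N k \<in> Q \<rightarrow>\<^sub>M R" and f: "f \<in> borel_measurable R"
  shows "(\<integral>\<^sup>+p. f p \<partial>mix Q R K w N) = (\<Sum>k<K. ennreal (w k) * (\<integral>\<^sup>+x. f (N k x) \<partial>Q))"
proof -
  interpret prob_space Q by fact
  have "(\<lambda>(k, x). N k x) \<in> (count_space {..<K} \<Otimes>\<^sub>M Q) \<rightarrow>\<^sub>M R"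
    by (rule measurable_pair_measure_countable1) (auto intro: N)
  then have m: "(\<lambda>(k, x). N k x) \<in> (point_measure {..<K} (\<lambda>k. ennreal (w k)) \<Otimes>\<^sub>M Q) \<rightarrow>\<^sub>M R"
    by (subst measurable_cong_sets[OF sets_pair_measure_cong[OF sets_point_measure_count_space refl] refl])
  have "(\<integral>\<^sup>+p. f p \<partial>mix Q R K w N)
      = (\<integral>\<^sup>+z. f (case z of (k, x) \<Rightarrow> N k x) \<partial>(point_measure {..<K} (\<lambda>k. ennreal (w k)) \<Otimes>\<^sub>M Q))"
    unfolding mix_def using f by (subst nn_integral_distr[OF m]) auto
  also have "\<dots> = (\<integral>\<^sup>+k. \<integral>\<^sup>+x. f (case (k, x) of (k, x) \<Rightarrow> N k x) \<partial>Q \<partial>point_measure {..<K} (\<lambda>k. ennreal (w k)))"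
    by (rule nn_integral_fst[symmetric]) (rule measurable_compose[OF m f])
  finally show ?thesis by (simp add: nn_integral_point_measure_finite)
qed

lemma integral_mix:
  fixes f :: "'p \<Rightarrow> real"
  assumes Q: "prob_space Q" and N: "\<And>k. k < K \<Longrightarrow> N k \<in> Q \<rightarrow>\<^sub>M R" and f: "f \<in> borel_measurable R"
    and f01: "\<And>p. p \<in> space R \<Longrightarrow> 0 \<le> f p" "\<And>p. p \<in> space R \<Longrightarrow> f p \<le> 1" and w: "\<And>k. w k \<ge> 0"
  shows "(\<integral>p. f p \<partial>mix Q R K w N) = (\<Sum>k<K. w k * (\<integral>x. f (N k x) \<partial>Q))"
proof -
  interpret prob_space Q by fact
  have fN: "0 \<le> f (N k x)" "f (N k x) \<le> 1" if "k < K" "x \<in> space Q" for k x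
    using f01 measurable_space[OF N[OF that(1)] that(2)] by auto
  have fm: "f \<in> borel_measurable (mix Q R K w N)" using f by (simp cong: measurable_cong_sets)
  have I: "(\<integral>\<^sup>+x. ennreal (f (N k x)) \<partial>Q) = ennreal (\<integral>x. f (N k x) \<partial>Q)" if k: "k < K" for k
    using fN[OF k] measurable_compose[OF N[OF k] f]
    by (intro nn_integral_eq_integral integrable_const_bound[of _ 1] AE_I2) auto
  have I0: "(\<integral>x. f (N k x) \<partial>Q) \<ge> 0" if k: "k < K" for k
    using fN[OF k] by (intro integral_nonneg_AE AE_I2) auto
  have "(\<integral>p. f p \<partial>mix Q R K w N) = enn2real (\<integral>\<^sup>+p. ennreal (f p) \<partial>mix Q R K w N)"
    using f01 fm by (intro integral_eq_nn_integral AE_I2) auto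
  also have "(\<integral>\<^sup>+p. ennreal (f p) \<partial>mix Q R K w N) = (\<Sum>k<K. ennreal (w k) * (\<integral>\<^sup>+x. ennreal (f (N k x)) \<partial>Q))"
    using f by (intro nn_integral_mix[OF Q N]) auto
  also have "\<dots> = (\<Sum>k<K. ennreal (w k * (\<integral>x. f (N k x) \<partial>Q)))"
    using w I I0 by (intro sum.cong) (auto simp: ennreal_mult)
  also have "\<dots> = ennreal (\<Sum>k<K. w k * (\<integral>x. f (N k x) \<partial>Q))"
    using w I0 by (intro sum_ennreal) auto
  finally have "(\<integral>p. f p \<partial>mix Q R K w N) = enn2real (ennreal (\<Sum>k<K. w k * (\<integral>x. f (N k x) \<partial>Q)))" .
  moreover have "0 \<le> (\<Sum>k<K. w k * (\<integral>x. f (N k x) \<partial>Q))"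
    using w I0 by (intro sum_nonneg mult_nonneg_nonneg) auto
  ultimately show ?thesis by simp
qed

lemma measure_mix:
  assumes Q: "prob_space Q" and N: "\<And>k. k < K \<Longrightarrow> N k \<in> Q \<rightarrow>\<^sub>M R" and B: "B \<in> sets R" and w: "\<And>k. w k \<ge> 0"
  shows "measure (mix Q R K w N) B = (\<Sum>k<K. w k * measure (distr Q R (N k)) B)"
proof -
  interpret prob_space Q by fact
  have "measure (mix Q R K w N) B = (\<integral>p. indicator B p \<partial>mix Q R K w N)" using B by (simp add: Int_absorb2 sets.sets_into_space)
  also have "\<dots> = (\<Sum>k<K. w k * (\<integral>x. indicator B (N k x) \<partial>Q))"
    using B by (intro integral_mix[OF Q N _ _ _ w]) auto
  also have "\<dots> = (\<Sum>k<K. w k * measure (distr Q R (N k)) B)"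
  proof (intro sum.cong refl)
    fix k assume "k \<in> {..<K}"
    then have k: "N k \<in> Q \<rightarrow>\<^sub>M R" using N by simp
    have "(\<integral>x. indicator B (N k x) \<partial>Q) = (\<integral>p. (indicator B p :: real) \<partial>distr Q R (N k))"
      using B by (subst integral_distr[OF k]) auto
    also have "\<dots> = measure (distr Q R (N k)) B" using B by (simp add: Int_absorb2 sets.sets_into_space)
    finally show "w k * (\<integral>x. indicator B (N k x) \<partial>Q) = w k * measure (distr Q R (N k)) B" by simp
  qed
  finally show ?thesis .
qed

lemma finite_measure_mix:
  assumes Q: "prob_space Q" and N: "\<And>k. k < K \<Longrightarrow> N k \<in> Q \<rightarrow>\<^sub>M R"
  shows "finite_measure (mix Q R K w N)"
proof
  interpret prob_space Q by fact
  have "emeasure (mix Q R K w N) (space R) = (\<integral>\<^sup>+p. 1 \<partial>mix Q R K w N)" by simp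
  also have "\<dots> = (\<Sum>k<K. ennreal (w k))" by (subst nn_integral_mix[OF Q N]) (auto simp: emeasure_space_1)
  finally have e: "emeasure (mix Q R K w N) (space R) = (\<Sum>k<K. ennreal (w k))" .
  show "emeasure (mix Q R K w N) (space (mix Q R K w N)) \<noteq> \<infinity>" unfolding space_mix e by simp
qed

text \<open>The signed measure is sum_k a_k (law of N_k), split by the sign of the coefficients. The
  two parts may overlap, so the total variation is estimated directly on finite partitions.\<close>

lemma represents_mixture:
  fixes K :: nat
  assumes Q: "prob_space Q" and N: "\<And>k. k < K \<Longrightarrow> N k \<in> Q \<rightarrow>\<^sub>M prob_algebra M"
    and \<mu>: "\<And>A. A \<in> sets (Sn M n) \<Longrightarrow> measure \<mu> A = (\<Sum>k<K. a k * (\<integral>x. measure (Sn (N k x) n) A \<partial>Q))"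
  shows "\<exists>\<alpha> \<beta>. represents M n \<mu> \<alpha> \<beta> \<and> tv_norm (prob_algebra M) \<alpha> \<beta> \<le> (\<Sum>k<K. \<bar>a k\<bar>)"
proof -
  define \<alpha> where "\<alpha> = mix Q (prob_algebra M) K (\<lambda>k. max (a k) 0) N"
  define \<beta> where "\<beta> = mix Q (prob_algebra M) K (\<lambda>k. max (- a k) 0) N"
  have a: "max (a k) 0 * c - max (- a k) 0 * c = a k * c" for k c by (simp add: max_def)
  have "represents M n \<mu> \<alpha> \<beta>"
    unfolding represents_def
  proof (intro conjI ballI)
    show "finite_measure \<alpha>" "finite_measure \<beta>" unfolding \<alpha>_def \<beta>_def by (intro finite_measure_mix[OF Q N]; assumption)+
    show "sets \<alpha> = sets (prob_algebra M)" "sets \<beta> = sets (prob_algebra M)" by (auto simp: \<alpha>_def \<beta>_def)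
    fix A assume A: "A \<in> sets (Sn M n)"
    have "(\<integral>\<nu>. measure (Sn \<nu> n) A \<partial>mix Q (prob_algebra M) K w N) = (\<Sum>k<K. w k * (\<integral>x. measure (Sn (N k x) n) A \<partial>Q))"
      if "\<And>k. w k \<ge> 0" for w
      by (rule integral_mix[OF Q N measurable_measure_Sn[OF A]]) (auto intro: measure_Sn_le_1 that)
    then show "measure \<mu> A = (\<integral>\<nu>. measure (Sn \<nu> n) A \<partial>\<alpha>) - (\<integral>\<nu>. measure (Sn \<nu> n) A \<partial>\<beta>)"
      by (simp add: \<alpha>_def \<beta>_def \<mu>[OF A] a flip: sum_subtractf)
  qed
  moreover have "tv_norm (prob_algebra M) \<alpha> \<beta> \<le> (\<Sum>k<K. \<bar>a k\<bar>)"
    unfolding tv_norm_def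
  proof (rule cSup_least)
    fix s assume "s \<in> {\<Sum>i<k. \<bar>measure \<alpha> (B i) - measure \<beta> (B i)\<bar> |(k::nat) B.
        (\<forall>i<k. B i \<in> sets (prob_algebra M)) \<and> disjoint_family_on B {..<k}}"
    then obtain r B where s: "s = (\<Sum>i<(r::nat). \<bar>measure \<alpha> (B i) - measure \<beta> (B i)\<bar>)"
      and B: "\<And>i. i < r \<Longrightarrow> B i \<in> sets (prob_algebra M)" "disjoint_family_on B {..<r}" by blast
    let ?p = "\<lambda>k. measure (distr Q (prob_algebra M) (N k))"
    have "measure \<alpha> (B i) - measure \<beta> (B i) = (\<Sum>k<K. a k * ?p k (B i))" if "i < r" for i
      unfolding \<alpha>_def \<beta>_def by (subst (1 2) measure_mix[OF Q N B(1)[OF that]]) (auto simp: a simp flip: sum_subtractf)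
    then have "s = (\<Sum>i<r. \<bar>\<Sum>k<K. a k * ?p k (B i)\<bar>)" by (simp add: s)
    also have "\<dots> \<le> (\<Sum>i<r. \<Sum>k<K. \<bar>a k\<bar> * ?p k (B i))"
      by (intro sum_mono order_trans[OF sum_abs]) (simp add: abs_mult)
    also have "\<dots> = (\<Sum>k<K. \<bar>a k\<bar> * (\<Sum>i<r. ?p k (B i)))" by (subst sum.swap) (simp add: sum_distrib_left)
    \<comment> \<open>For each k the masses of the disjoint cells under one probability law sum to
      at most 1.\<close>
    also have "\<dots> \<le> (\<Sum>k<K. \<bar>a k\<bar> * 1)"
    proof (intro sum_mono mult_left_mono)
      fix k assume "k \<in> {..<K}"
      then interpret D: prob_space "distr Q (prob_algebra M) (N k)" using N by (intro prob_space.prob_space_distr[OF Q]) auto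
      have "(\<Sum>i<r. ?p k (B i)) = ?p k (\<Union>i<r. B i)"
        using B by (intro D.finite_measure_finite_Union[symmetric]) auto
      then show "(\<Sum>i<r. ?p k (B i)) \<le> 1" by simp
    qed simp
    finally show "s \<le> (\<Sum>k<K. \<bar>a k\<bar>)" by simp
  qed (auto simp: disjoint_family_on_def intro!: exI[of _ 0])
  ultimately show ?thesis by blast
qed

text \<open>By the hypothesis, mu is obtained from the tensor t by replacing the basis tensor of g
  with the law of (H_(g 0), ..., H_(g (n-1))). Under the same substitution the power of y_k becomes
  the expected n-th power of the random measure \<open>emp M m (y k) (H x)\<close>, so an optimal
  representation of t yields the signed measure.\<close>

lemma represents_tensor:
  assumes n: "n \<ge> 1" and m: "m \<ge> 1" and Q: "prob_space Q" and H: "H \<in> Q \<rightarrow>\<^sub>M PiM {..<m} (\<lambda>_. M)"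
    and rep: "pis_rep {..<m} n t c"
    and \<mu>: "\<And>A. A \<in> sets (Sn M n) \<Longrightarrow>
      measure \<mu> A = (\<Sum>g\<in>grid n m. t (idx n g) * measure Q {x\<in>space Q. (\<lambda>i\<in>{..<n}. H x (g i)) \<in> A})"
  shows "\<exists>\<alpha> \<beta>. represents M n \<mu> \<alpha> \<beta> \<and> tv_norm (prob_algebra M) \<alpha> \<beta> \<le> pis_norm {..<m} n t"
proof -
  interpret prob_space Q by fact
  obtain K a y where y: "\<And>k. k < (K::nat) \<Longrightarrow> y k \<in> prob_vec m"
    "t = (\<lambda>js. \<Sum>k<K. a k * tpow n (y k) js)" "(\<Sum>k<K. \<bar>a k\<bar>) \<le> pis_norm {..<m} n t"
    using pis_norm_attained[OF m n rep] by metis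
  have Hs: "H x j \<in> space M" if "x \<in> space Q" "j < m" for x j
    using measurable_space[OF H that(1)] that(2) by (auto simp: space_PiM)
  have Hm: "(\<lambda>x. \<lambda>i\<in>{..<n}. H x (g i)) \<in> Q \<rightarrow>\<^sub>M Sn M n" if "g \<in> grid n m" for g
    unfolding Sn_def using that
    by (intro measurable_restrict measurable_compose[OF H measurable_component_singleton]) auto
  have "measure \<mu> A = (\<Sum>k<K. a k * (\<integral>x. measure (Sn (emp M m (y k) (H x)) n) A \<partial>Q))" if A: "A \<in> sets (Sn M n)" for A
  proof -
    let ?m = "\<lambda>g. measure Q {x\<in>space Q. (\<lambda>i\<in>{..<n}. H x (g i)) \<in> A}"
    have int: "(\<integral>x. measure (Sn (emp M m (y k) (H x)) n) A \<partial>Q) = (\<Sum>g\<in>grid n m. (\<Prod>i<n. y k (g i)) * ?m g)" if k: "k < K" for k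
    proof -
      have s: "{x\<in>space Q. (\<lambda>i\<in>{..<n}. H x (g i)) \<in> A} \<in> sets Q" if "g \<in> grid n m" for g
        using measurable_sets[OF Hm[OF that] A] by (simp add: vimage_def Int_def conj_commute)
      have "(\<integral>x. measure (Sn (emp M m (y k) (H x)) n) A \<partial>Q)
          = (\<integral>x. (\<Sum>g\<in>grid n m. (\<Prod>i<n. y k (g i)) * indicator {x\<in>space Q. (\<lambda>i\<in>{..<n}. H x (g i)) \<in> A} x) \<partial>Q)"
        by (intro Bochner_Integration.integral_cong refl, subst measure_Sn_emp[OF y(1)[OF k] _ A])
           (auto simp: Hs indicator_def intro!: sum.cong)
      also have "\<dots> = (\<Sum>g\<in>grid n m. (\<integral>x. (\<Prod>i<n. y k (g i)) * indicator {x\<in>space Q. (\<lambda>i\<in>{..<n}. H x (g i)) \<in> A} x \<partial>Q))"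
        using s by (intro Bochner_Integration.integral_sum integrable_mult_right integrable_real_indicator) (auto simp: less_top[symmetric])
      also have "\<dots> = (\<Sum>g\<in>grid n m. (\<Prod>i<n. y k (g i)) * ?m g)"
        using s by (intro sum.cong refl) (simp add: Int_absorb2)
      finally show ?thesis .
    qed
    have "measure \<mu> A = (\<Sum>g\<in>grid n m. \<Sum>k<K. a k * (\<Prod>i<n. y k (g i)) * ?m g)"
      unfolding \<mu>[OF A] y(2) by (simp add: sum_distrib_right)
    also have "\<dots> = (\<Sum>k<K. a k * (\<Sum>g\<in>grid n m. (\<Prod>i<n. y k (g i)) * ?m g))"
      by (subst sum.swap) (simp add: sum_distrib_left mult.assoc)
    finally show ?thesis using int by simp
  qed
  then have "\<exists>\<alpha> \<beta>. represents M n \<mu> \<alpha> \<beta> \<and> tv_norm (prob_algebra M) \<alpha> \<beta> \<le> (\<Sum>k<K. \<bar>a k\<bar>)"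
    by (intro represents_mixture[OF Q, where N="\<lambda>k x. emp M m (y k) (H x)"] measurable_compose[OF H measurable_emp] y(1)) auto
  then show ?thesis using y(3) order_trans by blast
qed

section \<open>Exchangeable distributions\<close>

lemma measurable_permute_coords:
  assumes "\<sigma> permutes {..<n}"
  shows "permute_coords n \<sigma> \<in> Sn M n \<rightarrow>\<^sub>M Sn M n"
  unfolding permute_coords_def Sn_def
  by (intro measurable_restrict measurable_component_singleton) (use assms in \<open>auto simp: permutes_lessThan\<close>)

lemma exch_dist_exchangeable:
  assumes "exchangeable P M n X"
  shows "exch_dist M n (distr P (Sn M n) X)"
proof -
  have P: "prob_space P" and X: "X \<in> P \<rightarrow>\<^sub>M Sn M n"
    and inv: "\<And>\<sigma>. \<sigma> permutes {..<n} \<Longrightarrow> distr P (Sn M n) (\<lambda>\<omega>. permute_coords n \<sigma> (X \<omega>)) = distr P (Sn M n) X"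
    using assms by (auto simp: exchangeable_def)
  have "distr (distr P (Sn M n) X) (Sn M n) (permute_coords n \<sigma>) = distr P (Sn M n) X" if "\<sigma> permutes {..<n}" for \<sigma>
    using inv[OF that] by (subst distr_distr[OF measurable_permute_coords[OF that] X]) (simp add: comp_def)
  then show ?thesis using prob_space.prob_space_distr[OF P X] by (simp add: exch_dist_def)
qed

lemma exch_dist_measure:
  assumes \<mu>: "exch_dist M n \<mu>" and \<sigma>: "\<sigma> permutes {..<n}" and A: "A \<in> sets (Sn M n)"
  shows "measure \<mu> {x \<in> space \<mu>. permute_coords n \<sigma> x \<in> A} = measure \<mu> A"
proof -
  have s: "sets \<mu> = sets (Sn M n)" using \<mu> by (simp add: exch_dist_def)
  have m: "permute_coords n \<sigma> \<in> \<mu> \<rightarrow>\<^sub>M Sn M n"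
    using measurable_permute_coords[OF \<sigma>] by (subst measurable_cong_sets[OF s refl])
  have "measure \<mu> A = measure (distr \<mu> (Sn M n) (permute_coords n \<sigma>)) A" using \<mu> \<sigma> by (simp add: exch_dist_def)
  also have "\<dots> = measure \<mu> (permute_coords n \<sigma> -` A \<inter> space \<mu>)" by (rule measure_distr[OF m A])
  finally show ?thesis by (simp add: vimage_def Int_def conj_commute)
qed

lemma exch_dist_represents:
  assumes n: "n \<ge> 1" and \<mu>: "exch_dist M n \<mu>"
  shows "\<exists>\<alpha> \<beta>. represents M n \<mu> \<alpha> \<beta> \<and> tv_norm (prob_algebra M) \<alpha> \<beta> \<le> kappa n"
  unfolding kappa_def
proof (rule represents_tensor[OF n n _ _ pis_rep_tvee_unitvec, where Q=\<mu> and H="\<lambda>x. x"])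
  show "prob_space \<mu>" using \<mu> by (simp add: exch_dist_def)
  have s: "sets \<mu> = sets (PiM {..<n} (\<lambda>_. M))" using \<mu> by (simp add: exch_dist_def Sn_def)
  show "(\<lambda>x. x) \<in> \<mu> \<rightarrow>\<^sub>M PiM {..<n} (\<lambda>_. M)" by (subst measurable_cong_sets[OF s refl]) simp
  fix A assume A: "A \<in> sets (Sn M n)"
  \<comment> \<open>The unit tensor averages over permuted samples, and exchangeability makes all
    the averaged probabilities equal.\<close>
  have "(\<Sum>g\<in>grid n n. tvee n unitvec (idx n g) * measure \<mu> {x\<in>space \<mu>. (\<lambda>i\<in>{..<n}. x (g i)) \<in> A})
      = (1 / fact n) * (\<Sum>\<sigma> | \<sigma> permutes {..<n}. measure \<mu> {x\<in>space \<mu>. (\<lambda>i\<in>{..<n}. x (restrict \<sigma> {..<n} i)) \<in> A})"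
    by (rule sum_tvee_unitvec)
  also have "\<dots> = (1 / fact n) * (\<Sum>\<sigma> | \<sigma> permutes {..<n}. measure \<mu> A)"
  proof (intro arg_cong2[where f="(*)"] refl sum.cong)
    fix \<sigma> assume "\<sigma> \<in> {\<sigma>. \<sigma> permutes {..<n}}"
    then have \<sigma>: "\<sigma> permutes {..<n}" by simp
    have "(\<lambda>i\<in>{..<n}. x (restrict \<sigma> {..<n} i)) = permute_coords n \<sigma> x" for x :: "nat \<Rightarrow> 'a"
      by (auto simp: permute_coords_def)
    then show "measure \<mu> {x\<in>space \<mu>. (\<lambda>i\<in>{..<n}. x (restrict \<sigma> {..<n} i)) \<in> A} = measure \<mu> A"
      using exch_dist_measure[OF \<mu> \<sigma> A] by simp
  qed
  also have "\<dots> = measure \<mu> A" by (simp add: card_permutations[of _ n])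
  finally show "measure \<mu> A = (\<Sum>g\<in>grid n n. tvee n unitvec (idx n g) * measure \<mu> {x\<in>space \<mu>. (\<lambda>i\<in>{..<n}. x (g i)) \<in> A})" ..
qed

section \<open>Finite state spaces\<close>

locale finite_states =
  fixes M :: "'a measure" and m :: nat and h :: "nat \<Rightarrow> 'a"
  assumes h: "bij_betw h {..<m} (space M)" and sets_M: "sets M = Pow (space M)"
begin

definition pt :: "nat \<Rightarrow> (nat \<Rightarrow> nat) \<Rightarrow> nat \<Rightarrow> 'a" where
  "pt n g = (\<lambda>i\<in>{..<n}. h (g i))"

lemma h_mem: "j < m \<Longrightarrow> h j \<in> space M"
  using bij_betwE[OF h] by auto

lemma h_inj: "i < m \<Longrightarrow> j < m \<Longrightarrow> h i = h j \<longleftrightarrow> i = j"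
  using bij_betw_imp_inj_on[OF h] by (auto simp: inj_on_def)

lemma finite_space: "finite (space M)"
  using bij_betw_finite[OF h] by simp

lemma space_Sn: "space (Sn M n) = {..<n} \<rightarrow>\<^sub>E space M"
  by (simp add: Sn_def space_PiM)

lemma sets_Sn_Pow: "sets (Sn M n) = Pow (space (Sn M n))"
proof -
  have "sets (Sn M n) = sets (PiM {..<n} (\<lambda>_. count_space (space M)))"
    unfolding Sn_def by (rule sets_PiM_cong) (simp_all add: sets_M)
  also have "\<dots> = Pow ({..<n} \<rightarrow>\<^sub>E space M)"
    using finite_space by (subst count_space_PiM_finite) (auto intro: countable_finite)
  finally show ?thesis by (simp add: space_Sn)
qed

lemma pt_bij: "bij_betw (pt n) (grid n m) (space (Sn M n))"
  unfolding bij_betw_def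
proof
  show "inj_on (pt n) (grid n m)"
  proof (rule inj_onI)
    fix g k assume gk: "g \<in> grid n m" "k \<in> grid n m" "pt n g = pt n k"
    show "g = k"
    proof (rule PiE_ext[OF gk(1,2)])
      fix i assume i: "i \<in> {..<n}"
      then have "h (g i) = h (k i)" using fun_cong[OF gk(3), of i] by (simp add: pt_def)
      moreover have "g i < m" "k i < m" using gk i by (auto dest: PiE_mem)
      ultimately show "g i = k i" by (simp add: h_inj)
    qed
  qed
  show "pt n ` grid n m = space (Sn M n)"
  proof
    show "pt n ` grid n m \<subseteq> space (Sn M n)"
    proof
      fix x assume "x \<in> pt n ` grid n m"
      then obtain g where g: "g \<in> grid n m" "x = pt n g" by blast
      then have "g i < m" if "i < n" for i using that by (auto dest: PiE_mem)
      then show "x \<in> space (Sn M n)" by (simp add: g(2) space_Sn pt_def restrict_PiE_iff h_mem)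
    qed
    show "space (Sn M n) \<subseteq> pt n ` grid n m"
    proof
      fix x assume x: "x \<in> space (Sn M n)"
      let ?g = "\<lambda>i\<in>{..<n}. the_inv_into {..<m} h (x i)"
      have xi: "x i \<in> h ` {..<m}" if "i < n" for i
        using x that bij_betw_imp_surj_on[OF h] by (auto simp: space_Sn dest: PiE_mem)
      have inj: "inj_on h {..<m}" by (rule bij_betw_imp_inj_on[OF h])
      have "?g \<in> grid n m" using the_inv_into_into[OF inj xi subset_refl] by (simp add: restrict_PiE_iff)
      moreover have "pt n ?g = x"
      proof
        fix i show "pt n ?g i = x i"
          using x f_the_inv_into_f[OF inj xi] by (cases "i < n") (auto simp: pt_def space_Sn PiE_def extensional_def)
      qed
      ultimately show "x \<in> pt n ` grid n m" by (metis image_eqI)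
    qed
  qed
qed

text \<open>Regards a law on the finite product space as a tensor over l1^m; the value 0 off the
  grid makes it comparable with representations as a whole function.\<close>

definition arr :: "nat \<Rightarrow> (nat \<Rightarrow> 'a) measure \<Rightarrow> nat list \<Rightarrow> real" where
  "arr n \<mu> js = (if length js = n \<and> set js \<subseteq> {..<m} then measure \<mu> {pt n (\<lambda>i. js ! i)} else 0)"

lemma supported_arr: "supported m n (arr n \<mu>)"
  by (simp add: supported_def arr_def)

lemma pt_cong: "(\<And>i. i < n \<Longrightarrow> g i = k i) \<Longrightarrow> pt n g = pt n k"
  by (auto simp: pt_def)

lemma arr_idx:
  assumes "\<And>i. i < n \<Longrightarrow> g i < m"
  shows "arr n \<mu> (idx n g) = measure \<mu> {pt n g}"
proof -
  have "pt n (\<lambda>i. idx n g ! i) = pt n g" by (rule pt_cong) simp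
  then show ?thesis using assms by (auto simp: arr_def set_idx)
qed

lemma grid_less: "g \<in> grid n m \<Longrightarrow> i < n \<Longrightarrow> g i < m"
  by (auto dest: PiE_mem)

lemma pt_mem: "g \<in> grid n m \<Longrightarrow> pt n g \<in> space (Sn M n)"
  using bij_betwE[OF pt_bij] by blast

lemma measure_eq_sum_arr:
  assumes "prob_space \<mu>" and s: "sets \<mu> = sets (Sn M n)" and A: "A \<in> sets (Sn M n)"
  shows "measure \<mu> A = (\<Sum>g\<in>grid n m. arr n \<mu> (idx n g) * indicator A (pt n g))"
proof -
  interpret prob_space \<mu> by fact
  have fin: "finite (space (Sn M n))" using bij_betw_finite[OF pt_bij] by simp
  have AS: "A \<subseteq> space (Sn M n)" using A by (simp add: sets_Sn_Pow)
  have "measure \<mu> A = (\<Sum>x\<in>A. measure \<mu> {x})"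
    using AS s finite_subset[OF AS fin] by (intro finite_measure_eq_sum_singleton) (auto simp: sets_Sn_Pow)
  also have "\<dots> = (\<Sum>x\<in>space (Sn M n). measure \<mu> {x} * indicator A x)"
    using AS fin by (intro sum.mono_neutral_cong_left) auto
  also have "\<dots> = (\<Sum>g\<in>grid n m. measure \<mu> {pt n g} * indicator A (pt n g))"
    by (rule sum.reindex_bij_betw[OF pt_bij, symmetric])
  also have "\<dots> = (\<Sum>g\<in>grid n m. arr n \<mu> (idx n g) * indicator A (pt n g))"
    by (intro sum.cong refl) (simp add: arr_idx grid_less)
  finally show ?thesis .
qed

lemma arr_nonneg: "arr n \<mu> js \<ge> 0"
  by (simp add: arr_def)

lemma sum_arr:
  assumes "prob_space \<mu>" and s: "sets \<mu> = sets (Sn M n)"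
  shows "(\<Sum>g\<in>grid n m. \<bar>arr n \<mu> (idx n g)\<bar>) = 1"
proof -
  have "measure \<mu> (space (Sn M n)) = 1"
    using prob_space.prob_space[OF assms(1)] sets_eq_imp_space_eq[OF s] by simp
  then show ?thesis
    using measure_eq_sum_arr[OF assms, of "space (Sn M n)"] by (simp add: arr_nonneg pt_mem)
qed

lemma permute_coords_pt:
  assumes "\<sigma> permutes {..<n}"
  shows "permute_coords n \<sigma> (pt n g) = pt n (g \<circ> \<sigma>)"
  using assms by (auto simp: permute_coords_def pt_def permutes_lessThan)

lemma permute_coords_inj:
  assumes \<sigma>: "\<sigma> permutes {..<n}" and xy: "x \<in> space (Sn M n)" "y \<in> space (Sn M n)"
    and eq: "permute_coords n \<sigma> x = permute_coords n \<sigma> y"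
  shows "x = y"
proof
  fix i show "x i = y i"
  proof (cases "i < n")
    case True
    then have "inv \<sigma> i < n" using permutes_inv[OF \<sigma>] by (simp add: permutes_lessThan)
    then show ?thesis using fun_cong[OF eq, of "inv \<sigma> i"] by (simp add: permute_coords_def permutes_inverses[OF \<sigma>])
  qed (use xy in \<open>auto simp: space_Sn PiE_def extensional_def\<close>)
qed

lemma symmetric_arr:
  assumes \<mu>: "exch_dist M n \<mu>"
  shows "symmetric n (arr n \<mu>)"
  unfolding symmetric_def
proof (intro allI impI)
  fix \<sigma> js assume \<sigma>: "\<sigma> permutes {..<n}"
  have s: "sets \<mu> = sets (Sn M n)" using \<mu> by (simp add: exch_dist_def)
  show "arr n \<mu> (permute_idx \<sigma> js) = arr n \<mu> js"
  proof (cases "length js = n")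
    case True
    have js: "js = idx n (\<lambda>i. js ! i)" using idx_nth[OF True] by simp
    have pj: "permute_idx \<sigma> js = idx n (\<lambda>i. js ! \<sigma> i)"
      using True by (simp add: permute_idx_def idx_def)
    have st: "set (permute_idx \<sigma> js) = set js"
    proof -
      have "set (permute_idx \<sigma> js) = (\<lambda>i. js ! i) ` (\<sigma> ` {..<n})" by (auto simp: pj set_idx)
      also have "\<dots> = (\<lambda>i. js ! i) ` {..<n}" by (simp add: permutes_image[OF \<sigma>])
      also have "\<dots> = set js" using True by (subst (2) js) (simp add: set_idx)
      finally show ?thesis .
    qed
    show ?thesis
    proof (cases "set js \<subseteq> {..<m}")
      case sub: True
      have less: "js ! i < m" if "i < n" for i using sub True that by (auto simp: subset_iff)
      let ?x = "pt n (\<lambda>i. js ! i)"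
      have x: "?x \<in> space (Sn M n)" by (simp add: space_Sn pt_def restrict_PiE_iff h_mem less)
      have px: "permute_coords n \<sigma> ?x \<in> space (Sn M n)"
        using measurable_space[OF measurable_permute_coords[OF \<sigma>] x] .
      have "measure \<mu> {permute_coords n \<sigma> ?x} = measure \<mu> {y \<in> space \<mu>. permute_coords n \<sigma> y \<in> {permute_coords n \<sigma> ?x}}"
        by (rule exch_dist_measure[OF \<mu> \<sigma>, symmetric]) (use px in \<open>simp add: sets_Sn_Pow\<close>)
      \<comment> \<open>A coordinate permutation is injective, so the preimage of one permuted point
        is one point.\<close>
      also have "{y \<in> space \<mu>. permute_coords n \<sigma> y \<in> {permute_coords n \<sigma> ?x}} = {?x}"
        using x permute_coords_inj[OF \<sigma>] sets_eq_imp_space_eq[OF s] by auto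
      finally have "measure \<mu> {pt n ((\<lambda>i. js ! i) \<circ> \<sigma>)} = measure \<mu> {?x}" by (simp add: permute_coords_pt[OF \<sigma>])
      moreover have "arr n \<mu> js = measure \<mu> {?x}" using True sub by (simp add: arr_def)
      moreover have "arr n \<mu> (permute_idx \<sigma> js) = measure \<mu> {pt n ((\<lambda>i. js ! i) \<circ> \<sigma>)}"
        unfolding pj by (subst arr_idx) (auto simp: less permutes_lessThan[OF \<sigma>] comp_def)
      ultimately show ?thesis by simp
    next
      case False
      then show ?thesis by (simp add: arr_def st)
    qed
  qed (simp add: arr_def permute_idx_def)
qed

lemma represents_finite:
  assumes n: "n \<ge> 1" and m: "m \<ge> 1" and \<mu>: "exch_dist M n \<mu>"
  shows "\<exists>\<alpha> \<beta>. represents M n \<mu> \<alpha> \<beta> \<and> tv_norm (prob_algebra M) \<alpha> \<beta> \<le> c_pis n {..<m}"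
proof -
  have p: "prob_space \<mu>" and s: "sets \<mu> = sets (Sn M n)" using \<mu> by (auto simp: exch_dist_def)
  interpret prob_space \<mu> by fact
  obtain c where c: "pis_rep {..<m} n (arr n \<mu>) c"
    using pis_rep_supported_symmetric[OF n supported_arr symmetric_arr[OF \<mu>]] by blast
  have "\<exists>\<alpha> \<beta>. represents M n \<mu> \<alpha> \<beta> \<and> tv_norm (prob_algebra M) \<alpha> \<beta> \<le> pis_norm {..<m} n (arr n \<mu>)"
  \<comment> \<open>Here the tuple H is deterministic, an enumeration of the state space; all
    randomness of mu sits in the tensor, and the probabilities on the right become
    indicators.\<close>
  proof (rule represents_tensor[OF n m p _ c, where H="\<lambda>_. \<lambda>j\<in>{..<m}. h j"])
    show "(\<lambda>_. \<lambda>j\<in>{..<m}. h j) \<in> \<mu> \<rightarrow>\<^sub>M PiM {..<m} (\<lambda>_. M)"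
      by (rule measurable_const) (simp add: space_PiM restrict_PiE_iff h_mem)
    fix A assume A: "A \<in> sets (Sn M n)"
    have "measure \<mu> {x \<in> space \<mu>. (\<lambda>i\<in>{..<n}. (\<lambda>j\<in>{..<m}. h j) (g i)) \<in> A} = indicator A (pt n g)" if "g \<in> grid n m" for g
    proof -
      have "(\<lambda>i\<in>{..<n}. (\<lambda>j\<in>{..<m}. h j) (g i)) = pt n g" using grid_less[OF that] by (auto simp: pt_def)
      then show ?thesis by (simp add: indicator_def prob_space)
    qed
    then show "measure \<mu> A = (\<Sum>g\<in>grid n m. arr n \<mu> (idx n g) * measure \<mu> {x \<in> space \<mu>. (\<lambda>i\<in>{..<n}. (\<lambda>j\<in>{..<m}. h j) (g i)) \<in> A})"
      by (simp add: measure_eq_sum_arr[OF p s A])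
  qed
  moreover have "pis_norm {..<m} n (arr n \<mu>) \<le> c_pis n {..<m}"
    by (rule pis_norm_le_c_pis[OF n supported_arr symmetric_arr[OF \<mu>] sum_arr[OF p s]])
  ultimately show ?thesis by force
qed

text \<open>The converse of passing to \<open>arr\<close>: it supplies the laws against which the
  constants are shown to be optimal.\<close>

lemma exch_dist_exists:
  assumes t: "supported m n t" "symmetric n t" "\<And>js. t js \<ge> 0" "(\<Sum>g\<in>grid n m. t (idx n g)) = 1"
  shows "\<exists>\<mu>. exch_dist M n \<mu> \<and> arr n \<mu> = t"
proof -
  let ?P = "point_measure (grid n m) (\<lambda>g. ennreal (t (idx n g)))"
  define \<mu> where "\<mu> = distr ?P (Sn M n) (pt n)"
  have s: "sets \<mu> = sets (Sn M n)" by (simp add: \<mu>_def)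
  have e: "emeasure \<mu> A = ennreal (\<Sum>g\<in>grid n m. t (idx n g) * indicator A (pt n g))" if A: "A \<in> sets (Sn M n)" for A
  proof -
    have "emeasure \<mu> A = emeasure ?P (pt n -` A \<inter> grid n m)"
      unfolding \<mu>_def using A pt_mem by (subst emeasure_distr) (auto simp: space_point_measure)
    also have "\<dots> = (\<Sum>g\<in>pt n -` A \<inter> grid n m. ennreal (t (idx n g)))" by (rule emeasure_point_measure_finite) auto
    also have "\<dots> = (\<Sum>g\<in>grid n m. ennreal (t (idx n g)) * indicator A (pt n g))" by (rule sum_vimage_indicator) simp
    also have "\<dots> = (\<Sum>g\<in>grid n m. ennreal (t (idx n g) * indicator A (pt n g)))"
      by (intro sum.cong refl) (auto simp: indicator_def)
    also have "\<dots> = ennreal (\<Sum>g\<in>grid n m. t (idx n g) * indicator A (pt n g))"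
      by (rule sum_ennreal) (auto simp: t(3))
    finally show ?thesis .
  qed
  have me: "measure \<mu> A = (\<Sum>g\<in>grid n m. t (idx n g) * indicator A (pt n g))" if "A \<in> sets (Sn M n)" for A
    by (rule measure_eq_emeasure_eq_ennreal[OF _ e[OF that]]) (auto intro!: sum_nonneg mult_nonneg_nonneg t(3))
  have sp: "space \<mu> = space (Sn M n)" by (rule sets_eq_imp_space_eq[OF s])
  have p: "prob_space \<mu>"
  proof
    have "(\<Sum>g\<in>grid n m. t (idx n g) * indicator (space (Sn M n)) (pt n g)) = (\<Sum>g\<in>grid n m. t (idx n g))"
      by (intro sum.cong refl) (simp add: pt_mem)
    then show "emeasure \<mu> (space \<mu>) = 1" unfolding sp by (subst e) (simp_all add: t(4))
  qed
  have "distr \<mu> (Sn M n) (permute_coords n \<sigma>) = \<mu>" if \<sigma>: "\<sigma> permutes {..<n}" for \<sigma>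
  proof (rule measure_eqI)
    show "sets (distr \<mu> (Sn M n) (permute_coords n \<sigma>)) = sets \<mu>" by (simp add: s)
    fix A assume "A \<in> sets (distr \<mu> (Sn M n) (permute_coords n \<sigma>))"
    then have A: "A \<in> sets (Sn M n)" by simp
    have m': "permute_coords n \<sigma> \<in> \<mu> \<rightarrow>\<^sub>M Sn M n"
      using measurable_permute_coords[OF \<sigma>] by (subst measurable_cong_sets[OF s refl])
    let ?B = "permute_coords n \<sigma> -` A \<inter> space \<mu>"
    have "emeasure (distr \<mu> (Sn M n) (permute_coords n \<sigma>)) A = emeasure \<mu> ?B" by (rule emeasure_distr[OF m' A])
    also have "\<dots> = ennreal (\<Sum>g\<in>grid n m. t (idx n g) * indicator ?B (pt n g))"
      using measurable_sets[OF m' A] by (intro e) (simp add: s)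
    also have "(\<Sum>g\<in>grid n m. t (idx n g) * indicator ?B (pt n g)) = (\<Sum>g\<in>grid n m. t (idx n g) * indicator A (pt n g))"
    \<comment> \<open>Permuting coordinates of a point is composing its index with \<sigma>,
      restricted again to stay in the grid; the weights do not change because t is
      symmetric.\<close>
    proof (rule sum.reindex_bij_witness[where i="\<lambda>g. restrict (g \<circ> inv \<sigma>) {..<n}" and j="\<lambda>g. restrict (g \<circ> \<sigma>) {..<n}"])
      note inv = permutes_inv[OF \<sigma>]
      fix g assume g: "g \<in> grid n m"
      have ext: "k i = undefined" if "k \<in> grid n m" "\<not> i < n" for k i using that by (auto simp: PiE_def extensional_def)
      show "restrict (restrict (g \<circ> \<sigma>) {..<n} \<circ> inv \<sigma>) {..<n} = g"
        using ext[OF g] by (auto simp: fun_eq_iff permutes_lessThan[OF inv] permutes_inverses[OF \<sigma>])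
      show "restrict (restrict (g \<circ> inv \<sigma>) {..<n} \<circ> \<sigma>) {..<n} = g"
        using ext[OF g] by (auto simp: fun_eq_iff permutes_lessThan[OF \<sigma>] permutes_inverses[OF \<sigma>])
      show "restrict (g \<circ> \<sigma>) {..<n} \<in> grid n m" "restrict (g \<circ> inv \<sigma>) {..<n} \<in> grid n m"
        using grid_less[OF g] by (auto simp: restrict_PiE_iff permutes_lessThan[OF \<sigma>] permutes_lessThan[OF inv])
      have "idx n (restrict (g \<circ> \<sigma>) {..<n}) = idx n (g \<circ> \<sigma>)" by (rule idx_cong) simp
      then have 1: "t (idx n (restrict (g \<circ> \<sigma>) {..<n})) = t (idx n g)" using symmetric_idx[OF t(2) \<sigma>] by simp
      have "pt n (restrict (g \<circ> \<sigma>) {..<n}) = pt n (g \<circ> \<sigma>)" by (rule pt_cong) simp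
      then have "pt n (restrict (g \<circ> \<sigma>) {..<n}) = permute_coords n \<sigma> (pt n g)" by (simp add: permute_coords_pt[OF \<sigma>])
      then show "t (idx n (restrict (g \<circ> \<sigma>) {..<n})) * indicator A (pt n (restrict (g \<circ> \<sigma>) {..<n})) = t (idx n g) * indicator ?B (pt n g)"
        using pt_mem[OF g] by (simp add: 1 indicator_def sp)
    qed
    also have "ennreal \<dots> = emeasure \<mu> A" by (rule e[OF A, symmetric])
    finally show "emeasure (distr \<mu> (Sn M n) (permute_coords n \<sigma>)) A = emeasure \<mu> A" .
  qed
  then have "exch_dist M n \<mu>" using p s by (simp add: exch_dist_def)
  moreover have "arr n \<mu> = t"
  proof (rule supported_eqI[OF supported_arr t(1)])
    fix g assume g: "g \<in> grid n m"
    have "arr n \<mu> (idx n g) = measure \<mu> {pt n g}" by (simp add: arr_idx grid_less[OF g])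
    also have "\<dots> = (\<Sum>k\<in>grid n m. t (idx n k) * indicator {pt n g} (pt n k))"
      by (rule me) (simp add: sets_Sn_Pow pt_mem[OF g])
    also have "\<dots> = (\<Sum>k\<in>grid n m. if k = g then t (idx n k) else 0)"
      using bij_betw_imp_inj_on[OF pt_bij] g by (intro sum.cong refl) (auto simp: indicator_def inj_on_def)
    also have "\<dots> = t (idx n g)" using g by simp
    finally show "arr n \<mu> (idx n g) = t (idx n g)" .
  qed
  ultimately show ?thesis by blast
qed

end

section \<open>Lower bounds for the total variation\<close>

text \<open>Comparison with the step function that takes the value \<open>y v\<close> on the cell
  \<open>B v\<close>; it differs from f by at most \<epsilon> everywhere.\<close>

lemma integral_discretize:
  fixes f :: "'p \<Rightarrow> real"
  assumes "finite_measure \<gamma>" and V: "finite V"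
    and B: "\<And>v. v \<in> V \<Longrightarrow> B v \<in> sets \<gamma>" and cover: "\<And>p. p \<in> space \<gamma> \<Longrightarrow> cell p \<in> V"
    and cell: "\<And>p v. p \<in> space \<gamma> \<Longrightarrow> v \<in> V \<Longrightarrow> p \<in> B v \<longleftrightarrow> cell p = v"
    and f: "f \<in> borel_measurable \<gamma>" "\<And>p. p \<in> space \<gamma> \<Longrightarrow> \<bar>f p\<bar> \<le> 1"
    and close: "\<And>p. p \<in> space \<gamma> \<Longrightarrow> \<bar>f p - y (cell p)\<bar> \<le> \<epsilon>"
  shows "\<bar>(\<integral>p. f p \<partial>\<gamma>) - (\<Sum>v\<in>V. y v * measure \<gamma> (B v))\<bar> \<le> \<epsilon> * measure \<gamma> (space \<gamma>)"
proof -
  interpret finite_measure \<gamma> by fact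
  let ?F = "\<lambda>p. \<Sum>v\<in>V. y v * indicator (B v) p"
  have F: "?F p = y (cell p)" if p: "p \<in> space \<gamma>" for p
  proof -
    have "?F p = (\<Sum>v\<in>V. if v = cell p then y v else 0)" using cell[OF p] by (intro sum.cong) (auto simp: indicator_def)
    then show ?thesis using V cover[OF p] by simp
  qed
  have If: "integrable \<gamma> f" by (rule integrable_const_bound[of _ 1]) (use f in auto)
  have IF: "integrable \<gamma> ?F"
    using B by (intro Bochner_Integration.integrable_sum integrable_mult_right integrable_real_indicator) (auto simp: less_top[symmetric])
  have "(\<integral>p. ?F p \<partial>\<gamma>) = (\<Sum>v\<in>V. \<integral>p. y v * indicator (B v) p \<partial>\<gamma>)"
    using B by (intro Bochner_Integration.integral_sum integrable_mult_right integrable_real_indicator) (auto simp: less_top[symmetric])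
  also have "\<dots> = (\<Sum>v\<in>V. y v * measure \<gamma> (B v))"
    using B by (intro sum.cong refl) (simp add: Int_absorb2 sets.sets_into_space)
  finally have "(\<integral>p. f p \<partial>\<gamma>) - (\<Sum>v\<in>V. y v * measure \<gamma> (B v)) = (\<integral>p. f p - ?F p \<partial>\<gamma>)"
    using If IF by simp
  also have "\<bar>\<dots>\<bar> \<le> (\<integral>p. \<bar>f p - ?F p\<bar> \<partial>\<gamma>)" by (rule integral_abs_bound)
  also have "\<dots> \<le> (\<integral>p. \<epsilon> \<partial>\<gamma>)"
    using If IF close by (intro integral_mono integrable_abs Bochner_Integration.integrable_diff) (auto simp: F)
  also have "\<dots> = \<epsilon> * measure \<gamma> (space \<gamma>)" by simp
  finally show ?thesis .
qed

text \<open>Beyond reindexing a partition by numbers, the point is that the supremum is finite: the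
  total masses of both measures bound all partition sums.\<close>

lemma sum_le_tv_norm:
  assumes "finite_measure \<alpha>" "finite_measure \<beta>" "sets \<alpha> = sets R" "sets \<beta> = sets R"
    and V: "finite V" and B: "\<And>v. v \<in> V \<Longrightarrow> B v \<in> sets R" "disjoint_family_on B V"
  shows "(\<Sum>v\<in>V. \<bar>measure \<alpha> (B v) - measure \<beta> (B v)\<bar>) \<le> tv_norm R \<alpha> \<beta>"
proof -
  interpret A: finite_measure \<alpha> by fact
  interpret B: finite_measure \<beta> by fact
  obtain b where b: "bij_betw b {..<card V} V" using ex_bij_betw_nat_finite[OF V]
    by (auto simp: atLeast0LessThan)
  have "disjoint_family_on (B \<circ> b) {..<card V}"
    unfolding disjoint_family_on_def
  proof (intro ballI impI)
    fix i j assume ij: "i \<in> {..<card V}" "j \<in> {..<card V}" "i \<noteq> j"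
    then have "b i \<in> V" "b j \<in> V" "b i \<noteq> b j"
      using bij_betwE[OF b] inj_onD[OF bij_betw_imp_inj_on[OF b]] by blast+
    then show "(B \<circ> b) i \<inter> (B \<circ> b) j = {}" using B(2) by (simp add: disjoint_family_onD)
  qed
  moreover have "\<forall>i<card V. (B \<circ> b) i \<in> sets R" using bij_betwE[OF b] B(1) by auto
  moreover have "(\<Sum>v\<in>V. \<bar>measure \<alpha> (B v) - measure \<beta> (B v)\<bar>)
      = (\<Sum>i<card V. \<bar>measure \<alpha> ((B \<circ> b) i) - measure \<beta> ((B \<circ> b) i)\<bar>)"
    using sum.reindex_bij_betw[OF b, of "\<lambda>v. \<bar>measure \<alpha> (B v) - measure \<beta> (B v)\<bar>"] by simp
  ultimately have mem: "(\<Sum>v\<in>V. \<bar>measure \<alpha> (B v) - measure \<beta> (B v)\<bar>) \<in>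
      {(\<Sum>i<k. \<bar>measure \<alpha> (C i) - measure \<beta> (C i)\<bar>) | (k::nat) C. (\<forall>i<k. C i \<in> sets R) \<and> disjoint_family_on C {..<k}}"
    by blast
  show ?thesis unfolding tv_norm_def
  proof (rule cSup_upper[OF mem], rule bdd_aboveI)
    fix s assume "s \<in> {(\<Sum>i<k. \<bar>measure \<alpha> (C i) - measure \<beta> (C i)\<bar>) | (k::nat) C. (\<forall>i<k. C i \<in> sets R) \<and> disjoint_family_on C {..<k}}"
    then obtain k C where s: "s = (\<Sum>i<(k::nat). \<bar>measure \<alpha> (C i) - measure \<beta> (C i)\<bar>)"
      and C: "\<And>i. i < k \<Longrightarrow> C i \<in> sets R" "disjoint_family_on C {..<k}" by blast
    have "s \<le> (\<Sum>i<k. measure \<alpha> (C i) + measure \<beta> (C i))" unfolding s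
      by (intro sum_mono) (metis abs_triangle_ineq4 abs_of_nonneg measure_nonneg)
    also have "\<dots> = measure \<alpha> (\<Union>i<k. C i) + measure \<beta> (\<Union>i<k. C i)"
      using C assms(3,4) by (subst A.finite_measure_finite_Union, simp, force, simp, subst B.finite_measure_finite_Union, simp, force, simp)
         (simp add: sum.distrib)
    also have "\<dots> \<le> measure \<alpha> (space \<alpha>) + measure \<beta> (space \<beta>)"
      by (intro add_mono A.bounded_measure B.bounded_measure)
    finally show "s \<le> measure \<alpha> (space \<alpha>) + measure \<beta> (space \<beta>)" .
  qed
qed

lemma symmetric_tpow: "symmetric n (tpow n x)"
  unfolding symmetric_def
proof (intro allI impI)
  fix \<sigma> js assume \<sigma>: "\<sigma> permutes {..<n}"
  show "tpow n x (permute_idx \<sigma> js) = tpow n x js"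
  proof (cases "length js = n")
    case True
    have "permute_idx \<sigma> js = idx n ((\<lambda>i. js ! i) \<circ> \<sigma>)" using permute_idx_idx[OF \<sigma>, of "\<lambda>i. js ! i"] by (simp add: idx_nth[OF True])
    moreover have "tpow n x js = tpow n x (idx n (\<lambda>i. js ! i))" by (simp add: idx_nth[OF True])
    ultimately show ?thesis using prod.permute[OF \<sigma>, of "\<lambda>i. x (js ! i)"] by (simp add: comp_def)
  qed (simp add: permute_idx_def)
qed

section \<open>Discretisation of a representing signed measure on a finite state space\<close>

context finite_states
begin

lemma measure_Sn_pt:
  assumes \<nu>: "\<nu> \<in> space (prob_algebra M)" and g: "g \<in> grid n m"
  shows "measure (Sn \<nu> n) {pt n g} = (\<Prod>i<n. measure \<nu> {h (g i)})"
proof -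
  have "prob_space \<nu>" using \<nu> by (simp add: space_prob_algebra)
  then interpret prob_space \<nu> .
  have "{pt n g} = PiE {..<n} (\<lambda>i. {pt n g i})"
    by (rule PiE_singleton[symmetric]) (simp add: pt_def)
  also have "\<dots> = PiE {..<n} (\<lambda>i. {h (g i)})" by (rule PiE_cong) (simp add: pt_def)
  finally have "{pt n g} = PiE {..<n} (\<lambda>i. {h (g i)})" .
  then have "emeasure (Sn \<nu> n) {pt n g} = (\<Prod>i<n. emeasure \<nu> {h (g i)})"
    using emeasure_Sn_PiE[OF \<nu>, of n "\<lambda>i. {h (g i)}"] grid_less[OF g] by (simp add: sets_M h_mem)
  also have "\<dots> = ennreal (\<Prod>i<n. measure \<nu> {h (g i)})"
    by (simp add: emeasure_eq_measure prod_ennreal)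
  finally show ?thesis by (intro measure_eq_emeasure_eq_ennreal) (auto intro: prod_nonneg)
qed

definition coords :: "'a measure \<Rightarrow> nat \<Rightarrow> real" where
  "coords \<nu> = (\<lambda>j. if j < m then measure \<nu> {h j} else 0)"

lemma coords_prob_vec:
  assumes \<nu>: "\<nu> \<in> space (prob_algebra M)"
  shows "coords \<nu> \<in> prob_vec m"
proof -
  have s: "sets \<nu> = sets M" and "prob_space \<nu>" using \<nu> by (auto simp: space_prob_algebra)
  then interpret prob_space \<nu> by simp
  have "measure \<nu> (space M) = (\<Sum>x\<in>space M. measure \<nu> {x})"
    using finite_space by (intro finite_measure_eq_sum_singleton) (auto simp: s sets_M)
  also have "\<dots> = (\<Sum>j<m. measure \<nu> {h j})" by (rule sum.reindex_bij_betw[OF h, symmetric])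
  finally have "(\<Sum>j<m. measure \<nu> {h j}) = 1" using prob_space sets_eq_imp_space_eq[OF s] by simp
  then show ?thesis by (simp add: prob_vec_def coords_def)
qed

text \<open>Cutting the simplex of probability vectors into cells of side 1/N turns a representing signed
  measure into a finite positive representation of nearly the same tensor; the error is symmetric and
  hence small in the positive symmetric norm as well.\<close>

lemma pis_norm_le_tv_norm_approx:
  assumes n: "n \<ge> 1" and N: "N \<ge> (1::nat)" and \<mu>: "exch_dist M n \<mu>" and rep: "represents M n \<mu> \<alpha> \<beta>"
  shows "pis_norm {..<m} n (arr n \<mu>) \<le> tv_norm (prob_algebra M) \<alpha> \<beta>
    + kappa n * (real (card (grid n m)) * ((real n / real N) * (measure \<alpha> (space \<alpha>) + measure \<beta> (space \<beta>))))"
proof -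
  let ?R = "prob_algebra M"
  have \<alpha>: "finite_measure \<alpha>" "sets \<alpha> = sets ?R" and \<beta>: "finite_measure \<beta>" "sets \<beta> = sets ?R"
    and eq: "\<And>A. A \<in> sets (Sn M n) \<Longrightarrow> measure \<mu> A = (\<integral>\<nu>. measure (Sn \<nu> n) A \<partial>\<alpha>) - (\<integral>\<nu>. measure (Sn \<nu> n) A \<partial>\<beta>)"
    using rep by (auto simp: represents_def)
  let ?t = "arr n \<mu>"
  define cell where "cell \<nu> = (\<lambda>j\<in>{..<m}. nat \<lfloor>real N * coords \<nu> j\<rfloor>)" for \<nu>
  define V where "V = cell ` space ?R"
  define B where "B v = {\<nu> \<in> space ?R. cell \<nu> = v}" for v
  \<comment> \<open>The representative is taken from a measure inside the cell, not from a grid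
    corner, so it is a true probability vector of norm 1. V holds only nonempty cells, so the choice
    is sound.\<close>
  define x where "x v = coords (SOME \<nu>. \<nu> \<in> B v)" for v
  define y where "y g v = (\<Prod>i<n. x v (g i))" for g v
  define c where "c v = measure \<alpha> (B v) - measure \<beta> (B v)" for v
  define s where "s js = (\<Sum>v\<in>V. c v * tpow n (x v) js)" for js
  let ?C = "measure \<alpha> (space \<alpha>) + measure \<beta> (space \<beta>)"
  have coords01: "0 \<le> coords \<nu> j" "coords \<nu> j \<le> 1" if "\<nu> \<in> space ?R" for \<nu> j
    using that by (auto simp: coords_def space_prob_algebra intro: prob_space.prob_le_1)
  have "V \<subseteq> PiE {..<m} (\<lambda>_. {..N})"
  proof -
    have "nat \<lfloor>real N * coords \<nu> j\<rfloor> \<le> N" if \<nu>: "\<nu> \<in> space ?R" for \<nu> j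
    proof -
      have "real N * coords \<nu> j \<le> real N * 1" by (intro mult_left_mono coords01[OF \<nu>]) simp
      then have "\<lfloor>real N * coords \<nu> j\<rfloor> \<le> int N" by (simp add: floor_le_iff)
      then show ?thesis by simp
    qed
    then show ?thesis unfolding V_def cell_def by (simp add: image_subset_iff restrict_PiE_iff)
  qed
  then have finV: "finite V" by (rule finite_subset) (simp add: finite_PiE)
  have Bsets: "B v \<in> sets ?R" if "v \<in> V" for v
  proof -
    have v: "v \<in> extensional {..<m}" using that by (auto simp: V_def cell_def)
    have "B v = {\<nu> \<in> space ?R. \<forall>j\<in>{..<m}. nat \<lfloor>real N * measure \<nu> {h j}\<rfloor> = v j}"
      using v by (auto simp: B_def cell_def coords_def fun_eq_iff extensional_def)
    also have "\<dots> \<in> sets ?R"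
    proof (rule sets.sets_Collect_finite_All)
      fix j assume "j \<in> {..<m}"
      then have "{h j} \<in> sets M" by (simp add: sets_M h_mem)
      then have [measurable]: "(\<lambda>\<nu>. measure \<nu> {h j}) \<in> borel_measurable ?R" by (rule measurable_measure_prob_algebra)
      show "{\<nu> \<in> space ?R. nat \<lfloor>real N * measure \<nu> {h j}\<rfloor> = v j} \<in> sets ?R" by measurable
    qed simp
    finally show ?thesis .
  qed
  have some: "(SOME \<nu>. \<nu> \<in> B v) \<in> B v" if "v \<in> V" for v
  proof -
    have "\<exists>\<nu>. \<nu> \<in> B v" using that by (auto simp: V_def B_def)
    then show ?thesis by (rule someI_ex)
  qed
  have xp: "x v \<in> prob_vec m" if "v \<in> V" for v
    using some[OF that] unfolding x_def by (intro coords_prob_vec) (simp add: B_def)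
  have close: "\<bar>measure (Sn \<nu> n) {pt n g} - y g (cell \<nu>)\<bar> \<le> real n / real N"
    if \<nu>: "\<nu> \<in> space ?R" and g: "g \<in> grid n m" for \<nu> g
  proof -
    define \<nu>' where "\<nu>' = (SOME \<nu>'. \<nu>' \<in> B (cell \<nu>))"
    have "\<nu>' \<in> B (cell \<nu>)" unfolding \<nu>'_def using \<nu> by (intro some) (simp add: V_def)
    then have \<nu>': "\<nu>' \<in> space ?R" "cell \<nu>' = cell \<nu>" by (auto simp: B_def)
    have d: "\<bar>coords \<nu> j - coords \<nu>' j\<bar> \<le> 1 / real N" if j: "j < m" for j
    proof -
      have "nat \<lfloor>real N * coords \<nu> j\<rfloor> = nat \<lfloor>real N * coords \<nu>' j\<rfloor>"
        using fun_cong[OF \<nu>'(2), of j] j by (simp add: cell_def)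
      moreover have "0 \<le> real N * coords \<nu> j" "0 \<le> real N * coords \<nu>' j"
        using coords01 \<nu> \<nu>'(1) by auto
      ultimately have "\<lfloor>real N * coords \<nu> j\<rfloor> = \<lfloor>real N * coords \<nu>' j\<rfloor>"
        by (simp add: nat_eq_iff)
      then have "\<bar>real N * coords \<nu> j - real N * coords \<nu>' j\<bar> \<le> 1" by linarith
      then have "real N * \<bar>coords \<nu> j - coords \<nu>' j\<bar> \<le> 1"
        by (simp add: abs_mult flip: right_diff_distrib)
      then show ?thesis using N by (simp add: pos_le_divide_eq mult.commute)
    qed
    have "measure (Sn \<nu> n) {pt n g} = (\<Prod>i<n. coords \<nu> (g i))"
      unfolding measure_Sn_pt[OF \<nu> g] by (intro prod.cong) (auto simp: coords_def grid_less[OF g])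
    moreover have "y g (cell \<nu>) = (\<Prod>i<n. coords \<nu>' (g i))" by (simp add: y_def x_def \<nu>'_def)
    ultimately have "\<bar>measure (Sn \<nu> n) {pt n g} - y g (cell \<nu>)\<bar> = norm ((\<Prod>i<n. coords \<nu> (g i)) - (\<Prod>i<n. coords \<nu>' (g i)))" by simp
    \<comment> \<open>Products of n numbers in [0,1] differ by at most the sum of the differences of
      the factors, each at most 1/N within a cell: hence n/N.\<close>
    also have "\<dots> \<le> (\<Sum>i<n. norm (coords \<nu> (g i) - coords \<nu>' (g i)))"
      using coords01[OF \<nu>] coords01[OF \<nu>'(1)] by (intro norm_prod_diff) auto
    also have "\<dots> \<le> (\<Sum>i<n. 1 / real N)" using d grid_less[OF g] by (intro sum_mono) auto
    finally show ?thesis by simp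
  qed
  have disc: "\<bar>(\<integral>\<nu>. measure (Sn \<nu> n) {pt n g} \<partial>\<gamma>) - (\<Sum>v\<in>V. y g v * measure \<gamma> (B v))\<bar> \<le> real n / real N * measure \<gamma> (space \<gamma>)"
    if \<gamma>: "finite_measure \<gamma>" "sets \<gamma> = sets ?R" and g: "g \<in> grid n m" for \<gamma> g
  proof -
    have sp: "space \<gamma> = space ?R" by (rule sets_eq_imp_space_eq[OF \<gamma>(2)])
    have A: "{pt n g} \<in> sets (Sn M n)" using pt_mem[OF g] by (simp add: sets_Sn_Pow)
    show ?thesis
    proof (rule integral_discretize[OF \<gamma>(1) finV])
      show "(\<lambda>\<nu>. measure (Sn \<nu> n) {pt n g}) \<in> borel_measurable \<gamma>"
        using measurable_measure_Sn[OF A] by (subst measurable_cong_sets[OF \<gamma>(2) refl])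
    qed (use Bsets close[OF _ g] measure_Sn_le_1 in \<open>auto simp: sp \<gamma>(2) V_def B_def\<close>)
  qed
  have err: "\<bar>?t (idx n g) - s (idx n g)\<bar> \<le> real n / real N * ?C" if g: "g \<in> grid n m" for g
  proof -
    have "?t (idx n g) = (\<integral>\<nu>. measure (Sn \<nu> n) {pt n g} \<partial>\<alpha>) - (\<integral>\<nu>. measure (Sn \<nu> n) {pt n g} \<partial>\<beta>)"
      using pt_mem[OF g] by (simp add: arr_idx grid_less[OF g] eq sets_Sn_Pow)
    moreover have "s (idx n g) = (\<Sum>v\<in>V. y g v * measure \<alpha> (B v)) - (\<Sum>v\<in>V. y g v * measure \<beta> (B v))"
      unfolding s_def c_def y_def by (simp add: algebra_simps flip: sum_subtractf)
    ultimately show ?thesis using disc[OF \<alpha> g] disc[OF \<beta> g] by (simp add: algebra_simps abs_le_iff)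
  qed
  \<comment> \<open>As all vectors have norm 1, the cost of s is a partition sum for the total
    variation.\<close>
  have s_rep: "pis_rep {..<m} n s (\<Sum>v\<in>V. \<bar>c v\<bar>)"
    by (rule pis_repI[OF finV, where x=x and a=c])
       (use xp in \<open>auto simp: s_def l1norm_prob_vec[OF xp] prob_vec_def intro: prob_vec_l1vec[OF xp]\<close>)
  have "disjoint_family_on B V" by (auto simp: disjoint_family_on_def B_def)
  then have s_le: "pis_norm {..<m} n s \<le> tv_norm ?R \<alpha> \<beta>"
    using pis_norm_le[OF s_rep] sum_le_tv_norm[OF \<alpha>(1) \<beta>(1) \<alpha>(2) \<beta>(2) finV Bsets] unfolding c_def by fastforce
  \<comment> \<open>The remainder is small only entrywise; being symmetric, it has a positive
    representation of cost at most kappa times its entry sum.\<close>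
  define r where "r js = ?t js - s js" for js
  have s_sup: "supported m n s" unfolding s_def by (intro supported_sum supported_tpow prob_vec_l1vec xp)
  have r_sup: "supported m n r" using s_sup supported_arr[of n \<mu>] by (auto simp: supported_def r_def)
  have r_sym: "symmetric n r"
    using symmetric_arr[OF \<mu>] symmetric_tpow unfolding symmetric_def r_def s_def by auto
  obtain d where d: "pis_rep {..<m} n r d" "d \<le> kappa n * (\<Sum>g\<in>grid n m. \<bar>r (idx n g)\<bar>)"
    using pis_rep_supported_symmetric[OF n r_sup r_sym] by blast
  have "?t = (\<lambda>js. 1 * s js + 1 * r js)" by (simp add: r_def)
  then have "pis_norm {..<m} n ?t \<le> pis_norm {..<m} n s + pis_norm {..<m} n r"
    using pis_norm_lincomb[OF s_rep d(1), of 1 1] by simp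
  moreover have "pis_norm {..<m} n r \<le> kappa n * (\<Sum>g\<in>grid n m. \<bar>r (idx n g)\<bar>)"
    using pis_norm_le[OF d(1)] d(2) by linarith
  moreover have "(\<Sum>g\<in>grid n m. \<bar>r (idx n g)\<bar>) \<le> real (card (grid n m)) * (real n / real N * ?C)"
    unfolding r_def by (rule sum_bounded_above[OF err])
  then have "kappa n * (\<Sum>g\<in>grid n m. \<bar>r (idx n g)\<bar>) \<le> kappa n * (real (card (grid n m)) * (real n / real N * ?C))"
    using kappa_pos[OF n] by (intro mult_left_mono) auto
  ultimately show ?thesis using s_le by linarith
qed

lemma pis_norm_le_tv_norm:
  assumes n: "n \<ge> 1" and \<mu>: "exch_dist M n \<mu>" and rep: "represents M n \<mu> \<alpha> \<beta>"
  shows "pis_norm {..<m} n (arr n \<mu>) \<le> tv_norm (prob_algebra M) \<alpha> \<beta>"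
proof (rule field_le_epsilon)
  fix e :: real assume e: "e > 0"
  define D where "D = kappa n * (real (card (grid n m)) * (real n * (measure \<alpha> (space \<alpha>) + measure \<beta> (space \<beta>))))"
  obtain N :: nat where N: "D / e < real N" using reals_Archimedean2 by blast
  have D0: "D \<ge> 0" unfolding D_def using kappa_pos[OF n] by (intro mult_nonneg_nonneg add_nonneg_nonneg) auto
  then have N1: "N \<ge> 1" using N e by (cases N) (auto simp: field_simps)
  have "D / real N \<le> e" using N N1 e by (simp add: field_simps)
  moreover have "pis_norm {..<m} n (arr n \<mu>) \<le> tv_norm (prob_algebra M) \<alpha> \<beta> + D / real N"
    using pis_norm_le_tv_norm_approx[OF n N1 \<mu> rep] by (simp add: D_def field_simps)
  ultimately show "pis_norm {..<m} n (arr n \<mu>) \<le> tv_norm (prob_algebra M) \<alpha> \<beta> + e" by linarith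
qed

text \<open>A constant valid for all exchangeable laws bounds the norm of nonnegative symmetric
  arrays by scaling. A general symmetric array is split by entrywise sign; both parts stay
  symmetric, and their masses add up to the projective norm.\<close>

lemma c_pis_le:
  assumes n: "n \<ge> 1" and m: "m \<ge> 1"
    and C: "\<And>\<mu>. exch_dist M n \<mu> \<Longrightarrow> \<exists>\<alpha> \<beta>. represents M n \<mu> \<alpha> \<beta> \<and> tv_norm (prob_algebra M) \<alpha> \<beta> \<le> C"
  shows "c_pis n {..<m} \<le> C"
proof -
  have nonneg: "pis_norm {..<m} n u \<le> C * (\<Sum>g\<in>grid n m. u (idx n g))"
    if u: "supported m n u" "symmetric n u" "\<And>js. u js \<ge> 0" for u
  proof (cases "(\<Sum>g\<in>grid n m. u (idx n g)) = 0")
    case True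
    then have "u (idx n g) = 0" if "g \<in> grid n m" for g
      using that u(3) by (subst (asm) sum_nonneg_eq_0_iff) auto
    then have "u = (\<lambda>_. 0)" by (intro supported_eqI[OF u(1)]) (auto simp: supported_def)
    then show ?thesis using pis_norm_le[OF pis_rep_zero] by simp
  next
    case False
    define S where "S = (\<Sum>g\<in>grid n m. u (idx n g))"
    have S: "S > 0" using False sum_nonneg[of "grid n m" "\<lambda>g. u (idx n g)"] u(3) by (simp add: S_def less_le)
    let ?t = "\<lambda>js. u js / S"
    have t: "supported m n ?t" "symmetric n ?t" using u by (auto simp: supported_def symmetric_def)
    have "(\<Sum>g\<in>grid n m. ?t (idx n g)) = 1" using S by (simp add: S_def flip: sum_divide_distrib)
    then obtain \<mu> where \<mu>: "exch_dist M n \<mu>" "arr n \<mu> = ?t"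
      using exch_dist_exists[OF t] u(3) S by auto
    obtain \<alpha> \<beta> where ab: "represents M n \<mu> \<alpha> \<beta>" "tv_norm (prob_algebra M) \<alpha> \<beta> \<le> C" using C[OF \<mu>(1)] by blast
    have le: "pis_norm {..<m} n ?t \<le> C" using pis_norm_le_tv_norm[OF n \<mu>(1) ab(1)] ab(2) \<mu>(2) by simp
    obtain d where d: "pis_rep {..<m} n ?t d" using pis_rep_supported_symmetric[OF n t] by blast
    \<comment> \<open>Homogeneity is obtained from the estimate for linear combinations, with a
      dummy second term.\<close>
    have "u = (\<lambda>js. S * ?t js + 0 * ?t js)" using S by simp
    then have "pis_norm {..<m} n u \<le> S * pis_norm {..<m} n ?t"
      using pis_norm_lincomb[OF d d, of S 0] S by simp
    also have "\<dots> \<le> S * C" using le S by (intro mult_left_mono) auto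
    finally show ?thesis by (simp add: S_def mult.commute)
  qed
  show ?thesis unfolding c_pis_def
  proof (rule cSup_least)
    \<comment> \<open>A nonzero symmetric tensor, showing that the set of ratios is
      nonempty.\<close>
    let ?e = "tpow n (unitvec 0)"
    have "?e (idx n (\<lambda>_. 0)) \<noteq> 0" by (simp add: unitvec_def)
    then have "?e \<noteq> (\<lambda>_. 0)" by metis
    moreover have "?e \<in> sym_tensor_pow {..<m} n"
      using m by (intro supported_in_sym_tensor_pow supported_tpow symmetric_tpow unitvec_l1vec) auto
    ultimately show "{pis_norm {..<m} n t / proj_norm {..<m} n t |t. t \<in> sym_tensor_pow {..<m} n \<and> t \<noteq> (\<lambda>_. 0)} \<noteq> {}" by blast
  next
    fix q assume "q \<in> {pis_norm {..<m} n t / proj_norm {..<m} n t |t. t \<in> sym_tensor_pow {..<m} n \<and> t \<noteq> (\<lambda>_. 0)}"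
    then obtain t where q: "q = pis_norm {..<m} n t / proj_norm {..<m} n t"
      and t: "t \<in> sym_tensor_pow {..<m} n" "t \<noteq> (\<lambda>_. 0)" by blast
    have sym: "symmetric n t" using t(1) by (simp add: sym_tensor_pow_eq)
    obtain c where "proj_rep {..<m} n t c" using t(1) by (auto simp: sym_tensor_pow_eq tensor_pow_iff)
    then obtain c' where "pis_rep {..<m} n t c'" using pis_rep_if_proj_rep[OF n sym] by blast
    then have sup: "supported m n t" by (rule pis_rep_supported)
    define p where "p js = max (t js) 0" for js
    define q' where "q' js = max (- t js) 0" for js
    have p: "supported m n p" "symmetric n p" "\<And>js. p js \<ge> 0" using sup sym by (auto simp: supported_def symmetric_def p_def)
    have q': "supported m n q'" "symmetric n q'" "\<And>js. q' js \<ge> 0" using sup sym by (auto simp: supported_def symmetric_def q'_def)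
    obtain d where d: "pis_rep {..<m} n p d" using pis_rep_supported_symmetric[OF n p(1,2)] by blast
    obtain d' where d': "pis_rep {..<m} n q' d'" using pis_rep_supported_symmetric[OF n q'(1,2)] by blast
    have "t = (\<lambda>js. 1 * p js + (- 1) * q' js)" by (auto simp: p_def q'_def)
    then have "pis_norm {..<m} n t \<le> pis_norm {..<m} n p + pis_norm {..<m} n q'"
      using pis_norm_lincomb[OF d d', of 1 "- 1"] by simp
    also have "\<dots> \<le> C * (\<Sum>g\<in>grid n m. p (idx n g)) + C * (\<Sum>g\<in>grid n m. q' (idx n g))"
      by (intro add_mono nonneg p q')
    also have "\<dots> = C * (\<Sum>g\<in>grid n m. p (idx n g) + q' (idx n g))" by (simp add: sum.distrib distrib_left)
    also have "(\<Sum>g\<in>grid n m. p (idx n g) + q' (idx n g)) = proj_norm {..<m} n t"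
      unfolding proj_norm_supported[OF sup subset_refl] by (intro sum.cong refl) (simp add: p_def q'_def)
    finally have le: "pis_norm {..<m} n t \<le> C * proj_norm {..<m} n t" .
    have "proj_norm {..<m} n t \<noteq> 0"
    proof
      assume "proj_norm {..<m} n t = 0"
      then have "t (idx n g) = 0" if "g \<in> grid n m" for g
        using that unfolding proj_norm_supported[OF sup subset_refl] by (subst (asm) sum_nonneg_eq_0_iff) auto
      then have "t = (\<lambda>_. 0)" by (intro supported_eqI[OF sup]) (auto simp: supported_def)
      then show False using t(2) by simp
    qed
    moreover have "proj_norm {..<m} n t \<ge> 0" unfolding proj_norm_supported[OF sup subset_refl] by (intro sum_nonneg) simp
    ultimately have "proj_norm {..<m} n t > 0" by simp
    then show "q \<le> C" using le by (simp add: q divide_le_eq)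
  qed
qed

end

text \<open>The extremal law is that of a uniformly random permutation of n points, that is, drawing
  all n points without replacement: its array is the unit tensor.\<close>

lemma kappa_best_possible:
  assumes n: "n \<ge> 1"
  shows "\<exists>(M :: nat measure) \<mu>. exch_dist M n \<mu> \<and>
    (\<forall>\<alpha> \<beta>. represents M n \<mu> \<alpha> \<beta> \<longrightarrow> tv_norm (prob_algebra M) \<alpha> \<beta> \<ge> kappa n)"
proof -
  interpret finite_states "count_space {..<n}" n id by standard simp_all
  have "(\<Sum>g\<in>grid n n. tvee n unitvec (idx n g)) = 1"
    using sum_tvee_unitvec_eq_1[of n] by (simp add: tvee_nonneg unitvec_def)
  then obtain \<mu> where \<mu>: "exch_dist (count_space {..<n}) n \<mu>" "arr n \<mu> = tvee n unitvec"
    using exch_dist_exists[OF supported_tvee_unitvec symmetric_tvee] by (auto simp: tvee_nonneg unitvec_def)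
  have "kappa n \<le> tv_norm (prob_algebra (count_space {..<n})) \<alpha> \<beta>" if "represents (count_space {..<n}) n \<mu> \<alpha> \<beta>" for \<alpha> \<beta>
    using pis_norm_le_tv_norm[OF n \<mu>(1) that] by (simp add: \<mu>(2) kappa_def)
  then show ?thesis using \<mu>(1) by blast
qed

theorem theorem7p1:
  fixes n :: nat
  assumes "n \<ge> 1"
  shows "kappa n = c_pis n UNIV
    \<and> (\<forall>(M :: 'a measure) (P :: 'b measure) X. exchangeable P M n X \<longrightarrow>
          (\<exists>\<alpha> \<beta>. represents M n (distr P (Sn M n) X) \<alpha> \<beta>
                 \<and> tv_norm (prob_algebra M) \<alpha> \<beta> \<le> kappa n))
    \<and> (\<exists>(M :: nat measure) \<mu>. exch_dist M n \<mu> \<and>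
          (\<forall>\<alpha> \<beta>. represents M n \<mu> \<alpha> \<beta> \<longrightarrow> tv_norm (prob_algebra M) \<alpha> \<beta> \<ge> kappa n))
    \<and> real n ^ n / fact n \<le> kappa n
    \<and> kappa n \<le> 2 ^ (n - 1) * real n ^ n / fact n
    \<and> (\<forall>(M :: 'c measure) m. finite (space M) \<and> card (space M) = m \<and> m \<ge> 1
          \<and> sets M = Pow (space M) \<longrightarrow>
          (let good = (\<lambda>C. \<forall>\<mu>. exch_dist M n \<mu> \<longrightarrow>
                     (\<exists>\<alpha> \<beta>. represents M n \<mu> \<alpha> \<beta> \<and> tv_norm (prob_algebra M) \<alpha> \<beta> \<le> C))
           in good (c_pis n {..<m}) \<and> (\<forall>C. good C \<longrightarrow> c_pis n {..<m} \<le> C))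
          \<and> (m \<ge> n \<longrightarrow> c_pis n {..<m} = kappa n))"
proof (intro conjI allI impI)
  show "kappa n = c_pis n UNIV" by (rule c_pis_eq_kappa[OF assms, symmetric]) simp
  show "\<exists>\<alpha> \<beta>. represents M n (distr P (Sn M n) X) \<alpha> \<beta> \<and> tv_norm (prob_algebra M) \<alpha> \<beta> \<le> kappa n"
    if "exchangeable P M n X" for M :: "'a measure" and P :: "'b measure" and X
    by (rule exch_dist_represents[OF assms exch_dist_exchangeable[OF that]])
  show "\<exists>(M :: nat measure) \<mu>. exch_dist M n \<mu> \<and>
    (\<forall>\<alpha> \<beta>. represents M n \<mu> \<alpha> \<beta> \<longrightarrow> tv_norm (prob_algebra M) \<alpha> \<beta> \<ge> kappa n)"
    by (rule kappa_best_possible[OF assms])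
  show "real n ^ n / fact n \<le> kappa n" by (rule le_kappa[OF assms])
  show "kappa n \<le> 2 ^ (n - 1) * real n ^ n / fact n" by (rule kappa_le[OF assms])
  fix M :: "'c measure" and m
  assume M: "finite (space M) \<and> card (space M) = m \<and> m \<ge> 1 \<and> sets M = Pow (space M)"
  obtain h where "bij_betw h {..<m} (space M)"
    using ex_bij_betw_nat_finite[of "space M"] M by (auto simp: atLeast0LessThan)
  then interpret finite_states M m h using M by unfold_locales auto
  show "let good = (\<lambda>C. \<forall>\<mu>. exch_dist M n \<mu> \<longrightarrow>
          (\<exists>\<alpha> \<beta>. represents M n \<mu> \<alpha> \<beta> \<and> tv_norm (prob_algebra M) \<alpha> \<beta> \<le> C))
        in good (c_pis n {..<m}) \<and> (\<forall>C. good C \<longrightarrow> c_pis n {..<m} \<le> C)"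
    unfolding Let_def using represents_finite[OF assms] c_pis_le[OF assms] M by blast
  show "c_pis n {..<m} = kappa n" if "m \<ge> n"
    by (rule c_pis_eq_kappa[OF assms]) (use that in auto)
qed

end
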